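(* Every $(\kappa,\mu)$-paracontact metric manifold is $H$-paracontact. Moreover, whenever $\kappa\neq-1$, the Reeb vector field $\xi$ of a paracontact $(\kappa,\mu)$-space $(M,\varphi,\xi,\eta,g)$ also defines a harmonic map $\xi:(M,g)\to(T_1M,g^s)$ into its unit tangent sphere bundle.
   Context: All manifolds are smooth and connected. A $(2n+1)$-dimensional contact manifold is a manifold $M^{2n+1}$ with a global 1-form $\eta$ such that $\eta\wedge(d\eta)^n\neq 0$ everywhere; its Reeb vector field $\xi$ is the unique vector field with $\eta(\xi)=1$, $d\eta(\xi,\cdot)=0$. A paracontact metric structure $(\varphi,\xi,\eta,g)$ on $M$ consists of such $\eta,\xi$, a semi-Riemannian metric $g$ and a $(1,1)$-tensor $\varphi$ with $\eta=g(\xi,\cdot)$, $d\eta(\cdot,\cdot)=g(\cdot,\varphi\,\cdot)$, $\varphi^2=I-\eta\otimes\xi$ (here $2\,d\eta(X,Y)=X\eta(Y)-Y\eta(X)-\eta([X,Y])$). $\nabla$ is the Levi-Civita connection, $R(X,Y)=R_{XY}=\nabla_{[X,Y]}-[\nabla_X,\nabla_Y]$, and $h=\frac12\mathcal L_\xi\varphi$. A paracontact metric manifold is a $(\kappa,\mu)$-space (or $(\kappa,\mu)$-paracontact metric manifold) if $R(X,Y)\xi=\kappa(\eta(X)Y-\eta(Y)X)+\mu(\eta(X)hY-\eta(Y)hX)$ for all vector fields $X,Y$, where $\kappa,\mu$ are smooth functions on $M$ ("$\kappa\ne-1$" is meant at every point). It is $H$-paracontact if $\xi$ is a harmonic vector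 field. Harmonic vector fields: the energy of a vector field $V$ on $(M,g)$ is the energy of the map $V:(M,g)\to(TM,g^s)$, $g^s$ the Sasaki metric (computed over relatively compact domains if $M$ is non-compact). A vector field $V$ of constant length $g(V,V)=r\neq 0$ is harmonic if it is a critical point of the energy restricted to vector fields of the same constant length $r$; equivalently, $\bar\Delta V$ is collinear to $V$, where $\bar\Delta V=-\mathrm{tr}\,\nabla^2V=\sum_i\varepsilon_i(\nabla_{\nabla_{E_i}E_i}V-\nabla_{E_i}\nabla_{E_i}V)$ for a local pseudo-orthonormal frame $\{E_i\}$, $\varepsilon_i=g(E_i,E_i)=\pm1$. $(T_1M,g^s)$ is the unit tangent sphere bundle $\{v\in TM: g(v,v)=1\}$ with the metric induced by the Sasaki metric; a unit vector field $V$ defines a harmonic map $V:(M,g)\to(T_1M,g^s)$ when $V$ is a harmonic vector field and $\mathrm{tr}[R(\nabla_\cdot V,V)\cdot]=\sum_i\varepsilon_iR(\nabla_{E_i}V,V)E_i=0$. *)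

theory Defs
  imports
    "HOL-Analysis.Analysis"
    "HOL-Combinatorics.Combinatorics"
    "HOL-Library.Function_Algebras"
begin

section \<open>Smooth manifolds\<close>

instantiation "fun" :: (type, real_vector) real_vector
begin

definition scaleR_fun :: "real \<Rightarrow> ('a \<Rightarrow> 'b) \<Rightarrow> 'a \<Rightarrow> 'b"
  where "scaleR_fun c f = (\<lambda>x. c *\<^sub>R f x)"

instance
  by standard (auto simp: scaleR_fun_def plus_fun_def fun_eq_iff algebra_simps)

end

text \<open>Only meaningful on open sets.\<close>

fun Ck_on :: "nat \<Rightarrow> ('e::real_normed_vector \<Rightarrow> 'b::real_normed_vector) \<Rightarrow> 'e set \<Rightarrow> bool"
  where
    "Ck_on 0 f S \<longleftrightarrow> continuous_on S f"
  | "Ck_on (Suc k) f S \<longleftrightarrow> (\<forall>x\<in>S. f differentiable (at x)) \<and>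
       (\<forall>v. Ck_on k (\<lambda>x. frechet_derivative f (at x) v) S)"

definition smooth_on :: "('e::real_normed_vector \<Rightarrow> 'b::real_normed_vector) \<Rightarrow> 'e set \<Rightarrow> bool"
  where "smooth_on f S \<longleftrightarrow> (\<forall>k. Ck_on k f S)"

text \<open>A chart is a pair of its domain and its coordinate map. The underlying set of the manifold is
  the whole type \<open>'a\<close>; the Hausdorff and countability axioms are the sort constraints below.\<close>

type_synonym ('a, 'n) chart = "'a set \<times> ('a \<Rightarrow> real^'n)"

definition smooth_manifold ::
    "('a::{t2_space,second_countable_topology}, 'n::finite) chart set \<Rightarrow> bool"
  where "smooth_manifold A \<longleftrightarrow>
    connected (UNIV :: 'a set) \<and>
    (\<Union>(U, x)\<in>A. U) = UNIV \<and>
    (\<forall>(U, x)\<in>A. open U \<and> open (x ` U) \<and> homeomorphism U (x ` U) x (inv_into U x)) \<and>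
    (\<forall>(U, x)\<in>A. \<forall>(V, y)\<in>A. smooth_on (y \<circ> inv_into U x) (x ` (U \<inter> V)))"

definition smooth_fun :: "('a, 'n::finite) chart set \<Rightarrow> ('a \<Rightarrow> real) \<Rightarrow> bool"
  where "smooth_fun A f \<longleftrightarrow> (\<forall>(U, x)\<in>A. smooth_on (f \<circ> inv_into U x) (x ` U))"

text \<open>Tangent vectors at \<open>p\<close> are derivations at \<open>p\<close> of the algebra of smooth functions. They are
  required to vanish on non-smooth functions, so that equality of tangent vectors (and of vector
  fields) is equality of HOL functions.\<close>

type_synonym 'a tvec = "('a \<Rightarrow> real) \<Rightarrow> real"
type_synonym 'a vfield = "'a \<Rightarrow> 'a tvec"

definition tangent_space :: "('a, 'n::finite) chart set \<Rightarrow> 'a \<Rightarrow> 'a tvec set"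
  where "tangent_space A p = {v.
    (\<forall>f h. smooth_fun A f \<longrightarrow> smooth_fun A h \<longrightarrow>
       v (\<lambda>q. f q + h q) = v f + v h \<and> v (\<lambda>q. f q * h q) = v f * h p + f p * v h) \<and>
    (\<forall>c f. smooth_fun A f \<longrightarrow> v (\<lambda>q. c * f q) = c * v f) \<and>
    (\<forall>f. \<not> smooth_fun A f \<longrightarrow> v f = 0)}"

definition vfields :: "('a, 'n::finite) chart set \<Rightarrow> 'a vfield set"
  where "vfields A = {X. (\<forall>p. X p \<in> tangent_space A p) \<and>
    (\<forall>f. smooth_fun A f \<longrightarrow> smooth_fun A (\<lambda>p. X p f))}"

definition smul :: "('a \<Rightarrow> real) \<Rightarrow> 'a vfield \<Rightarrow> 'a vfield"
  where "smul f X = (\<lambda>p. f p *\<^sub>R X p)"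

definition bracket :: "'a vfield \<Rightarrow> 'a vfield \<Rightarrow> 'a vfield"
  where "bracket X Y = (\<lambda>p f. X p (\<lambda>q. Y q f) - Y p (\<lambda>q. X q f))"

definition coord_vec :: "('a, 'n::finite) chart set \<Rightarrow> ('a, 'n) chart \<Rightarrow> 'n \<Rightarrow> 'a vfield"
  where "coord_vec A c i = (\<lambda>p f. if smooth_fun A f
    then frechet_derivative (f \<circ> inv_into (fst c) (snd c)) (at (snd c p)) (axis i 1) else 0)"

section \<open>Tensor fields, metrics and connections\<close>

text \<open>Tensor fields are families of multilinear maps on the tangent spaces; their values off the
  tangent spaces are irrelevant. Smoothness means that smooth vector fields are taken to smooth
  functions or vector fields.\<close>

definition one_form :: "('a, 'n::finite) chart set \<Rightarrow> ('a \<Rightarrow> 'a tvec \<Rightarrow> real) \<Rightarrow> bool"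
  where "one_form A \<eta> \<longleftrightarrow>
    (\<forall>p. \<forall>v\<in>tangent_space A p. \<forall>w\<in>tangent_space A p. \<forall>a b.
       \<eta> p (a *\<^sub>R v + b *\<^sub>R w) = a * \<eta> p v + b * \<eta> p w) \<and>
    (\<forall>X\<in>vfields A. smooth_fun A (\<lambda>p. \<eta> p (X p)))"

definition endo_field :: "('a, 'n::finite) chart set \<Rightarrow> ('a \<Rightarrow> 'a tvec \<Rightarrow> 'a tvec) \<Rightarrow> bool"
  where "endo_field A \<phi> \<longleftrightarrow>
    (\<forall>p. \<forall>v\<in>tangent_space A p. \<phi> p v \<in> tangent_space A p) \<and>
    (\<forall>p. \<forall>v\<in>tangent_space A p. \<forall>w\<in>tangent_space A p. \<forall>a b.
       \<phi> p (a *\<^sub>R v + b *\<^sub>R w) = a *\<^sub>R \<phi> p v + b *\<^sub>R \<phi> p w) \<and>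
    (\<forall>X\<in>vfields A. (\<lambda>p. \<phi> p (X p)) \<in> vfields A)"

text \<open>The index of the metric is constant automatically, since manifolds are connected.\<close>

definition semi_riemannian ::
    "('a, 'n::finite) chart set \<Rightarrow> ('a \<Rightarrow> 'a tvec \<Rightarrow> 'a tvec \<Rightarrow> real) \<Rightarrow> bool"
  where "semi_riemannian A g \<longleftrightarrow>
    (\<forall>p. \<forall>u\<in>tangent_space A p. \<forall>v\<in>tangent_space A p. \<forall>w\<in>tangent_space A p. \<forall>a b.
       g p (a *\<^sub>R u + b *\<^sub>R v) w = a * g p u w + b * g p v w) \<and>
    (\<forall>p. \<forall>v\<in>tangent_space A p. \<forall>w\<in>tangent_space A p. g p v w = g p w v) \<and>
    (\<forall>p. \<forall>v\<in>tangent_space A p. (\<forall>w\<in>tangent_space A p. g p v w = 0) \<longrightarrow> v = 0) \<and>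
    (\<forall>X\<in>vfields A. \<forall>Y\<in>vfields A. smooth_fun A (\<lambda>p. g p (X p) (Y p)))"

definition levi_civita ::
    "('a, 'n::finite) chart set \<Rightarrow> ('a \<Rightarrow> 'a tvec \<Rightarrow> 'a tvec \<Rightarrow> real) \<Rightarrow>
     ('a vfield \<Rightarrow> 'a vfield \<Rightarrow> 'a vfield) \<Rightarrow> bool"
  where "levi_civita A g nabla \<longleftrightarrow>
    (\<forall>X\<in>vfields A. \<forall>Y\<in>vfields A. nabla X Y \<in> vfields A) \<and>
    (\<forall>X\<in>vfields A. \<forall>Y\<in>vfields A. \<forall>Z\<in>vfields A.
       nabla (X + Y) Z = nabla X Z + nabla Y Z \<and>
       nabla Z (X + Y) = nabla Z X + nabla Z Y) \<and>
    (\<forall>f. smooth_fun A f \<longrightarrow> (\<forall>X\<in>vfields A. \<forall>Y\<in>vfields A.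
       nabla (smul f X) Y = smul f (nabla X Y) \<and>
       nabla X (smul f Y) = smul (\<lambda>p. X p f) Y + smul f (nabla X Y))) \<and>
    (\<forall>X\<in>vfields A. \<forall>Y\<in>vfields A. nabla X Y - nabla Y X = bracket X Y) \<and>
    (\<forall>X\<in>vfields A. \<forall>Y\<in>vfields A. \<forall>Z\<in>vfields A. \<forall>p.
       X p (\<lambda>q. g q (Y q) (Z q)) = g p (nabla X Y p) (Z p) + g p (Y p) (nabla X Z p))"

text \<open>The sign is opposite to the more common convention.\<close>

definition curvature ::
    "('a vfield \<Rightarrow> 'a vfield \<Rightarrow> 'a vfield) \<Rightarrow> 'a vfield \<Rightarrow> 'a vfield \<Rightarrow> 'a vfield \<Rightarrow> 'a vfield"
  where "curvature nabla X Y Z =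
    nabla (bracket X Y) Z - (nabla X (nabla Y Z) - nabla Y (nabla X Z))"

definition frame_at ::
    "('a, 'n::finite) chart set \<Rightarrow> ('a \<Rightarrow> 'a tvec \<Rightarrow> 'a tvec \<Rightarrow> real) \<Rightarrow> 'a \<Rightarrow>
     ('n \<Rightarrow> 'a vfield) \<Rightarrow> bool"
  where "frame_at A g p E \<longleftrightarrow>
    (\<forall>i. E i \<in> vfields A \<and> \<bar>g p (E i p) (E i p)\<bar> = 1) \<and>
    (\<forall>i j. i \<noteq> j \<longrightarrow> g p (E i p) (E j p) = 0)"

text \<open>The metric trace of \<open>B\<close> at \<open>p\<close>. It is applied only to \<open>B\<close> whose value at \<open>p\<close> depends
  bilinearly on the values of the arguments at \<open>p\<close>, so it does not depend on the chosen frame, and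
  fields that form a pseudo-orthonormal frame at \<open>p\<close> alone suffice.\<close>

definition metric_trace ::
    "('a, 'n::finite) chart set \<Rightarrow> ('a \<Rightarrow> 'a tvec \<Rightarrow> 'a tvec \<Rightarrow> real) \<Rightarrow>
     ('a vfield \<Rightarrow> 'a vfield \<Rightarrow> 'a \<Rightarrow> 'b::real_vector) \<Rightarrow> 'a \<Rightarrow> 'b"
  where "metric_trace A g B p =
    (let E = (SOME E. frame_at A g p E)
     in \<Sum>i\<in>UNIV. g p (E i p) (E i p) *\<^sub>R B (E i) (E i) p)"

text \<open>In every chart the volume measure of \<open>g\<close> has density \<open>sqrt \<bar>det (g\<^sub>i\<^sub>j)\<bar>\<close>. As countably many
  charts cover the manifold, this determines the measure.\<close>

definition volume_measure ::
    "('a::topological_space, 'n::finite) chart set \<Rightarrow> ('a \<Rightarrow> 'a tvec \<Rightarrow> 'a tvec \<Rightarrow> real) \<Rightarrow>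
     'a measure \<Rightarrow> bool"
  where "volume_measure A g vol \<longleftrightarrow>
    sets vol = sets borel \<and>
    (\<forall>(U, x)\<in>A. \<forall>B\<in>sets borel. B \<subseteq> U \<longrightarrow>
       emeasure vol B = (\<integral>\<^sup>+y\<in>x ` B.
         ennreal (sqrt \<bar>det (\<chi> i j. let p = inv_into U x y in
           g p (coord_vec A (U, x) i p) (coord_vec A (U, x) j p))\<bar>) \<partial>lborel))"

section \<open>Harmonic vector fields\<close>

text \<open>The pullback along \<open>V\<close> of the Sasaki metric: the Sasaki metric makes horizontal and vertical
  vectors orthogonal and restricts to \<open>g\<close> on both, and \<open>dV(X)\<close> is the sum of the horizontal lift of
  \<open>X\<close> and the vertical lift of \<open>\<nabla>\<^sub>X V\<close>.\<close>

definition sasaki_pullback ::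
    "('a \<Rightarrow> 'a tvec \<Rightarrow> 'a tvec \<Rightarrow> real) \<Rightarrow> ('a vfield \<Rightarrow> 'a vfield \<Rightarrow> 'a vfield) \<Rightarrow>
     'a vfield \<Rightarrow> 'a vfield \<Rightarrow> 'a vfield \<Rightarrow> 'a \<Rightarrow> real"
  where "sasaki_pullback g nabla V X Y p =
    g p (X p) (Y p) + g p (nabla X V p) (nabla Y V p)"

definition energy ::
    "('a, 'n::finite) chart set \<Rightarrow> ('a \<Rightarrow> 'a tvec \<Rightarrow> 'a tvec \<Rightarrow> real) \<Rightarrow>
     ('a vfield \<Rightarrow> 'a vfield \<Rightarrow> 'a vfield) \<Rightarrow> 'a measure \<Rightarrow> 'a set \<Rightarrow> 'a vfield \<Rightarrow> real"
  where "energy A g nabla vol D V =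
    1/2 * (LINT p:D|vol. metric_trace A g (sasaki_pullback g nabla V) p)"

text \<open>Smooth variations of \<open>V\<close> for \<open>\<bar>t\<bar> < \<epsilon>\<close> through vector fields of constant length \<open>r\<close>, fixed
  outside a compact subset of \<open>D\<close>.\<close>

definition length_variation ::
    "('a::topological_space, 'n::finite) chart set \<Rightarrow> ('a \<Rightarrow> 'a tvec \<Rightarrow> 'a tvec \<Rightarrow> real) \<Rightarrow>
     real \<Rightarrow> 'a set \<Rightarrow> 'a vfield \<Rightarrow> real \<Rightarrow> (real \<Rightarrow> 'a vfield) \<Rightarrow> bool"
  where "length_variation A g r D V \<epsilon> W \<longleftrightarrow>
    \<epsilon> > 0 \<and> W 0 = V \<and>
    (\<forall>t\<in>{-\<epsilon><..<\<epsilon>}. W t \<in> vfields A \<and> (\<forall>p. g p (W t p) (W t p) = r)) \<and>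
    (\<forall>f. smooth_fun A f \<longrightarrow> (\<forall>(U, x)\<in>A.
       smooth_on (\<lambda>(t, y). W t (inv_into U x y) f) ({-\<epsilon><..<\<epsilon>} \<times> x ` U))) \<and>
    (\<exists>K. compact K \<and> K \<subseteq> D \<and> (\<forall>t\<in>{-\<epsilon><..<\<epsilon>}. \<forall>p. p \<notin> K \<longrightarrow> W t p = V p))"

definition harmonic_vector_field ::
    "('a::topological_space, 'n::finite) chart set \<Rightarrow> ('a \<Rightarrow> 'a tvec \<Rightarrow> 'a tvec \<Rightarrow> real) \<Rightarrow>
     ('a vfield \<Rightarrow> 'a vfield \<Rightarrow> 'a vfield) \<Rightarrow> 'a measure \<Rightarrow> 'a vfield \<Rightarrow> bool"
  where "harmonic_vector_field A g nabla vol V \<longleftrightarrow>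
    V \<in> vfields A \<and>
    (\<exists>r. r \<noteq> 0 \<and> (\<forall>p. g p (V p) (V p) = r) \<and>
      (\<forall>D \<epsilon> W. open D \<longrightarrow> compact (closure D) \<longrightarrow> length_variation A g r D V \<epsilon> W \<longrightarrow>
         ((\<lambda>t. energy A g nabla vol D (W t)) has_real_derivative 0) (at 0)))"

text \<open>Harmonicity of a unit vector field as a map into the unit tangent sphere bundle with the
  metric induced by the Sasaki metric.\<close>

definition defines_harmonic_map ::
    "('a::topological_space, 'n::finite) chart set \<Rightarrow> ('a \<Rightarrow> 'a tvec \<Rightarrow> 'a tvec \<Rightarrow> real) \<Rightarrow>
     ('a vfield \<Rightarrow> 'a vfield \<Rightarrow> 'a vfield) \<Rightarrow> 'a measure \<Rightarrow> 'a vfield \<Rightarrow> bool"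
  where "defines_harmonic_map A g nabla vol V \<longleftrightarrow>
    (\<forall>p. g p (V p) (V p) = 1) \<and>
    harmonic_vector_field A g nabla vol V \<and>
    (\<forall>p. metric_trace A g (\<lambda>X Y. curvature nabla (nabla X V) V Y) p = 0)"

section \<open>Paracontact metric structures\<close>

definition ext_deriv :: "('a \<Rightarrow> 'a tvec \<Rightarrow> real) \<Rightarrow> 'a vfield \<Rightarrow> 'a vfield \<Rightarrow> 'a \<Rightarrow> real"
  where "ext_deriv \<eta> X Y p =
    1/2 * (X p (\<lambda>q. \<eta> q (Y q)) - Y p (\<lambda>q. \<eta> q (X q)) - \<eta> p (bracket X Y p))"

text \<open>The value of \<open>\<eta> \<and> (d\<eta>)\<^sup>n\<close> at \<open>p\<close> on \<open>X 0, \<dots>, X (2n)\<close>, up to a positive constant factor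
  depending on \<open>n\<close> and on the normalisation of the wedge product.\<close>

definition contact_volume ::
    "('a \<Rightarrow> 'a tvec \<Rightarrow> real) \<Rightarrow> nat \<Rightarrow> (nat \<Rightarrow> 'a vfield) \<Rightarrow> 'a \<Rightarrow> real"
  where "contact_volume \<eta> n X p =
    (\<Sum>\<sigma> | \<sigma> permutes {..<2 * n + 1}. of_int (sign \<sigma>) * \<eta> p (X (\<sigma> 0) p) *
       (\<Prod>i<n. ext_deriv \<eta> (X (\<sigma> (2 * i + 1))) (X (\<sigma> (2 * i + 2))) p))"

definition contact_form :: "('a, 'n::finite) chart set \<Rightarrow> nat \<Rightarrow> ('a \<Rightarrow> 'a tvec \<Rightarrow> real) \<Rightarrow> bool"
  where "contact_form A n \<eta> \<longleftrightarrow> one_form A \<eta> \<and>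
    (\<forall>p. \<exists>X. (\<forall>i. X i \<in> vfields A) \<and> contact_volume \<eta> n X p \<noteq> 0)"

definition reeb_field ::
    "('a, 'n::finite) chart set \<Rightarrow> ('a \<Rightarrow> 'a tvec \<Rightarrow> real) \<Rightarrow> 'a vfield \<Rightarrow> bool"
  where "reeb_field A \<eta> \<xi> \<longleftrightarrow> \<xi> \<in> vfields A \<and> (\<forall>p. \<eta> p (\<xi> p) = 1) \<and>
    (\<forall>X\<in>vfields A. \<forall>p. ext_deriv \<eta> \<xi> X p = 0)"

definition paracontact_metric_manifold ::
    "('a::{t2_space,second_countable_topology}, 'n::finite) chart set \<Rightarrow> nat \<Rightarrow>
     ('a \<Rightarrow> 'a tvec \<Rightarrow> 'a tvec) \<Rightarrow> 'a vfield \<Rightarrow> ('a \<Rightarrow> 'a tvec \<Rightarrow> real) \<Rightarrow>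
     ('a \<Rightarrow> 'a tvec \<Rightarrow> 'a tvec \<Rightarrow> real) \<Rightarrow> bool"
  where "paracontact_metric_manifold A n \<phi> \<xi> \<eta> g \<longleftrightarrow>
    smooth_manifold A \<and> CARD('n) = 2 * n + 1 \<and>
    contact_form A n \<eta> \<and> reeb_field A \<eta> \<xi> \<and> semi_riemannian A g \<and> endo_field A \<phi> \<and>
    (\<forall>p. \<forall>v\<in>tangent_space A p. \<eta> p v = g p (\<xi> p) v) \<and>
    (\<forall>X\<in>vfields A. \<forall>Y\<in>vfields A. \<forall>p. ext_deriv \<eta> X Y p = g p (X p) (\<phi> p (Y p))) \<and>
    (\<forall>p. \<forall>v\<in>tangent_space A p. \<phi> p (\<phi> p v) = v - \<eta> p v *\<^sub>R \<xi> p)"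

text \<open>Half the Lie derivative of \<open>\<phi>\<close> along \<open>\<xi>\<close>.\<close>

definition h_tensor :: "('a \<Rightarrow> 'a tvec \<Rightarrow> 'a tvec) \<Rightarrow> 'a vfield \<Rightarrow> 'a vfield \<Rightarrow> 'a vfield"
  where "h_tensor \<phi> \<xi> X =
    (1/2) *\<^sub>R (bracket \<xi> (\<lambda>p. \<phi> p (X p)) - (\<lambda>p. \<phi> p (bracket \<xi> X p)))"

definition kappa_mu_space ::
    "('a::{t2_space,second_countable_topology}, 'n::finite) chart set \<Rightarrow> nat \<Rightarrow>
     ('a \<Rightarrow> 'a tvec \<Rightarrow> 'a tvec) \<Rightarrow> 'a vfield \<Rightarrow> ('a \<Rightarrow> 'a tvec \<Rightarrow> real) \<Rightarrow>
     ('a \<Rightarrow> 'a tvec \<Rightarrow> 'a tvec \<Rightarrow> real) \<Rightarrow> ('a vfield \<Rightarrow> 'a vfield \<Rightarrow> 'a vfield) \<Rightarrow>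
     ('a \<Rightarrow> real) \<Rightarrow> ('a \<Rightarrow> real) \<Rightarrow> bool"
  where "kappa_mu_space A n \<phi> \<xi> \<eta> g nabla \<kappa> \<mu> \<longleftrightarrow>
    paracontact_metric_manifold A n \<phi> \<xi> \<eta> g \<and> smooth_fun A \<kappa> \<and> smooth_fun A \<mu> \<and>
    (\<forall>X\<in>vfields A. \<forall>Y\<in>vfields A. \<forall>p.
       curvature nabla X Y \<xi> p =
         \<kappa> p *\<^sub>R (\<eta> p (X p) *\<^sub>R Y p - \<eta> p (Y p) *\<^sub>R X p) +
         \<mu> p *\<^sub>R (\<eta> p (X p) *\<^sub>R h_tensor \<phi> \<xi> Y p - \<eta> p (Y p) *\<^sub>R h_tensor \<phi> \<xi> X p))"

definition H_paracontact ::
    "('a::{t2_space,second_countable_topology}, 'n::finite) chart set \<Rightarrow> nat \<Rightarrow>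
     ('a \<Rightarrow> 'a tvec \<Rightarrow> 'a tvec) \<Rightarrow> 'a vfield \<Rightarrow> ('a \<Rightarrow> 'a tvec \<Rightarrow> real) \<Rightarrow>
     ('a \<Rightarrow> 'a tvec \<Rightarrow> 'a tvec \<Rightarrow> real) \<Rightarrow> ('a vfield \<Rightarrow> 'a vfield \<Rightarrow> 'a vfield) \<Rightarrow>
     'a measure \<Rightarrow> bool"
  where "H_paracontact A n \<phi> \<xi> \<eta> g nabla vol \<longleftrightarrow>
    paracontact_metric_manifold A n \<phi> \<xi> \<eta> g \<and> harmonic_vector_field A g nabla vol \<xi>"

end

theory Submission
  imports Defs
begin

text \<open>
  Write \<open>\<nabla>\<xi> = -\<phi> + S\<close>. Closedness of \<open>d\<eta>\<close> and \<open>\<phi>\<^sup>2 = I - \<eta> \<otimes> \<xi>\<close> force \<open>S\<close> to be symmetric,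
  to anticommute with \<open>\<phi>\<close> and to satisfy \<open>h = \<phi> S\<close>; hence \<open>S\<close>, \<open>\<nabla>\<xi>\<close> and \<open>h \<nabla>\<xi>\<close> are trace free.
  The Codazzi equation expresses \<open>tr \<nabla>\<^sup>2\<xi>\<close> through the Ricci tensor and the divergence of \<open>\<phi>\<close>, both of
  which are proportional to \<open>\<xi>\<close>, so the rough Laplacian of \<open>\<xi>\<close> is collinear to \<open>\<xi>\<close>.

  Let \<open>W\<^sub>t = \<xi> + Z\<^sub>t\<close> be a variation of constant length. Then \<open>g(\<xi>, Z\<^sub>t) = -|Z\<^sub>t|\<^sup>2/2\<close> is of second order
  in \<open>t\<close>, so up to the divergence of a compactly supported field the energy density changes only by
  terms that are quadratic in \<open>Z\<^sub>t\<close> and \<open>\<nabla>Z\<^sub>t\<close>. By the divergence theorem the energy changes by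
  \<open>O(t\<^sup>2)\<close>; no differentiation under the integral sign is needed.

  The remaining condition \<open>tr R(\<nabla>\<^sub>\<cdot>\<xi>, \<xi>)\<cdot> = 0\<close> reduces by the pair symmetry of \<open>R\<close> to the vanishing
  of the traces of \<open>\<nabla>\<xi>\<close> and \<open>h \<nabla>\<xi>\<close>.
\<close>

section \<open>Calculus of functions of class \<open>C\<^sup>k\<close>\<close>

text \<open>\<open>harmonic_vector_field\<close> asks that the energy be stationary under every
  admissible variation, so criticality is shown on the integrals themselves and not through the
  rough Laplacian criterion. Three features shape the development. Fields, tensors and connections
  are global, so coordinates enter only after multiplication by a cutoff that is 1 near the point.
  \<open>metric_trace\<close> picks unrelated frames at different points, so a trace is never
  differentiated, and its continuity is read off the inverse Gram matrix. The metric is indefinite: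
  a nonzero vector may be null and g yields no norm, so quadratic terms are estimated through
  coordinate components and their first derivatives. The cancellation at the core: the part of the
  energy density linear in Z is 2 tr g(\<nabla>\<xi>, \<nabla>Z). It equals twice the divergence of
  the adjoint of \<nabla>\<xi> applied to Z, minus 2 g(tr \<nabla>\<nabla>\<xi>, Z). As tr
  \<nabla>\<nabla>\<xi> is a multiple of \<xi>, the last term only sees g(\<xi>, Z), which the
  length constraint makes quadratic.\<close>

lemma Ck_on_cong:
  assumes "open S" "\<And>x. x \<in> S \<Longrightarrow> f x = g x" "Ck_on k f S"
  shows "Ck_on k g S"
  using assms(2,3)
proof (induction k arbitrary: f g)
  case 0
  then show ?case by (simp cong: continuous_on_cong)
next
  case (Suc k)
  have D: "(g has_derivative frechet_derivative f (at x)) (at x)" if x: "x \<in> S" for x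
  proof -
    have "(f has_derivative frechet_derivative f (at x)) (at x)"
      using Suc.prems(2) x by (simp add: frechet_derivative_works)
    then show ?thesis
      using has_derivative_transform_within_open[OF _ assms(1) x] Suc.prems(1) by blast
  qed
  then have "frechet_derivative f (at x) v = frechet_derivative g (at x) v" if "x \<in> S" for x v
    using frechet_derivative_at[OF D[OF that]] by simp
  then have "Ck_on k (\<lambda>x. frechet_derivative g (at x) v) S" for v
    using Suc.IH[of "\<lambda>x. frechet_derivative f (at x) v"] Suc.prems(2) by simp
  then show ?case
    using D by (auto simp: differentiable_def)
qed

text \<open>Allows an explicitly computed derivative in place of the choice
  \<open>frechet_derivative\<close>; the inductions on the order of differentiability below run
  through it.\<close>

lemma Ck_on_SucI:
  assumes "open S"
    and D: "\<And>x. x \<in> S \<Longrightarrow> (f has_derivative f' x) (at x)"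
    and C: "\<And>v. Ck_on k (\<lambda>x. f' x v) S"
  shows "Ck_on (Suc k) f S"
proof -
  have "f' x v = frechet_derivative f (at x) v" if "x \<in> S" for x v
    using frechet_derivative_at[OF D[OF that]] by simp
  then have "Ck_on k (\<lambda>x. frechet_derivative f (at x) v) S" for v
    using Ck_on_cong[OF assms(1) _ C[of v]] by simp
  then show ?thesis
    using D by (auto simp: differentiable_def)
qed

lemma Ck_on_has_derivative:
  assumes "Ck_on (Suc k) f S" "x \<in> S"
  shows "(f has_derivative frechet_derivative f (at x)) (at x)"
  using assms by (simp add: frechet_derivative_works)

lemma Ck_on_Suc_imp: "Ck_on (Suc k) f S \<Longrightarrow> Ck_on k f S"
proof (induction k arbitrary: f)
  case 0
  then show ?case
    by (simp add: differentiable_imp_continuous_within differentiable_at_imp_differentiable_on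
        differentiable_imp_continuous_on)
next
  case (Suc k)
  then show ?case by auto
qed

lemma Ck_on_mono: "Ck_on k f S \<Longrightarrow> j \<le> k \<Longrightarrow> Ck_on j f S"
  by (induction k) (auto simp: le_Suc_eq simp del: Ck_on.simps dest: Ck_on_Suc_imp)

lemma Ck_on_subset: "Ck_on k f S \<Longrightarrow> T \<subseteq> S \<Longrightarrow> Ck_on k f T"
  by (induction k arbitrary: f) (auto intro: continuous_on_subset)

lemma Ck_on_local:
  assumes "\<And>x. x \<in> S \<Longrightarrow> \<exists>T. open T \<and> x \<in> T \<and> Ck_on k f T"
  shows "Ck_on k f S"
  using assms
proof (induction k arbitrary: f)
  case 0
  have "continuous (at x) f" if x: "x \<in> S" for x
    using 0[OF x] continuous_on_interior by (metis Ck_on.simps(1) interior_open)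
  then show ?case by (simp add: continuous_at_imp_continuous_on)
next
  case (Suc k)
  then show ?case
    by (simp) (metis)
qed

lemma Ck_on_const: "Ck_on k (\<lambda>x. c) S"
  by (induction k arbitrary: c) auto

lemma Ck_on_bounded_linear_comp:
  assumes L: "bounded_linear L" and "open S"
  shows "Ck_on k f S \<Longrightarrow> Ck_on k (\<lambda>x. L (f x)) S"
proof (induction k arbitrary: f)
  case 0
  then show ?case by (simp add: L bounded_linear.continuous_on)
next
  case (Suc k)
  show ?case
    by (rule Ck_on_SucI[OF assms(2) bounded_linear.has_derivative[OF L Ck_on_has_derivative]])
      (use Suc in auto)
qed

lemma Ck_on_bounded_linear: "bounded_linear L \<Longrightarrow> Ck_on k L S"
proof (rule Ck_on_subset[of _ _ UNIV])
  assume L: "bounded_linear L"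
  show "Ck_on k L UNIV"
  proof (cases k)
    case 0
    then show ?thesis by (simp add: L linear_continuous_on)
  next
    case (Suc j)
    show ?thesis unfolding Suc
      by (rule Ck_on_SucI[OF open_UNIV bounded_linear_imp_has_derivative[OF L]])
        (rule Ck_on_const)
  qed
qed simp

lemma Ck_on_add:
  assumes "open S"
  shows "Ck_on k f S \<Longrightarrow> Ck_on k g S \<Longrightarrow> Ck_on k (\<lambda>x. f x + g x) S"
proof (induction k arbitrary: f g)
  case 0
  then show ?case by (simp add: continuous_on_add)
next
  case (Suc k)
  show ?case
    by (rule Ck_on_SucI[OF assms has_derivative_add[OF Ck_on_has_derivative Ck_on_has_derivative]])
      (use Suc in auto)
qed

lemma Ck_on_sum:
  assumes "open S" "\<And>i. i \<in> I \<Longrightarrow> Ck_on k (f i) S"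
  shows "Ck_on k (\<lambda>x. \<Sum>i\<in>I. f i x) S"
  using assms(2)
  by (induction I rule: infinite_finite_induct) (auto intro!: Ck_on_add assms(1) Ck_on_const)

lemma Ck_on_mult:
  fixes f g :: "'a::real_normed_vector \<Rightarrow> real"
  assumes "open S"
  shows "Ck_on k f S \<Longrightarrow> Ck_on k g S \<Longrightarrow> Ck_on k (\<lambda>x. f x * g x) S"
proof (induction k arbitrary: f g)
  case 0
  then show ?case by (simp add: continuous_on_mult)
next
  case (Suc k)
  note D = Suc.prems[THEN Ck_on_Suc_imp]
  show ?case
    by (rule Ck_on_SucI[OF assms has_derivative_mult[OF Ck_on_has_derivative Ck_on_has_derivative]])
      (use Suc D in \<open>auto intro!: Ck_on_add assms\<close>)
qed

lemma Ck_on_prod: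
  fixes f :: "'i \<Rightarrow> 'a::real_normed_vector \<Rightarrow> real"
  assumes "open S" "\<And>i. i \<in> I \<Longrightarrow> Ck_on k (f i) S"
  shows "Ck_on k (\<lambda>x. \<Prod>i\<in>I. f i x) S"
  using assms(2)
  by (induction I rule: infinite_finite_induct) (auto intro!: Ck_on_mult assms(1) Ck_on_const)

lemma Ck_on_cmult:
  fixes f :: "'a::real_normed_vector \<Rightarrow> real"
  shows "open S \<Longrightarrow> Ck_on k f S \<Longrightarrow> Ck_on k (\<lambda>x. c * f x) S"
  by (rule Ck_on_mult[OF _ Ck_on_const])

lemma Ck_on_diff:
  fixes f g :: "'a::real_normed_vector \<Rightarrow> real"
  shows "open S \<Longrightarrow> Ck_on k f S \<Longrightarrow> Ck_on k g S \<Longrightarrow> Ck_on k (\<lambda>x. f x - g x) S"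
  using Ck_on_add[of S k f "\<lambda>x. -1 * g x"] Ck_on_cmult[of S k g "-1"] by simp

text \<open>Expanding the inner derivative in the basis turns the chain rule into a sum of products
  of scalar functions. Each partial derivative of \<open>f\<close> is again scalar-valued, so the
  induction hypothesis applies to its composite with \<open>g\<close>.\<close>

lemma Ck_on_compose:
  fixes f :: "'b::euclidean_space \<Rightarrow> real"
  assumes "open S" "open T" "g ` S \<subseteq> T"
  shows "Ck_on k f T \<Longrightarrow> Ck_on k g S \<Longrightarrow> Ck_on k (\<lambda>x. f (g x)) S"
proof (induction k arbitrary: f)
  case 0
  then show ?case using continuous_on_compose2[of T f S g] assms(3) by simp
next
  case (Suc k)
  define f' where "f' v = (\<lambda>x. \<Sum>b\<in>Basis. (frechet_derivative g (at x) v \<bullet> b) *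
      frechet_derivative f (at (g x)) b)" for v
  show ?case
  proof (rule Ck_on_SucI[OF assms(1), where f' = "\<lambda>x v. f' v x"])
    fix x assume x: "x \<in> S"
    have gx: "g x \<in> T" using x assms(3) by auto
    note df = Ck_on_has_derivative[OF Suc.prems(1) gx]
    interpret bounded_linear "frechet_derivative f (at (g x))"
      using df has_derivative_bounded_linear by blast
    have "frechet_derivative f (at (g x)) w =
        (\<Sum>b\<in>Basis. (w \<bullet> b) * frechet_derivative f (at (g x)) b)" for w
    proof -
      have "frechet_derivative f (at (g x)) (\<Sum>b\<in>Basis. (w \<bullet> b) *\<^sub>R b) =
          (\<Sum>b\<in>Basis. (w \<bullet> b) *\<^sub>R frechet_derivative f (at (g x)) b)"
        by (simp only: sum scaleR)
      then show ?thesis by (simp add: euclidean_representation)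
    qed
    then have eq: "(\<lambda>v. frechet_derivative f (at (g x)) (frechet_derivative g (at x) v)) =
        (\<lambda>v. f' v x)"
      unfolding f'_def by (rule ext)
    show "((\<lambda>x. f (g x)) has_derivative (\<lambda>v. f' v x)) (at x)"
      using has_derivative_compose[OF Ck_on_has_derivative[OF Suc.prems(2) x] df] eq by simp
  next
    fix v
    show "Ck_on k (f' v) S"
      unfolding f'_def
    proof (intro Ck_on_sum assms(1) Ck_on_mult)
      fix b :: 'b assume "b \<in> Basis"
      show "Ck_on k (\<lambda>x. frechet_derivative g (at x) v \<bullet> b) S"
        by (rule Ck_on_bounded_linear_comp[OF bounded_linear_inner_left assms(1)])
          (use Suc.prems(2) in simp)
      show "Ck_on k (\<lambda>x. frechet_derivative f (at (g x)) b) S"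
        using Suc.IH[of "\<lambda>y. frechet_derivative f (at y) b"] Suc.prems Ck_on_Suc_imp
        by auto
    qed
  qed
qed

lemma Ck_on_inverse:
  fixes f :: "'a::real_normed_vector \<Rightarrow> real"
  assumes "open S" "\<And>x. x \<in> S \<Longrightarrow> f x \<noteq> 0"
  shows "Ck_on k f S \<Longrightarrow> Ck_on k (\<lambda>x. inverse (f x)) S"
proof (induction k)
  case 0
  then show ?case using assms(2) by (simp add: continuous_on_inverse)
next
  case (Suc k)
  note 1 = Suc.IH[OF Ck_on_Suc_imp[OF Suc.prems]]
  show ?case
  proof (rule Ck_on_SucI[OF assms(1)])
    fix x assume x: "x \<in> S"
    show "((\<lambda>x. inverse (f x)) has_derivative
        (\<lambda>v. (-1) * (inverse (f x) * (frechet_derivative f (at x) v * inverse (f x))))) (at x)"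
      using Deriv.has_derivative_inverse[OF assms(2)[OF x] Ck_on_has_derivative[OF Suc.prems x]]
      by (simp add: mult.assoc)
  next
    fix v
    show "Ck_on k (\<lambda>x. (-1) * (inverse (f x) * (frechet_derivative f (at x) v * inverse (f x)))) S"
      using Suc.prems by (intro Ck_on_mult Ck_on_const assms(1) 1) auto
  qed
qed

text \<open>The two claims support each other: the derivative of \<open>sqrt\<close> is half its
  inverse, which gains one order for \<open>sqrt\<close>, and inverting passes this order on to the
  reciprocal.\<close>

lemma Ck_on_sqrt_powers: "Ck_on k (\<lambda>x. inverse (sqrt x)) {0<..} \<and> Ck_on k sqrt {0<..}"
proof (induction k)
  case 0
  then show ?case by (auto intro!: continuous_intros)
next
  case (Suc k)
  have "Ck_on (Suc k) sqrt {0<..}"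
  proof (rule Ck_on_SucI)
    fix x :: real assume "x \<in> {0<..}"
    then have "(sqrt has_derivative (*) (inverse (sqrt x) / 2)) (at x)"
      using DERIV_real_sqrt[of x, unfolded has_field_derivative_def] by simp
    then show "(sqrt has_derivative (\<lambda>v. v * (inverse (sqrt x) / 2))) (at x)"
      by (rule has_derivative_eq_rhs) (simp add: fun_eq_iff)
  next
    fix v :: real
    have "Ck_on k (\<lambda>x. (v / 2) * inverse (sqrt x)) {0<..}"
      using Suc by (intro Ck_on_cmult) auto
    then show "Ck_on k (\<lambda>x. v * (inverse (sqrt x) / 2)) {0<..}" by simp
  qed auto
  then show ?case by (auto intro!: Ck_on_inverse simp del: Ck_on.simps)
qed

lemma smooth_on_const: "smooth_on (\<lambda>x. c) S"
  by (simp add: smooth_on_def Ck_on_const)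

lemma smooth_on_cong: "open S \<Longrightarrow> (\<And>x. x \<in> S \<Longrightarrow> f x = g x) \<Longrightarrow> smooth_on f S \<Longrightarrow> smooth_on g S"
  unfolding smooth_on_def using Ck_on_cong by metis

lemma smooth_on_subset: "smooth_on f S \<Longrightarrow> T \<subseteq> S \<Longrightarrow> smooth_on f T"
  unfolding smooth_on_def using Ck_on_subset by metis

lemma smooth_on_local:
  assumes "\<And>x. x \<in> S \<Longrightarrow> \<exists>T. open T \<and> x \<in> T \<and> smooth_on f T"
  shows "smooth_on f S"
  unfolding smooth_on_def using assms unfolding smooth_on_def by (meson Ck_on_local)

lemma smooth_on_bounded_linear: "bounded_linear L \<Longrightarrow> smooth_on L S"
  by (simp add: smooth_on_def Ck_on_bounded_linear)

lemma smooth_on_add: "open S \<Longrightarrow> smooth_on f S \<Longrightarrow> smooth_on g S \<Longrightarrow> smooth_on (\<lambda>x. f x + g x) S"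
  by (simp add: smooth_on_def Ck_on_add)

lemma smooth_on_sum:
  "open S \<Longrightarrow> (\<And>i. i \<in> I \<Longrightarrow> smooth_on (f i) S) \<Longrightarrow> smooth_on (\<lambda>x. \<Sum>i\<in>I. f i x) S"
  by (simp add: smooth_on_def Ck_on_sum)

lemma smooth_on_mult:
  fixes f g :: "'a::real_normed_vector \<Rightarrow> real"
  shows "open S \<Longrightarrow> smooth_on f S \<Longrightarrow> smooth_on g S \<Longrightarrow> smooth_on (\<lambda>x. f x * g x) S"
  by (simp add: smooth_on_def Ck_on_mult)

lemma smooth_on_prod:
  fixes f :: "'i \<Rightarrow> 'a::real_normed_vector \<Rightarrow> real"
  shows "open S \<Longrightarrow> (\<And>i. i \<in> I \<Longrightarrow> smooth_on (f i) S) \<Longrightarrow> smooth_on (\<lambda>x. \<Prod>i\<in>I. f i x) S"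
  by (simp add: smooth_on_def Ck_on_prod)

lemma smooth_on_diff:
  fixes f g :: "'a::real_normed_vector \<Rightarrow> real"
  shows "open S \<Longrightarrow> smooth_on f S \<Longrightarrow> smooth_on g S \<Longrightarrow> smooth_on (\<lambda>x. f x - g x) S"
  by (simp add: smooth_on_def Ck_on_diff)

lemma smooth_on_compose:
  fixes f :: "'b::euclidean_space \<Rightarrow> real"
  shows "open S \<Longrightarrow> open T \<Longrightarrow> g ` S \<subseteq> T \<Longrightarrow> smooth_on f T \<Longrightarrow> smooth_on g S \<Longrightarrow>
    smooth_on (\<lambda>x. f (g x)) S"
  by (simp add: smooth_on_def Ck_on_compose)

lemma smooth_on_inverse:
  fixes f :: "'a::real_normed_vector \<Rightarrow> real"
  shows "open S \<Longrightarrow> (\<And>x. x \<in> S \<Longrightarrow> f x \<noteq> 0) \<Longrightarrow> smooth_on f S \<Longrightarrow> smooth_on (\<lambda>x. inverse (f x)) S"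
  by (simp add: smooth_on_def Ck_on_inverse)

lemma smooth_on_sqrt: "smooth_on sqrt {0<..}"
  by (simp add: smooth_on_def Ck_on_sqrt_powers)

lemma smooth_on_has_derivative:
  "smooth_on f S \<Longrightarrow> x \<in> S \<Longrightarrow> (f has_derivative frechet_derivative f (at x)) (at x)"
  unfolding smooth_on_def using Ck_on_has_derivative by blast

lemma smooth_on_frechet_derivative:
  "smooth_on f S \<Longrightarrow> smooth_on (\<lambda>x. frechet_derivative f (at x) v) S"
  unfolding smooth_on_def using Ck_on.simps(2) by blast

lemma smooth_on_imp_continuous_on: "smooth_on f S \<Longrightarrow> continuous_on S f"
  unfolding smooth_on_def using Ck_on.simps(1) by blast

text \<open>Writing the absolute value as the root of \<open>f x * f x\<close> leaves only functions
  that are smooth on the positive reals. The lemma serves the volume density, whose determinant has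
  either sign.\<close>

lemma smooth_on_sqrt_abs:
  fixes f :: "'a::real_normed_vector \<Rightarrow> real"
  assumes "open S" "\<And>x. x \<in> S \<Longrightarrow> f x \<noteq> 0" "smooth_on f S"
  shows "smooth_on (\<lambda>x. sqrt \<bar>f x\<bar>) S"
proof -
  have pos: "f x * f x > 0" if "x \<in> S" for x
    using assms(2)[OF that] by (auto simp: zero_less_mult_iff linorder_neq_iff)
  have 1: "smooth_on (\<lambda>x. sqrt (f x * f x)) S"
    by (rule smooth_on_compose[OF assms(1) _ _ smooth_on_sqrt]) (use pos smooth_on_mult[OF assms(1,3,3)] in auto)
  have "smooth_on (\<lambda>x. sqrt (sqrt (f x * f x))) S"
    by (rule smooth_on_compose[OF assms(1) _ _ smooth_on_sqrt 1]) (use assms(2) in \<open>auto\<close>)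
  then show ?thesis by simp
qed

subsection \<open>Bump functions\<close>

text \<open>The derivative of \<open>exp_inv m\<close> is a combination of \<open>exp_inv (Suc m)\<close> and
  \<open>exp_inv (Suc (Suc m))\<close>, whence all the \<open>exp_inv m\<close> are smooth simultaneously.\<close>

definition exp_inv :: "nat \<Rightarrow> real \<Rightarrow> real"
  where "exp_inv m s = (if s > 0 then inverse s ^ m * exp (- inverse s) else 0)"

text \<open>From the right, the substitution u = 1/s gives u^m / exp u at infinity.\<close>

lemma exp_inv_tendsto_0: "(exp_inv m \<longlongrightarrow> 0) (at 0)"
proof -
  have "((\<lambda>s. inverse s ^ m * exp (- inverse s)) \<longlongrightarrow> 0) (at_right (0::real))"
    using filterlim_compose[OF tendsto_power_div_exp_0[of m] filterlim_inverse_at_top_right]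
    by (simp add: exp_minus divide_inverse)
  then have "(exp_inv m \<longlongrightarrow> 0) (at_right 0)"
    by (rule Lim_transform_eventually) (auto simp: eventually_at_right_less exp_inv_def
        intro!: eventually_mono[OF eventually_at_right_less])
  moreover have "(exp_inv m \<longlongrightarrow> 0) (at_left 0)"
    by (rule Lim_transform_eventually[OF tendsto_const])
      (auto simp: eventually_at_filter exp_inv_def)
  ultimately show ?thesis by (simp add: filterlim_split_at)
qed

lemma exp_inv_deriv:
  "(exp_inv m has_real_derivative - real m * exp_inv (Suc m) s + exp_inv (Suc (Suc m)) s) (at s)"
proof -
  consider "s > 0" | "s < 0" | "s = 0" by linarith
  then show ?thesis
  proof cases
    case 1
    have "((\<lambda>s. inverse s ^ m * exp (- inverse s)) has_real_derivative
        - real m * exp_inv (Suc m) s + exp_inv (Suc (Suc m)) s) (at s)"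
      using 1 by (cases m) (auto intro!: derivative_eq_intros simp: exp_inv_def field_simps, metis One_nat_def power_eq_if)
    then show ?thesis
      by (rule has_field_derivative_transform_within_open[where S = "{0<..}"])
        (use 1 in \<open>auto simp: exp_inv_def\<close>)
  next
    case 2
    have "((\<lambda>s. 0) has_real_derivative 0) (at s)" by simp
    then have "(exp_inv m has_real_derivative 0) (at s)"
      by (rule has_field_derivative_transform_within_open[where S = "{..<0}"])
        (use 2 in \<open>auto simp: exp_inv_def\<close>)
    then show ?thesis using 2 by (simp add: exp_inv_def)
  next
    case 3
    \<comment> \<open>At 0 the difference quotient of \<open>exp_inv m\<close> coincides with
      \<open>exp_inv (Suc m)\<close>.\<close>
    have "((\<lambda>h. (exp_inv m h - exp_inv m 0) / (h - 0)) \<longlongrightarrow> 0) (at 0)"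
      using exp_inv_tendsto_0[of "Suc m"]
      by (rule Lim_transform_eventually) (auto simp: exp_inv_def divide_inverse eventually_at_filter)
    then show ?thesis using 3 by (simp add: has_field_derivative_iff exp_inv_def)
  qed
qed

lemma Ck_on_exp_inv: "Ck_on k (exp_inv m) UNIV"
proof (induction k arbitrary: m)
  case 0
  have "isCont (exp_inv m) s" for s
    using exp_inv_deriv DERIV_isCont by blast
  then show ?case by (simp add: continuous_at_imp_continuous_on)
next
  case (Suc k)
  show ?case
  proof (rule Ck_on_SucI)
    fix s show "(exp_inv m has_derivative
        (\<lambda>v. v * (- real m * exp_inv (Suc m) s + exp_inv (Suc (Suc m)) s))) (at s)"
      using exp_inv_deriv by (simp add: has_field_derivative_def mult_commute_abs)
  next
    fix v
    show "Ck_on k (\<lambda>s. v * (- real m * exp_inv (Suc m) s + exp_inv (Suc (Suc m)) s)) UNIV"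
      by (intro Ck_on_mult Ck_on_add Ck_on_const Suc.IH open_UNIV)
  qed simp
qed

lemma bump_exists:
  fixes c :: "'a::euclidean_space"
  assumes "r > 0"
  obtains b where "smooth_on b UNIV" "\<And>x. x \<in> ball c (r/2) \<Longrightarrow> b x = (1::real)"
    "\<And>x. x \<notin> ball c r \<Longrightarrow> b x = 0"
proof
  \<comment> \<open>\<open>u\<close> is positive exactly inside radius r and \<open>w\<close>
    exactly beyond radius r/2. These two regions cover the space, so the denominator of
    \<open>b\<close> never vanishes.\<close>
  define u where "u x = exp_inv 0 (r\<^sup>2 - (x - c) \<bullet> (x - c))" for x
  define w where "w x = exp_inv 0 ((x - c) \<bullet> (x - c) - (r/2)\<^sup>2)" for x
  define b where "b x = u x * inverse (u x + w x)" for x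
  have sq: "(x - c) \<bullet> (x - c) = (dist c x)\<^sup>2" for x
    by (simp add: dist_norm norm_minus_commute dot_square_norm)
  have sm: "smooth_on (\<lambda>x. (x - c) \<bullet> (x - c)) UNIV"
  proof -
    have "smooth_on (\<lambda>x. \<Sum>i\<in>Basis. (x \<bullet> i - c \<bullet> i) * (x \<bullet> i - c \<bullet> i)) UNIV"
      by (intro smooth_on_sum smooth_on_mult smooth_on_diff smooth_on_const open_UNIV
          smooth_on_bounded_linear bounded_linear_inner_left)
    then show ?thesis
      by (subst (1) euclidean_inner) (simp only: inner_diff_left)
  qed
  have e: "smooth_on (exp_inv 0) UNIV" by (simp add: smooth_on_def Ck_on_exp_inv)
  have su: "smooth_on u UNIV" "smooth_on w UNIV"
    unfolding u_def w_def
    by (rule smooth_on_compose[OF open_UNIV open_UNIV _ e], simp,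
        intro smooth_on_diff sm smooth_on_const open_UNIV)+
  have pos: "u x + w x > 0" for x
  proof (cases "dist c x < r")
    case True
    then have "(dist c x)\<^sup>2 < r\<^sup>2" using assms by (simp add: power_strict_mono)
    then show ?thesis by (auto simp: u_def w_def exp_inv_def sq add_pos_nonneg)
  next
    case False
    then have "dist c x > r/2" using assms by simp
    then have "(dist c x)\<^sup>2 > (r/2)\<^sup>2" using assms by (intro power_strict_mono) auto
    then show ?thesis by (auto simp: u_def w_def exp_inv_def sq add_nonneg_pos)
  qed
  then show "smooth_on b UNIV"
    unfolding b_def
    by (intro smooth_on_mult smooth_on_inverse smooth_on_add su open_UNIV less_imp_neq[THEN not_sym])
  show "b x = 1" if "x \<in> ball c (r/2)" for x
  proof -
    have "(dist c x)\<^sup>2 < (r/2)\<^sup>2" using that assms by (intro power_strict_mono) auto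
    then have "w x = 0" by (simp add: w_def exp_inv_def sq)
    then show ?thesis using pos[of x] by (simp add: b_def)
  qed
  show "b x = 0" if "x \<notin> ball c r" for x
  proof -
    have "(dist c x)\<^sup>2 \<ge> r\<^sup>2" using that assms by (intro power_mono) auto
    then show ?thesis by (simp add: b_def u_def exp_inv_def sq)
  qed
qed

subsection \<open>Hadamard's lemma\<close>

text \<open>Each differentiation under the integral sign produces one more factor s. The weight
  \<open>s ^ m\<close> makes this family of integrals closed under differentiation, as the induction
  in \<open>Ck_on_segment_integral\<close> requires.\<close>

lemma has_derivative_segment_integral:
  fixes h :: "'a::euclidean_space \<Rightarrow> real"
  assumes h: "Ck_on (Suc 0) h (ball c r)" and y: "y \<in> ball c r"
  shows "((\<lambda>y. integral {0..1} (\<lambda>s. s ^ m * h (c + s *\<^sub>R (y - c)))) has_derivative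
    (\<lambda>v. integral {0..1} (\<lambda>s. s ^ Suc m * frechet_derivative h (at (c + s *\<^sub>R (y - c))) v))) (at y)"
proof -
  let ?B = "ball c r"
  define \<gamma> where "\<gamma> y s = c + s *\<^sub>R (y - c)" for y and s :: real
  have \<gamma>: "\<gamma> y s \<in> ?B" if "y \<in> ?B" "s \<in> {0..1}" for y s
  proof -
    have "\<gamma> y s = (1 - s) *\<^sub>R c + s *\<^sub>R y" by (simp add: \<gamma>_def algebra_simps)
    moreover have "c \<in> ball c r" using le_less_trans[OF zero_le_dist[of c y]] that by simp
    ultimately show ?thesis
      using that convexD_alt[OF convex_ball, of c c r y s] by auto
  qed
  have \<gamma>c: "continuous_on (?B \<times> {0..1}) (\<lambda>(y, s). \<gamma> y s)"
    by (auto simp: \<gamma>_def split_beta intro!: continuous_intros)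
  have hc: "continuous_on ?B h" using Ck_on_Suc_imp[OF h] by simp
  \<comment> \<open>The Leibniz rule takes the derivative as a continuous map into the space of
    bounded linear maps.\<close>
  define D where "D z = Blinfun (frechet_derivative h (at z))" for z
  have Dapp: "blinfun_apply (D z) = frechet_derivative h (at z)" if "z \<in> ?B" for z
    unfolding D_def using Ck_on_has_derivative[OF h that]
    by (simp add: bounded_linear_Blinfun_apply has_derivative_bounded_linear)
  have Dc: "continuous_on ?B D"
  proof (rule continuous_on_blinfun_componentwise)
    fix i :: 'a
    have "continuous_on ?B (\<lambda>z. frechet_derivative h (at z) i)" using h by simp
    then show "continuous_on ?B (\<lambda>z. blinfun_apply (D z) i)"
      by (subst continuous_on_cong[OF refl, of _ _ "\<lambda>z. frechet_derivative h (at z) i"])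
        (simp_all only: Dapp)
  qed
  define F where "F y s = s ^ Suc m *\<^sub>R D (\<gamma> y s)" for y and s :: real
  have Fc: "continuous_on (?B \<times> {0..1}) (\<lambda>(y, s). F y s)"
  proof -
    have "continuous_on (?B \<times> {0..1}) (\<lambda>p. D ((\<lambda>(y, s). \<gamma> y s) p))"
      by (rule continuous_on_compose2[OF Dc \<gamma>c]) (use \<gamma> in auto)
    then show ?thesis by (auto simp: F_def split_beta intro!: continuous_intros)
  qed
  have "((\<lambda>y. integral (cbox 0 1) (\<lambda>s. s ^ m * h (\<gamma> y s))) has_derivative
      integral (cbox 0 1) (F y)) (at y within ?B)"
  proof (rule leibniz_rule[OF _ _ _ y convex_ball])
    fix x :: 'a and t :: real assume xt: "x \<in> ?B" "t \<in> cbox 0 1"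
    then have m: "\<gamma> x t \<in> ?B" using \<gamma> by auto
    have "((\<lambda>x. \<gamma> x t) has_derivative (\<lambda>v. t *\<^sub>R v)) (at x)"
      unfolding \<gamma>_def by (auto intro!: derivative_eq_intros)
    from has_derivative_compose[OF this Ck_on_has_derivative[OF h m]]
    have "((\<lambda>x. h (\<gamma> x t)) has_derivative (\<lambda>v. D (\<gamma> x t) (t *\<^sub>R v))) (at x)"
      by (simp add: Dapp[OF m])
    from has_derivative_mult_right[OF this, of "t ^ m"]
    show "((\<lambda>x. t ^ m * h (\<gamma> x t)) has_derivative blinfun_apply (F x t)) (at x within ?B)"
      by (simp add: F_def scaleR_blinfun.rep_eq blinfun.scaleR_right mult_ac has_derivative_at_withinI)
  next
    fix x assume x: "x \<in> ?B"
    have "continuous_on (cbox 0 1) (\<lambda>s. h (\<gamma> x s))"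
      by (rule continuous_on_compose2[OF hc]) (use \<gamma> x in \<open>auto simp: \<gamma>_def intro!: continuous_intros\<close>)
    then show "(\<lambda>s. s ^ m * h (\<gamma> x s)) integrable_on cbox 0 1"
      by (intro integrable_continuous continuous_intros)
  qed (use Fc in simp)
  moreover have "blinfun_apply (integral (cbox 0 1) (F y)) =
      (\<lambda>v. integral {0..1} (\<lambda>s. s ^ Suc m * frechet_derivative h (at (\<gamma> y s)) v))"
  proof
    fix v
    have int: "F y integrable_on cbox 0 1"
    proof (rule integrable_continuous)
      have "continuous_on {0..1} (\<lambda>s. (\<lambda>(y, s). F y s) (y, s))"
        by (rule continuous_on_compose2[OF Fc]) (use y in \<open>auto intro!: continuous_intros\<close>)
      then show "continuous_on (cbox 0 1) (F y)" by simp
    qed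
    have "blinfun_apply (integral (cbox 0 1) (F y)) v = integral (cbox 0 1) (\<lambda>s. F y s v)"
      using integral_linear[OF int blinfun.bounded_linear_left] by (simp add: o_def)
    also have "\<dots> = integral {0..1} (\<lambda>s. s ^ Suc m * frechet_derivative h (at (\<gamma> y s)) v)"
      unfolding cbox_interval by (rule integral_cong) (simp only: F_def scaleR_blinfun.rep_eq Dapp[OF \<gamma>[OF y]] real_scaleR_def)
    finally show "blinfun_apply (integral (cbox 0 1) (F y)) v =
      integral {0..1} (\<lambda>s. s ^ Suc m * frechet_derivative h (at (\<gamma> y s)) v)" .
  qed
  ultimately show ?thesis
    using at_within_open[OF y open_ball] by (simp add: \<gamma>_def)
qed

lemma Ck_on_segment_integral:
  fixes h :: "'a::euclidean_space \<Rightarrow> real"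
  shows "Ck_on (Suc k) h (ball c r) \<Longrightarrow>
    Ck_on k (\<lambda>y. integral {0..1} (\<lambda>s. s ^ m * h (c + s *\<^sub>R (y - c)))) (ball c r)"
proof (induction k arbitrary: h m)
  case 0
  have "continuous (at y) (\<lambda>y. integral {0..1} (\<lambda>s. s ^ m * h (c + s *\<^sub>R (y - c))))"
    if "y \<in> ball c r" for y
    using has_derivative_continuous[OF has_derivative_segment_integral[OF 0 that]] .
  then show ?case by (simp add: continuous_at_imp_continuous_on)
next
  case (Suc k)
  have "Ck_on (Suc 0) h (ball c r)" by (rule Ck_on_mono[OF Suc.prems]) simp
  moreover have "Ck_on (Suc k) (\<lambda>x. frechet_derivative h (at x) v) (ball c r)" for v
    using Suc.prems Ck_on.simps(2)[of "Suc k" h] by blast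
  ultimately show ?case
    by (intro Ck_on_SucI[OF open_ball has_derivative_segment_integral] Suc.IH)
qed

text \<open>The increment f(y) - f(c) is the integral of the derivative along the segment from c to
  y; \<open>G b\<close> is the mean of the partial derivative in direction b over that segment. This
  is what makes derivations at a point combinations of partial derivatives.\<close>

lemma hadamard_lemma:
  fixes f :: "'a::euclidean_space \<Rightarrow> real"
  assumes f: "smooth_on f (ball c r)"
  shows "\<exists>G. (\<forall>b. smooth_on (G b) (ball c r)) \<and>
    (\<forall>y\<in>ball c r. f y = f c + (\<Sum>b\<in>Basis. ((y - c) \<bullet> b) * G b y)) \<and>
    (\<forall>b. G b c = frechet_derivative f (at c) b)"
proof -
  define G where "G b y = integral {0..1} (\<lambda>s. s ^ 0 * frechet_derivative f (at (c + s *\<^sub>R (y - c))) b)"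
    for b y
  have 1: "smooth_on (G b) (ball c r)" for b
    unfolding G_def smooth_on_def
    using Ck_on_segment_integral smooth_on_frechet_derivative[OF f] unfolding smooth_on_def by blast
  have 2: "G b c = frechet_derivative f (at c) b" for b
    by (simp add: G_def)
  have 3: "f y = f c + (\<Sum>b\<in>Basis. ((y - c) \<bullet> b) * G b y)" if y: "y \<in> ball c r" for y
  proof -
    define \<gamma> where "\<gamma> s = c + s *\<^sub>R (y - c)" for s :: real
    have \<gamma>: "\<gamma> s \<in> ball c r" if "s \<in> {0..1}" for s
    proof -
      have "\<gamma> s = (1 - s) *\<^sub>R c + s *\<^sub>R y" by (simp add: \<gamma>_def algebra_simps)
      moreover have "c \<in> ball c r" using le_less_trans[OF zero_le_dist[of c y]] y by simp
      ultimately show ?thesis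
        using that y convexD_alt[OF convex_ball, of c c r y s] by auto
    qed
    define D where "D s = frechet_derivative f (at (\<gamma> s)) (y - c)" for s
    have lin: "D s = (\<Sum>b\<in>Basis. ((y - c) \<bullet> b) * frechet_derivative f (at (\<gamma> s)) b)" if "s \<in> {0..1}" for s
    proof -
      interpret bounded_linear "frechet_derivative f (at (\<gamma> s))"
        using smooth_on_has_derivative[OF f \<gamma>[OF that]] has_derivative_bounded_linear by blast
      have "frechet_derivative f (at (\<gamma> s)) (\<Sum>b\<in>Basis. ((y - c) \<bullet> b) *\<^sub>R b) =
          (\<Sum>b\<in>Basis. ((y - c) \<bullet> b) *\<^sub>R frechet_derivative f (at (\<gamma> s)) b)"
        by (simp only: sum scaleR)
      then show ?thesis by (simp add: D_def euclidean_representation)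
    qed
    have "(D has_integral (f (\<gamma> 1) - f (\<gamma> 0))) {0..1}"
    proof (rule fundamental_theorem_of_calculus)
      fix s :: real assume s: "s \<in> {0..1}"
      have "(\<gamma> has_derivative (\<lambda>t. t *\<^sub>R (y - c))) (at s)"
        unfolding \<gamma>_def by (auto intro!: derivative_eq_intros)
      from has_derivative_compose[OF this smooth_on_has_derivative[OF f \<gamma>[OF s]]]
      have "((\<lambda>s. f (\<gamma> s)) has_derivative (\<lambda>t. t *\<^sub>R D s)) (at s)"
        using linear_cmul[OF has_derivative_linear[OF smooth_on_has_derivative[OF f \<gamma>[OF s]]]]
        by (simp add: D_def)
      then show "((\<lambda>s. f (\<gamma> s)) has_vector_derivative D s) (at s within {0..1})"
        by (simp add: has_vector_derivative_def has_derivative_at_withinI)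
    qed simp
    then have "f y - f c = integral {0..1} D"
      by (simp add: \<gamma>_def integral_unique)
    also have "\<dots> = integral {0..1} (\<lambda>s. \<Sum>b\<in>Basis. ((y - c) \<bullet> b) * frechet_derivative f (at (\<gamma> s)) b)"
      by (intro integral_cong lin)
    also have "\<dots> = (\<Sum>b\<in>Basis. integral {0..1} (\<lambda>s. ((y - c) \<bullet> b) * frechet_derivative f (at (\<gamma> s)) b))"
    proof (rule integral_sum)
      fix b :: 'a
      have "continuous_on {0..1} (\<lambda>s. frechet_derivative f (at (\<gamma> s)) b)"
        by (rule continuous_on_compose2[OF smooth_on_imp_continuous_on[OF smooth_on_frechet_derivative[OF f]]])
          (use \<gamma> in \<open>auto simp: \<gamma>_def intro!: continuous_intros\<close>)
      then show "(\<lambda>s. ((y - c) \<bullet> b) * frechet_derivative f (at (\<gamma> s)) b) integrable_on {0..1}"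
        by (intro integrable_continuous_real continuous_intros)
    qed simp
    also have "\<dots> = (\<Sum>b\<in>Basis. ((y - c) \<bullet> b) * G b y)"
      by (simp add: G_def \<gamma>_def)
    finally show ?thesis by simp
  qed
  show ?thesis
    by (intro exI[of _ G] conjI allI ballI 1 2 3)
qed

section \<open>Smooth functions and tangent vectors\<close>

lemma sum_fun_app: "(\<Sum>i\<in>I. F i) p = (\<Sum>i\<in>I. F i p)"
  by (induction I rule: infinite_finite_induct) (simp_all add: zero_fun_def plus_fun_def)

lemma sum_Basis_axis: "(\<Sum>b\<in>(Basis :: (real^'n::finite) set). F b) = (\<Sum>k\<in>UNIV. F (axis k 1))"
proof -
  have "Basis = range (\<lambda>k::'n. axis k (1::real))" by (auto simp: Basis_vec_def)
  moreover have "inj (\<lambda>k::'n. axis k (1::real))" by (auto simp: inj_def axis_eq_axis)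
  then have "sum F (range (\<lambda>k::'n. axis k (1::real))) = (\<Sum>k\<in>UNIV. F (axis k 1))"
    by (subst sum.reindex) (auto simp: o_def)
  ultimately show ?thesis by metis
qed

section \<open>Charts, smooth functions and cutoffs\<close>

locale manifold =
  fixes A :: "('a::{t2_space,second_countable_topology}, 'n::finite) chart set"
  assumes mfd: "smooth_manifold A"
begin

lemma chart_facts:
  assumes "(U, x) \<in> A"
  shows "open U" "open (x ` U)" "homeomorphism U (x ` U) x (inv_into U x)"
    "continuous_on U x" "continuous_on (x ` U) (inv_into U x)"
    "\<And>q. q \<in> U \<Longrightarrow> inv_into U x (x q) = q"
    "\<And>y. y \<in> x ` U \<Longrightarrow> x (inv_into U x y) = y"
    "\<And>y. y \<in> x ` U \<Longrightarrow> inv_into U x y \<in> U"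
proof -
  show *: "open U" "open (x ` U)" "homeomorphism U (x ` U) x (inv_into U x)"
    using mfd assms unfolding smooth_manifold_def by fast+
  then show "continuous_on U x" "continuous_on (x ` U) (inv_into U x)"
    "\<And>q. q \<in> U \<Longrightarrow> inv_into U x (x q) = q"
    "\<And>y. y \<in> x ` U \<Longrightarrow> x (inv_into U x y) = y"
    "\<And>y. y \<in> x ` U \<Longrightarrow> inv_into U x y \<in> U"
    unfolding homeomorphism_def by (auto intro: inv_into_into)
qed

lemma chart_at: obtains U x where "(U, x) \<in> A" "p \<in> U"
proof -
  have "p \<in> (\<Union>(U, x)\<in>A. U)" using mfd unfolding smooth_manifold_def by simp
  then show ?thesis using that by auto
qed

lemma chart_image_open:
  assumes "(U, x) \<in> A" "open N"
  shows "open (x ` (U \<inter> N))"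
proof -
  note c = chart_facts[OF assms(1)]
  have "x ` (U \<inter> N) = x ` U \<inter> inv_into U x -` N"
    using c(6,8) by (auto simp: image_iff)
  then show ?thesis
    using continuous_open_preimage[OF c(5,2) assms(2)] by simp
qed

lemma smooth_funD:
  "smooth_fun A f \<Longrightarrow> (U, x) \<in> A \<Longrightarrow> smooth_on (\<lambda>y. f (inv_into U x y)) (x ` U)"
  unfolding smooth_fun_def by (force simp: o_def)

lemma smooth_funI:
  "(\<And>U x. (U, x) \<in> A \<Longrightarrow> smooth_on (\<lambda>y. f (inv_into U x y)) (x ` U)) \<Longrightarrow> smooth_fun A f"
  unfolding smooth_fun_def by (force simp: o_def)

lemma smooth_fun_const: "smooth_fun A (\<lambda>q. c)"
  by (rule smooth_funI) (rule smooth_on_const)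

lemma smooth_fun_add: "smooth_fun A f \<Longrightarrow> smooth_fun A h \<Longrightarrow> smooth_fun A (\<lambda>q. f q + h q)"
  by (rule smooth_funI, rule smooth_on_add) (auto intro: smooth_funD chart_facts)

lemma smooth_fun_mult: "smooth_fun A f \<Longrightarrow> smooth_fun A h \<Longrightarrow> smooth_fun A (\<lambda>q. f q * h q)"
  by (rule smooth_funI, rule smooth_on_mult) (auto intro: smooth_funD chart_facts)

lemma smooth_fun_diff: "smooth_fun A f \<Longrightarrow> smooth_fun A h \<Longrightarrow> smooth_fun A (\<lambda>q. f q - h q)"
  by (rule smooth_funI, rule smooth_on_diff) (auto intro: smooth_funD chart_facts)

lemma smooth_fun_cmult: "smooth_fun A f \<Longrightarrow> smooth_fun A (\<lambda>q. c * f q)"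
  by (rule smooth_fun_mult[OF smooth_fun_const])

lemma smooth_fun_sum:
  "(\<And>i. i \<in> I \<Longrightarrow> smooth_fun A (f i)) \<Longrightarrow> smooth_fun A (\<lambda>q. \<Sum>i\<in>I. f i q)"
  by (induction I rule: infinite_finite_induct) (auto intro: smooth_fun_const smooth_fun_add)

lemma smooth_fun_continuous:
  assumes "smooth_fun A f"
  shows "continuous_on UNIV f"
proof -
  have "continuous (at p) f" for p
  proof -
    obtain U x where c: "(U, x) \<in> A" "p \<in> U" by (rule chart_at)
    note cf = chart_facts[OF c(1)]
    have "continuous_on U (\<lambda>q. (\<lambda>y. f (inv_into U x y)) (x q))"
      by (rule continuous_on_compose2[OF smooth_on_imp_continuous_on[OF smooth_funD[OF assms c(1)]] cf(4)]) simp
    then have "continuous_on U f" by (rule continuous_on_eq) (simp add: cf)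
    then show ?thesis using cf(1) c(2) by (simp add: continuous_on_eq_continuous_at)
  qed
  then show ?thesis by (simp add: continuous_at_imp_continuous_on)
qed

text \<open>The Hausdorff property enters here: the compact set \<open>C\<close> is closed, so every
  point lies in \<open>U\<close> or in the open complement of \<open>C\<close>, where the extension
  is zero.\<close>

lemma chart_extend:
  assumes c: "(U, x) \<in> A" and u: "smooth_on u (x ` U)" and C: "compact C" "C \<subseteq> U"
    and z: "\<And>q. q \<in> U \<Longrightarrow> q \<notin> C \<Longrightarrow> u (x q) = 0"
  shows "smooth_fun A (\<lambda>q. if q \<in> U then u (x q) else 0)"
proof (rule smooth_funI, rule smooth_on_local)
  fix V y and w assume V: "(V, y) \<in> A" and w: "w \<in> y ` V"
  let ?f = "\<lambda>q. if q \<in> U then u (x q) else 0" and ?i = "inv_into V y"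
  note cf = chart_facts[OF c] and cV = chart_facts[OF V]
  show "\<exists>T. open T \<and> w \<in> T \<and> smooth_on (\<lambda>w. ?f (?i w)) T"
  proof (cases "?i w \<in> U")
    case True
    let ?T = "y ` (V \<inter> U)"
    have o: "open ?T" by (rule chart_image_open[OF V cf(1)])
    have "smooth_on (x \<circ> ?i) ?T"
      using mfd c V unfolding smooth_manifold_def by fast
    then have "smooth_on (\<lambda>w. u (x (?i w))) ?T"
      by (intro smooth_on_compose[OF o cf(2) _ u]) (auto simp: o_def cV)
    then have "smooth_on (\<lambda>w. ?f (?i w)) ?T"
      by (rule smooth_on_cong[OF o, rotated]) (auto simp: cV)
    moreover have "w \<in> ?T" using True w cV(7,8) by (metis IntI imageI)
    ultimately show ?thesis using o by blast
  next
    case False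
    let ?T = "y ` (V \<inter> - C)"
    have o: "open ?T" using compact_imp_closed[OF C(1)] by (intro chart_image_open[OF V]) auto
    have "smooth_on (\<lambda>w. ?f (?i w)) ?T"
      by (rule smooth_on_cong[OF o _ smooth_on_const[of 0]]) (auto simp: cV z)
    moreover have "w \<in> ?T" using False C(2) w cV(7,8) by (metis ComplI IntI imageI subsetD)
    ultimately show ?thesis using o by blast
  qed
qed

text \<open>Multiplication by \<open>\<beta>\<close> makes an object that lives on a chart global
  and changes nothing on \<open>N\<close>. The set \<open>C\<close> is the preimage of a closed
  ball, chosen small enough to lie in the prescribed open set \<open>W\<close>.\<close>

lemma bump_at:
  assumes c: "(U, x) \<in> A" and p: "p \<in> U" "p \<in> W" "open W"
  obtains \<beta> N C where "smooth_fun A \<beta>" "open N" "p \<in> N" "N \<subseteq> C" "compact C" "C \<subseteq> U" "C \<subseteq> W"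
    "\<And>q. q \<in> N \<Longrightarrow> \<beta> q = 1" "\<And>q. q \<notin> C \<Longrightarrow> \<beta> q = 0"
proof -
  note cf = chart_facts[OF c]
  have "x p \<in> x ` (U \<inter> W)" using p by auto
  then obtain r where r: "r > 0" "cball (x p) r \<subseteq> x ` (U \<inter> W)"
    using chart_image_open[OF c p(3)] open_contains_cball by blast
  obtain b where b: "smooth_on b UNIV" "\<And>y. y \<in> ball (x p) (r/2) \<Longrightarrow> b y = (1::real)"
    "\<And>y. y \<notin> ball (x p) r \<Longrightarrow> b y = 0"
    using bump_exists[OF r(1)] by blast
  define C where "C = inv_into U x ` cball (x p) r"
  define N where "N = U \<inter> x -` ball (x p) (r/2)"
  define \<beta> where "\<beta> q = (if q \<in> U then b (x q) else 0)" for q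
  have CUW: "C \<subseteq> U \<inter> W" using r(2) cf(6) by (auto simp: C_def)
  have Ccomp: "compact C"
    unfolding C_def using r(2)
    by (intro compact_continuous_image continuous_on_subset[OF cf(5)]) auto
  have zero: "b (x q) = 0" if "q \<in> U" "q \<notin> C" for q
  proof -
    have "x q \<notin> cball (x p) r" using that cf(6) unfolding C_def by (metis imageI)
    then show ?thesis by (intro b(3)) auto
  qed
  show ?thesis
  proof
    show "smooth_fun A \<beta>" unfolding \<beta>_def
      by (rule chart_extend[OF c smooth_on_subset[OF b(1)] Ccomp]) (use CUW zero in auto)
    show "open N" unfolding N_def by (rule continuous_open_preimage[OF cf(4,1)]) simp
    show "p \<in> N" using p r by (simp add: N_def)
    show "N \<subseteq> C"
    proof
      fix q assume "q \<in> N"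
      then have "q \<in> U" "x q \<in> cball (x p) r" using r(1) by (auto simp: N_def)
      then show "q \<in> C" using cf(6) unfolding C_def by (metis imageI)
    qed
    show "\<beta> q = 1" if "q \<in> N" for q using that b(2) by (simp add: N_def \<beta>_def)
    show "\<beta> q = 0" if "q \<notin> C" for q using that zero by (auto simp: \<beta>_def)
  qed (use CUW Ccomp in auto)
qed

section \<open>Tangent vectors as derivations\<close>

context
  fixes p v assumes v: "v \<in> tangent_space A p"
begin

lemma tv_add: "smooth_fun A f \<Longrightarrow> smooth_fun A h \<Longrightarrow> v (\<lambda>q. f q + h q) = v f + v h"
  and tv_mult: "smooth_fun A f \<Longrightarrow> smooth_fun A h \<Longrightarrow> v (\<lambda>q. f q * h q) = v f * h p + f p * v h"
  and tv_cmult: "smooth_fun A f \<Longrightarrow> v (\<lambda>q. c * f q) = c * v f"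
  and tv_nonsmooth: "\<not> smooth_fun A f \<Longrightarrow> v f = 0"
  using v unfolding tangent_space_def by blast+

lemma tv_const: "v (\<lambda>q. c) = 0"
proof -
  have "v (\<lambda>q. 1) = 0"
    using tv_mult[OF smooth_fun_const smooth_fun_const, of 1 1] by simp
  then show ?thesis
    using tv_cmult[OF smooth_fun_const, of c 1] by simp
qed

lemma tv_diff: "smooth_fun A f \<Longrightarrow> smooth_fun A h \<Longrightarrow> v (\<lambda>q. f q - h q) = v f - v h"
  using tv_add[of f "\<lambda>q. -1 * h q"] tv_cmult[of h "-1"] smooth_fun_cmult[of h "-1"] by simp

lemma tv_sum:
  "(\<And>i. i \<in> I \<Longrightarrow> smooth_fun A (f i)) \<Longrightarrow> v (\<lambda>q. \<Sum>i\<in>I. f i q) = (\<Sum>i\<in>I. v (f i))"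
  by (induction I rule: infinite_finite_induct) (simp_all add: tv_const tv_add smooth_fun_sum)

text \<open>A cutoff times \<open>f - h\<close> is identically zero. The Leibniz rule at
  \<open>p\<close>, where the cutoff is 1 and \<open>f - h\<close> vanishes, extracts
  \<open>v f - v h\<close> from that product.\<close>

lemma tv_local:
  assumes "open N" "p \<in> N" "\<And>q. q \<in> N \<Longrightarrow> f q = h q" "smooth_fun A f" "smooth_fun A h"
  shows "v f = v h"
proof -
  obtain U x where c: "(U, x) \<in> A" "p \<in> U" by (rule chart_at)
  obtain \<beta> N' C where b: "smooth_fun A \<beta>" "p \<in> N'" "C \<subseteq> N"
    "\<And>q. q \<in> N' \<Longrightarrow> \<beta> q = 1" "\<And>q. q \<notin> C \<Longrightarrow> \<beta> q = 0"
    by (rule bump_at[OF c assms(2,1)]) blast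
  have "(\<lambda>q. \<beta> q * (f q - h q)) = (\<lambda>q. 0)"
  proof
    fix q show "\<beta> q * (f q - h q) = 0"
      using b(3,5) assms(3) by (cases "q \<in> C") auto
  qed
  then have "v (\<lambda>q. \<beta> q * (f q - h q)) = 0" by (simp add: tv_const)
  moreover have "f p = h p" using assms(2,3) by simp
  ultimately show ?thesis
    using tv_mult[OF b(1) smooth_fun_diff[OF assms(4,5)]] b(2,4) tv_diff[OF assms(4,5)] by simp
qed

end

lemma tangent_space_subspace: "subspace (tangent_space A p)"
  unfolding subspace_def tangent_space_def
  by (auto simp: plus_fun_def zero_fun_def scaleR_fun_def algebra_simps)

lemmas ts_add = subspace_add[OF tangent_space_subspace]
  and ts_scale = subspace_scale[OF tangent_space_subspace]
  and ts_sum = subspace_sum[OF tangent_space_subspace]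
  and ts_zero = subspace_0[OF tangent_space_subspace]
  and ts_diff = subspace_diff[OF tangent_space_subspace]

lemma coord_vec_tangent:
  assumes c: "(U, x) \<in> A" and q: "q \<in> U"
  shows "coord_vec A (U, x) k q \<in> tangent_space A q"
proof -
  note cf = chart_facts[OF c]
  have xq: "x q \<in> x ` U" using q by simp
  note D = smooth_on_has_derivative[OF smooth_funD[OF _ c] xq]
  show ?thesis
    unfolding tangent_space_def
  proof (intro CollectI conjI allI impI)
    fix f h assume f: "smooth_fun A f" and h: "smooth_fun A h"
    show "coord_vec A (U, x) k q (\<lambda>q. f q + h q) =
        coord_vec A (U, x) k q f + coord_vec A (U, x) k q h"
      using fun_cong[OF frechet_derivative_at[OF has_derivative_add[OF D[OF f] D[OF h]]], of "axis k 1"]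
      by (simp add: coord_vec_def f h smooth_fun_add o_def)
    show "coord_vec A (U, x) k q (\<lambda>q. f q * h q) =
        coord_vec A (U, x) k q f * h q + f q * coord_vec A (U, x) k q h"
      using fun_cong[OF frechet_derivative_at[OF has_derivative_mult[OF D[OF f] D[OF h]]], of "axis k 1"]
      by (simp add: coord_vec_def f h smooth_fun_mult o_def cf(6)[OF q] add.commute)
  next
    fix c f assume f: "smooth_fun A f"
    show "coord_vec A (U, x) k q (\<lambda>q. c * f q) = c * coord_vec A (U, x) k q f"
      using fun_cong[OF frechet_derivative_at[OF has_derivative_mult_right[OF D[OF f], of c]], of "axis k 1"]
      by (simp add: coord_vec_def f smooth_fun_cmult o_def)
  qed (simp add: coord_vec_def)
qed

section \<open>The module of smooth vector fields\<close>

lemma vfieldsD: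
  assumes "X \<in> vfields A"
  shows "X p \<in> tangent_space A p" "smooth_fun A f \<Longrightarrow> smooth_fun A (\<lambda>p. X p f)"
  using assms unfolding vfields_def by auto

lemma vfieldsI:
  "(\<And>p. X p \<in> tangent_space A p) \<Longrightarrow> (\<And>f. smooth_fun A f \<Longrightarrow> smooth_fun A (\<lambda>p. X p f)) \<Longrightarrow>
    X \<in> vfields A"
  unfolding vfields_def by auto

lemma vf_add: "X \<in> vfields A \<Longrightarrow> Y \<in> vfields A \<Longrightarrow> X + Y \<in> vfields A"
  by (rule vfieldsI) (auto simp: plus_fun_def intro: ts_add[unfolded plus_fun_def] smooth_fun_add vfieldsD)

lemma vf_smul: "smooth_fun A f \<Longrightarrow> X \<in> vfields A \<Longrightarrow> smul f X \<in> vfields A"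
proof (rule vfieldsI)
  assume *: "smooth_fun A f" "X \<in> vfields A"
  show "smul f X p \<in> tangent_space A p" for p
    unfolding smul_def by (rule ts_scale[OF vfieldsD(1)[OF *(2)]])
  show "smooth_fun A (\<lambda>p. smul f X p h)" if "smooth_fun A h" for h
    using smooth_fun_mult[OF *(1) vfieldsD(2)[OF *(2) that]] by (simp add: smul_def scaleR_fun_def)
qed

lemma vf_zero: "0 \<in> vfields A"
  by (rule vfieldsI) (auto simp: zero_fun_def intro: ts_zero[unfolded zero_fun_def] smooth_fun_const)

lemma vf_sum: "(\<And>i. i \<in> I \<Longrightarrow> X i \<in> vfields A) \<Longrightarrow> (\<Sum>i\<in>I. X i) \<in> vfields A"
  by (induction I rule: infinite_finite_induct) (auto intro: vf_zero vf_add)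

lemma scaleR_eq_smul: "c *\<^sub>R X = smul (\<lambda>q. c) X"
  by (simp add: smul_def scaleR_fun_def)

lemma vf_scaleR: "X \<in> vfields A \<Longrightarrow> c *\<^sub>R X \<in> vfields A"
  by (simp add: scaleR_eq_smul vf_smul smooth_fun_const)

lemma vf_uminus: "X \<in> vfields A \<Longrightarrow> - X \<in> vfields A"
  using vf_scaleR[of X "-1"] by simp

lemma vf_diff: "X \<in> vfields A \<Longrightarrow> Y \<in> vfields A \<Longrightarrow> X - Y \<in> vfields A"
  using vf_add[of X "- Y"] vf_uminus by simp

lemma vf_bracket:
  assumes X: "X \<in> vfields A" and Y: "Y \<in> vfields A"
  shows "bracket X Y \<in> vfields A"
proof (rule vfieldsI)
  fix p
  note DX = vfieldsD[OF X] and DY = vfieldsD[OF Y]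
  note t = tv_add[OF DX(1)] tv_add[OF DY(1)] tv_mult[OF DX(1)] tv_mult[OF DY(1)]
    tv_cmult[OF DX(1)] tv_cmult[OF DY(1)] tv_const[OF DX(1)] tv_const[OF DY(1)]
    smooth_fun_add smooth_fun_mult smooth_fun_cmult
  show "bracket X Y p \<in> tangent_space A p"
    unfolding tangent_space_def bracket_def
    by (auto simp: t DX(2) DY(2) algebra_simps tv_nonsmooth[OF DX(1)] tv_nonsmooth[OF DY(1)])
next
  fix f assume "smooth_fun A f"
  then show "smooth_fun A (\<lambda>p. bracket X Y p f)"
    unfolding bracket_def by (intro smooth_fun_diff vfieldsD[OF X] vfieldsD[OF Y])
qed

end

subsection \<open>Local coordinates\<close>

locale local_coords = manifold A
  for A :: "('a::{t2_space,second_countable_topology}, 'n::finite) chart set" +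
  fixes U :: "'a set" and x :: "'a \<Rightarrow> real^'n" and \<beta> :: "'a \<Rightarrow> real" and N C :: "'a set"
  assumes chart: "(U, x) \<in> A" and N: "open N" "N \<subseteq> C" and C: "compact C" "C \<subseteq> U"
    and \<beta>: "smooth_fun A \<beta>" "\<And>q. q \<in> N \<Longrightarrow> \<beta> q = 1" "\<And>q. q \<notin> C \<Longrightarrow> \<beta> q = 0"
begin

abbreviation "inv_x \<equiv> inv_into U x"

lemmas cf = chart_facts[OF chart]

lemma NU: "q \<in> N \<Longrightarrow> q \<in> U" using N C by auto

text \<open>The coordinate functions and coordinate fields, cut off by \<open>\<beta>\<close> to globally smooth objects.\<close>

definition "xh k q = (if q \<in> U then \<beta> q * x q $ k else 0)"

definition "dh k = (\<lambda>q. \<beta> q *\<^sub>R coord_vec A (U, x) k q)"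

lemma cutoff_smooth:
  assumes "smooth_on u (x ` U)"
  shows "smooth_fun A (\<lambda>q. if q \<in> U then \<beta> q * u (x q) else 0)"
proof -
  have "smooth_fun A (\<lambda>q. if q \<in> U then (\<lambda>y. \<beta> (inv_x y) * u y) (x q) else 0)"
    by (rule chart_extend[OF chart _ C])
      (auto intro!: smooth_on_mult cf assms smooth_funD[OF \<beta>(1) chart] simp: cf \<beta>(3))
  moreover have "(\<lambda>q. if q \<in> U then (\<lambda>y. \<beta> (inv_x y) * u y) (x q) else 0) =
      (\<lambda>q. if q \<in> U then \<beta> q * u (x q) else 0)"
    using cf(6) by auto
  ultimately show ?thesis by simp
qed

lemma xh_smooth: "smooth_fun A (xh k)"
  unfolding xh_def[abs_def]
  by (rule cutoff_smooth, rule smooth_on_bounded_linear, rule bounded_linear_vec_nth)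

lemma xh_eq: "q \<in> N \<Longrightarrow> xh k q = x q $ k"
  using NU \<beta>(2) by (simp add: xh_def)

lemma dh_eq: "q \<in> N \<Longrightarrow> dh k q = coord_vec A (U, x) k q"
  by (simp add: dh_def \<beta>(2))

lemma dh_vf: "dh k \<in> vfields A"
proof (rule vfieldsI)
  fix q show "dh k q \<in> tangent_space A q"
    unfolding dh_def using coord_vec_tangent[OF chart] ts_scale C(2) \<beta>(3) ts_zero
    by (cases "q \<in> C") (auto)
next
  fix f assume f: "smooth_fun A f"
  have "smooth_fun A (\<lambda>q. if q \<in> U then \<beta> q *
      (\<lambda>y. frechet_derivative (\<lambda>y. f (inv_x y)) (at y) (axis k 1)) (x q) else 0)"
    by (rule cutoff_smooth) (rule smooth_on_frechet_derivative[OF smooth_funD[OF f chart]])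
  moreover have "(\<lambda>q. dh k q f) = (\<lambda>q. if q \<in> U then \<beta> q *
      (\<lambda>y. frechet_derivative (\<lambda>y. f (inv_x y)) (at y) (axis k 1)) (x q) else 0)"
    using C(2) \<beta>(3) by (auto simp: dh_def scaleR_fun_def coord_vec_def f o_def fun_eq_iff)
  ultimately show "smooth_fun A (\<lambda>q. dh k q f)" by simp
qed

lemma dh_xh: "q \<in> N \<Longrightarrow> dh k q (xh j) = (if j = k then 1 else 0)"
proof -
  assume q: "q \<in> N"
  let ?T = "x ` (U \<inter> N)"
  have o: "open ?T" by (rule chart_image_open[OF chart N(1)])
  have xq: "x q \<in> ?T" using q NU by auto
  have "((\<lambda>y. y $ j) has_derivative (\<lambda>y. y $ j)) (at (x q))"
    by (rule bounded_linear_imp_has_derivative[OF bounded_linear_vec_nth])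
  then have "((\<lambda>y. xh j (inv_x y)) has_derivative (\<lambda>y. y $ j)) (at (x q))"
    by (rule has_derivative_transform_within_open[OF _ o xq]) (auto simp: cf xh_eq)
  from fun_cong[OF frechet_derivative_at[OF this], of "axis k 1"] show ?thesis
    by (simp add: dh_eq[OF q] coord_vec_def xh_smooth o_def axis_def)
qed

text \<open>Hadamard's lemma around the image of \<open>q\<close> writes \<open>f\<close> as a
  constant plus products of coordinate increments with smooth factors. The increments vanish at
  \<open>q\<close>, so the Leibniz rule leaves only \<open>v (xh k)\<close> times the value of the
  factor at \<open>q\<close>, a partial derivative.\<close>

lemma tangent_expand_app:
  assumes q: "q \<in> N" and v: "v \<in> tangent_space A q" and f: "smooth_fun A f"
  shows "v f = (\<Sum>k\<in>UNIV. v (xh k) * coord_vec A (U, x) k q f)"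
proof -
  let ?F = "\<lambda>y. f (inv_x y)"
  have qU: "q \<in> U" using q NU by simp
  obtain r where r: "r > 0" "ball (x q) r \<subseteq> x ` (U \<inter> N)"
    using chart_image_open[OF chart N(1)] q qU open_contains_ball by blast
  have sF: "smooth_on ?F (ball (x q) r)"
    by (rule smooth_on_subset[OF smooth_funD[OF f chart]]) (use r in auto)
  obtain G where G: "\<And>b. smooth_on (G b) (ball (x q) r)"
    "\<And>y. y \<in> ball (x q) r \<Longrightarrow> ?F y = ?F (x q) + (\<Sum>b\<in>Basis. ((y - x q) \<bullet> b) * G b y)"
    "\<And>b. G b (x q) = frechet_derivative ?F (at (x q)) b"
    using hadamard_lemma[OF sF] by (elim exE conjE) (auto simp del: mem_ball)
  obtain b where b: "smooth_on b UNIV" "\<And>y. y \<in> ball (x q) (r/2/2) \<Longrightarrow> b y = (1::real)"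
    "\<And>y. y \<notin> ball (x q) (r/2) \<Longrightarrow> b y = 0"
    using bump_exists[OF half_gt_zero[OF r(1)], of "x q"] by blast
  \<comment> \<open>The Hadamard factors exist only on the ball of radius r, which may be smaller
    than the support of \<open>\<beta>\<close>; a second cutoff inside that ball is applied before
    they are made global.\<close>
  define H where "H k y = (if y \<in> ball (x q) r then b y * G (axis k 1) y else 0)" for k y
  have H: "smooth_on (H k) UNIV" for k
  proof (rule smooth_on_local)
    fix y
    show "\<exists>T. open T \<and> y \<in> T \<and> smooth_on (H k) T"
    proof (cases "y \<in> ball (x q) r")
      case True
      have "smooth_on (H k) (ball (x q) r)"
        by (rule smooth_on_cong[OF open_ball _ smooth_on_mult[OF open_ball
              smooth_on_subset[OF b(1)] G(1)]]) (auto simp: H_def)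
      then show ?thesis using True by blast
    next
      case False
      have "smooth_on (H k) (- cball (x q) (r/2))"
        by (rule smooth_on_cong[OF _ _ smooth_on_const[of 0]]) (use b(3) in \<open>auto simp: H_def\<close>)
      moreover have "y \<in> - cball (x q) (r/2)" using False r(1) by auto
      ultimately show ?thesis by (metis closed_cball open_Compl)
    qed
  qed
  define Gg where "Gg k z = (if z \<in> U then \<beta> z * H k (x z) else 0)" for k z
  have Gs: "smooth_fun A (Gg k)" for k
    unfolding Gg_def[abs_def] by (rule cutoff_smooth[OF smooth_on_subset[OF H]]) simp
  define M where "M = U \<inter> x -` ball (x q) (r/2/2)"
  have Mo: "open M" unfolding M_def by (rule continuous_open_preimage[OF cf(4,1)]) simp
  have qM: "q \<in> M" using qU r by (simp add: M_def)
  define rhs where "rhs z = f q + (\<Sum>k\<in>UNIV. (xh k z - xh k q) * Gg k z)" for z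
  have eq: "f z = rhs z" if "z \<in> M" for z
  proof -
    have z: "z \<in> U" "x z \<in> ball (x q) (r/2/2)" using that by (auto simp: M_def)
    then have xz: "x z \<in> ball (x q) r" using r(1) by auto
    have zN: "z \<in> N" using r(2) xz z(1) cf(6) by (metis IntD1 IntD2 imageE subsetD)
    have "Gg k z = G (axis k 1) (x z)" for k
      using z xz b(2)[OF z(2)] by (simp add: Gg_def H_def \<beta>(2)[OF zN])
    then show ?thesis
      using G(2)[OF xz] by (simp add: rhs_def cf z qU xh_eq zN q sum_Basis_axis inner_axis)
  qed
  have diff: "smooth_fun A (\<lambda>z. xh k z - xh k q)" for k
    by (intro smooth_fun_diff xh_smooth smooth_fun_const)
  have rs: "smooth_fun A rhs" unfolding rhs_def[abs_def]
    by (intro smooth_fun_add smooth_fun_const smooth_fun_sum smooth_fun_mult diff Gs)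
  have "v f = v rhs" by (rule tv_local[OF v Mo qM eq f rs])
  also have "\<dots> = (\<Sum>k\<in>UNIV. v (\<lambda>z. (xh k z - xh k q) * Gg k z))"
    unfolding rhs_def[abs_def]
    by (simp add: tv_add[OF v smooth_fun_const smooth_fun_sum[OF smooth_fun_mult[OF diff Gs]]]
        tv_const[OF v] tv_sum[OF v smooth_fun_mult[OF diff Gs]])
  also have "\<dots> = (\<Sum>k\<in>UNIV. v (xh k) * Gg k q)"
    by (simp add: tv_mult[OF v diff Gs] tv_diff[OF v xh_smooth smooth_fun_const] tv_const[OF v])
  also have "\<dots> = (\<Sum>k\<in>UNIV. v (xh k) * coord_vec A (U, x) k q f)"
    using qU r b(2) G(3) by (simp add: Gg_def H_def \<beta>(2)[OF q] coord_vec_def f o_def)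
  finally show ?thesis .
qed

lemma tangent_expand:
  assumes q: "q \<in> N" and v: "v \<in> tangent_space A q"
  shows "v = (\<Sum>k\<in>UNIV. v (xh k) *\<^sub>R dh k q)"
proof
  fix f
  show "v f = (\<Sum>k\<in>UNIV. v (xh k) *\<^sub>R dh k q) f"
    by (cases "smooth_fun A f")
      (auto simp: sum_fun_app scaleR_fun_def dh_eq[OF q] tangent_expand_app[OF q v]
        tv_nonsmooth[OF v] coord_vec_def)
qed

lemma dh_tangent: "dh k q \<in> tangent_space A q"
  by (rule vfieldsD[OF dh_vf])

lemma tangent_eqI:
  assumes "q \<in> N" "v \<in> tangent_space A q" "w \<in> tangent_space A q" "\<And>k. v (xh k) = w (xh k)"
  shows "v = w"
  using tangent_expand[OF assms(1,2)] tangent_expand[OF assms(1,3)] assms(4) by simp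

lemma dh_inj: "q \<in> N \<Longrightarrow> inj (\<lambda>k. dh k q)"
  using dh_xh by (intro injI) (metis zero_neq_one)

lemma dh_independent:
  assumes "q \<in> N"
  shows "independent (range (\<lambda>k. dh k q))"
proof -
  let ?B = "range (\<lambda>k. dh k q)"
  have key: "f v = 0" if s: "(\<Sum>v\<in>?B. f v *\<^sub>R v) = 0" and v: "v \<in> ?B" for f v
  proof -
    obtain j where j: "v = dh j q" using v by auto
    have "(\<Sum>k\<in>UNIV. f (dh k q) *\<^sub>R dh k q) = 0"
      using s by (subst (asm) sum.reindex[OF dh_inj[OF assms]]) (simp add: o_def)
    from fun_cong[OF this, of "xh j"] have "0 = (\<Sum>k\<in>UNIV. f (dh k q) * (if j = k then 1 else 0))"
      by (simp add: sum_fun_app scaleR_fun_def dh_xh[OF assms])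
    also have "\<dots> = (\<Sum>k\<in>UNIV. if k = j then f (dh k q) else 0)"
      by (rule sum.cong) auto
    also have "\<dots> = f v" by (simp add: j)
    finally show ?thesis by (rule sym)
  qed
  show ?thesis
    using key independent_if_scalars_zero[of ?B] by auto
qed

lemma dh_span:
  assumes "q \<in> N"
  shows "span (range (\<lambda>k. dh k q)) = tangent_space A q"
proof
  show "span (range (\<lambda>k. dh k q)) \<subseteq> tangent_space A q"
    by (rule span_minimal) (auto simp: dh_tangent tangent_space_subspace)
  show "tangent_space A q \<subseteq> span (range (\<lambda>k. dh k q))"
  proof
    fix v assume "v \<in> tangent_space A q"
    have "(\<Sum>k\<in>UNIV. v (xh k) *\<^sub>R dh k q) \<in> span (range (\<lambda>k. dh k q))"
      by (intro span_sum span_scale span_base rangeI)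
    then show "v \<in> span (range (\<lambda>k. dh k q))"
      using tangent_expand[OF assms \<open>v \<in> tangent_space A q\<close>] by simp
  qed
qed

end

context manifold
begin

lemma local_coords_at:
  assumes "(U, x) \<in> A" "p \<in> U" "p \<in> W" "open W"
  obtains \<beta> N C where "local_coords A U x \<beta> N C" "p \<in> N" "C \<subseteq> W"
  using bump_at[OF assms] manifold_axioms assms(1)
  unfolding local_coords_def local_coords_axioms_def by metis

text \<open>The components of \<open>v\<close> are kept constant in cut-off coordinates. This lets
  pointwise statements about the metric be tested on global fields.\<close>

lemma tangent_extend:
  assumes "v \<in> tangent_space A p"
  obtains X where "X \<in> vfields A" "X p = v"
proof -
  obtain U x where c: "(U, x) \<in> A" "p \<in> U" by (rule chart_at)
  obtain \<beta> N C where "local_coords A U x \<beta> N C" "p \<in> N"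
    by (rule local_coords_at[OF c UNIV_I open_UNIV])
  then interpret local_coords A U x \<beta> N C by simp
  have "(\<Sum>k\<in>UNIV. v (xh k) *\<^sub>R dh k) \<in> vfields A"
    by (intro vf_sum vf_scaleR dh_vf)
  moreover have "(\<Sum>k\<in>UNIV. v (xh k) *\<^sub>R dh k) p = v"
    using tangent_expand[OF \<open>p \<in> N\<close> assms] by (simp add: sum_fun_app scaleR_fun_def)
  ultimately show ?thesis using that by blast
qed

end

section \<open>Orthonormal frames and metric traces\<close>

context manifold
begin

text \<open>\<open>B\<close> stands for an operation on fields that has already been evaluated at
  \<open>p\<close>, so a function factor comes out as its value at \<open>p\<close>.\<close>

definition tensorial :: "'a \<Rightarrow> ('a vfield \<Rightarrow> 'b::real_vector) \<Rightarrow> bool"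
  where "tensorial p B \<longleftrightarrow>
    (\<forall>X\<in>vfields A. \<forall>Y\<in>vfields A. B (X + Y) = B X + B Y) \<and>
    (\<forall>f. smooth_fun A f \<longrightarrow> (\<forall>X\<in>vfields A. B (smul f X) = f p *\<^sub>R B X))"

lemma tensorialI:
  assumes "\<And>X Y. X \<in> vfields A \<Longrightarrow> Y \<in> vfields A \<Longrightarrow> B (X + Y) = B X + B Y"
    and "\<And>f X. smooth_fun A f \<Longrightarrow> X \<in> vfields A \<Longrightarrow> B (smul f X) = f p *\<^sub>R B X"
  shows "tensorial p B"
  using assms unfolding tensorial_def by blast

context
  fixes p :: 'a and B :: "'a vfield \<Rightarrow> 'b::real_vector"
  assumes B: "tensorial p B"
begin

lemma tensorial_add: "X \<in> vfields A \<Longrightarrow> Y \<in> vfields A \<Longrightarrow> B (X + Y) = B X + B Y"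
  and tensorial_smul: "smooth_fun A f \<Longrightarrow> X \<in> vfields A \<Longrightarrow> B (smul f X) = f p *\<^sub>R B X"
  using B unfolding tensorial_def by blast+

lemma tensorial_0: "B 0 = 0"
  using tensorial_add[OF vf_zero vf_zero] by simp

lemma tensorial_scaleR: "X \<in> vfields A \<Longrightarrow> B (c *\<^sub>R X) = c *\<^sub>R B X"
  by (simp add: scaleR_eq_smul tensorial_smul smooth_fun_const)

lemma tensorial_diff: "X \<in> vfields A \<Longrightarrow> Y \<in> vfields A \<Longrightarrow> B (X - Y) = B X - B Y"
  using tensorial_add[of X "- Y"] tensorial_scaleR[of Y "-1"] vf_uminus[of Y] by simp

lemma tensorial_sum:
  "(\<And>i. i \<in> I \<Longrightarrow> X i \<in> vfields A) \<Longrightarrow> B (\<Sum>i\<in>I. X i) = (\<Sum>i\<in>I. B (X i))"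
  by (induction I rule: infinite_finite_induct)
    (auto simp: tensorial_0 tensorial_add vf_sum)

lemma tensorial_zero_near:
  assumes X: "X \<in> vfields A" and M: "open M" "p \<in> M" "\<And>q. q \<in> M \<Longrightarrow> X q = 0"
  shows "B X = 0"
proof -
  obtain U x where c: "(U, x) \<in> A" "p \<in> U" by (rule chart_at)
  obtain \<beta> N C where b: "smooth_fun A \<beta>" "p \<in> N" "C \<subseteq> M"
    "\<And>q. q \<in> N \<Longrightarrow> \<beta> q = 1" "\<And>q. q \<notin> C \<Longrightarrow> \<beta> q = 0"
    by (rule bump_at[OF c M(2,1)]) blast
  have "\<beta> q *\<^sub>R X q = 0" for q
    using b(3,5) M(3) by (cases "q \<in> C") auto
  then have "smul \<beta> X = 0" by (auto simp: smul_def zero_fun_def)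
  then show ?thesis
    using tensorial_smul[OF b(1) X] tensorial_0 b(2,4) by simp
qed

text \<open>Near \<open>p\<close> the field is a combination of coordinate fields with smooth
  coefficients. These come out of \<open>B\<close> as their values at \<open>p\<close>, which are
  zero.\<close>

lemma tensorial_zero_at:
  assumes X: "X \<in> vfields A" and "X p = 0"
  shows "B X = 0"
proof -
  obtain U x where c: "(U, x) \<in> A" "p \<in> U" by (rule chart_at)
  obtain \<beta> N C where "local_coords A U x \<beta> N C" and p: "p \<in> N"
    by (rule local_coords_at[OF c UNIV_I open_UNIV])
  then interpret local_coords A U x \<beta> N C by simp
  define S where "S = (\<Sum>k\<in>UNIV. smul (\<lambda>q. X q (xh k)) (dh k))"
  have s: "smul (\<lambda>q. X q (xh k)) (dh k) \<in> vfields A" for k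
    by (intro vf_smul dh_vf vfieldsD[OF X] xh_smooth)
  have S: "S \<in> vfields A" unfolding S_def by (intro vf_sum s)
  have "X q = S q" if "q \<in> N" for q
    using tangent_expand[OF that vfieldsD(1)[OF X]] by (simp add: S_def sum_fun_app smul_def)
  then have "B (X - S) = 0"
    using tensorial_zero_near[OF vf_diff[OF X S] N(1) p] by (simp add: minus_apply)
  then have "B X = B S" by (simp add: tensorial_diff X S)
  also have "\<dots> = (\<Sum>k\<in>UNIV. X p (xh k) *\<^sub>R B (dh k))"
    unfolding S_def using s by (simp add: tensorial_sum tensorial_smul dh_vf vfieldsD[OF X] xh_smooth)
  also have "\<dots> = 0" using assms(2) by (simp add: zero_fun_def)
  finally show ?thesis .
qed

lemma tensorial_cong:
  assumes "X \<in> vfields A" "Y \<in> vfields A" "X p = Y p"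
  shows "B X = B Y"
  using tensorial_zero_at[OF vf_diff[OF assms(1,2)]] assms by (simp add: tensorial_diff minus_apply)

lemma tensorial_expand:
  assumes "X \<in> vfields A" "\<And>i. i \<in> I \<Longrightarrow> Y i \<in> vfields A" "X p = (\<Sum>i\<in>I. c i *\<^sub>R Y i p)"
  shows "B X = (\<Sum>i\<in>I. c i *\<^sub>R B (Y i))"
proof -
  have v: "(\<Sum>i\<in>I. c i *\<^sub>R Y i) \<in> vfields A" by (intro vf_sum vf_scaleR assms(2))
  have "B X = B (\<Sum>i\<in>I. c i *\<^sub>R Y i)"
    by (rule tensorial_cong[OF assms(1) v]) (simp add: assms(3) sum_fun_app scaleR_fun_def)
  then show ?thesis by (simp add: tensorial_sum vf_scaleR assms(2) tensorial_scaleR)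
qed

end

definition bitensorial :: "'a \<Rightarrow> ('a vfield \<Rightarrow> 'a vfield \<Rightarrow> 'b::real_vector) \<Rightarrow> bool"
  where "bitensorial p B \<longleftrightarrow>
    (\<forall>X\<in>vfields A. tensorial p (B X) \<and> tensorial p (\<lambda>Y. B Y X))"

lemma bitensorialI:
  "(\<And>X. X \<in> vfields A \<Longrightarrow> tensorial p (B X)) \<Longrightarrow>
    (\<And>X. X \<in> vfields A \<Longrightarrow> tensorial p (\<lambda>Y. B Y X)) \<Longrightarrow> bitensorial p B"
  by (simp add: bitensorial_def)

lemma bitensorialD:
  "bitensorial p B \<Longrightarrow> X \<in> vfields A \<Longrightarrow> tensorial p (B X)"
  "bitensorial p B \<Longrightarrow> X \<in> vfields A \<Longrightarrow> tensorial p (\<lambda>Y. B Y X)"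
  by (simp_all add: bitensorial_def)

end

section \<open>Pseudo-orthonormal bases\<close>

locale pseudo_riemannian = manifold A
  for A :: "('a::{t2_space,second_countable_topology}, 'n::finite) chart set" +
  fixes g :: "'a \<Rightarrow> 'a tvec \<Rightarrow> 'a tvec \<Rightarrow> real"
  assumes semi_riem: "semi_riemannian A g"
begin

abbreviation "T p \<equiv> tangent_space A p"

lemmas semi_riem' = semi_riem[unfolded semi_riemannian_def]

lemma g_lin: "u \<in> T p \<Longrightarrow> v \<in> T p \<Longrightarrow> w \<in> T p \<Longrightarrow>
    g p (a *\<^sub>R u + b *\<^sub>R v) w = a * g p u w + b * g p v w"
  using conjunct1[OF semi_riem'] by simp

lemma g_sym: "v \<in> T p \<Longrightarrow> w \<in> T p \<Longrightarrow> g p v w = g p w v"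
  by (rule bspec[OF bspec[OF spec[OF conjunct1[OF conjunct2[OF semi_riem']]]]])

lemma g_nondeg: "v \<in> T p \<Longrightarrow> (\<And>w. w \<in> T p \<Longrightarrow> g p v w = 0) \<Longrightarrow> v = 0"
  using conjunct1[OF conjunct2[OF conjunct2[OF semi_riem']]] by simp

lemma g_smooth: "X \<in> vfields A \<Longrightarrow> Y \<in> vfields A \<Longrightarrow> smooth_fun A (\<lambda>p. g p (X p) (Y p))"
  using conjunct2[OF conjunct2[OF conjunct2[OF semi_riem']]] by simp

lemma g_add: "u \<in> T p \<Longrightarrow> v \<in> T p \<Longrightarrow> w \<in> T p \<Longrightarrow> g p (u + v) w = g p u w + g p v w"
  using g_lin[of u p v w 1 1] by simp

lemma g_scale: "u \<in> T p \<Longrightarrow> w \<in> T p \<Longrightarrow> g p (a *\<^sub>R u) w = a * g p u w"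
  using g_lin[of u p u w a 0] by simp

lemma g_add2: "u \<in> T p \<Longrightarrow> v \<in> T p \<Longrightarrow> w \<in> T p \<Longrightarrow> g p w (u + v) = g p w u + g p w v"
  using g_add[of u p v w] by (simp add: g_sym ts_add)

lemma g_scale2: "u \<in> T p \<Longrightarrow> w \<in> T p \<Longrightarrow> g p w (a *\<^sub>R u) = a * g p w u"
  using g_scale[of u p w] by (simp add: g_sym ts_scale)

lemma g_zero: "w \<in> T p \<Longrightarrow> g p 0 w = 0" "w \<in> T p \<Longrightarrow> g p w 0 = 0"
  using g_scale[of w p w 0] g_scale2[of w p w 0] by simp_all

lemma g_minus: "u \<in> T p \<Longrightarrow> w \<in> T p \<Longrightarrow> g p (- u) w = - g p u w"
  "u \<in> T p \<Longrightarrow> w \<in> T p \<Longrightarrow> g p w (- u) = - g p w u"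
  using g_scale[of u p w "-1"] g_scale2[of u p w "-1"] by simp_all

lemma g_diff: "u \<in> T p \<Longrightarrow> v \<in> T p \<Longrightarrow> w \<in> T p \<Longrightarrow> g p (u - v) w = g p u w - g p v w"
  "u \<in> T p \<Longrightarrow> v \<in> T p \<Longrightarrow> w \<in> T p \<Longrightarrow> g p w (u - v) = g p w u - g p w v"
  using g_lin[of u p v w 1 "-1"] by (simp_all add: g_sym ts_diff)

lemma g_sum:
  "w \<in> T p \<Longrightarrow> (\<And>i. i \<in> I \<Longrightarrow> v i \<in> T p) \<Longrightarrow> g p (\<Sum>i\<in>I. v i) w = (\<Sum>i\<in>I. g p (v i) w)"
  "w \<in> T p \<Longrightarrow> (\<And>i. i \<in> I \<Longrightarrow> v i \<in> T p) \<Longrightarrow> g p w (\<Sum>i\<in>I. v i) = (\<Sum>i\<in>I. g p w (v i))"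
  by (induction I rule: infinite_finite_induct) (simp_all add: g_zero g_add g_add2 ts_sum)

definition orthonormal_set :: "'a \<Rightarrow> 'a tvec set \<Rightarrow> bool"
  where "orthonormal_set p F \<longleftrightarrow> finite F \<and> F \<subseteq> T p \<and> (\<forall>v\<in>F. \<bar>g p v v\<bar> = 1) \<and>
    (\<forall>v\<in>F. \<forall>w\<in>F. v \<noteq> w \<longrightarrow> g p v w = 0)"

lemma tangent_basis:
  obtains B where "finite B" "card B = CARD('n)" "independent B" "span B = T p"
proof -
  obtain U x where c: "(U, x) \<in> A" "p \<in> U" by (rule chart_at)
  obtain \<beta> N C where "local_coords A U x \<beta> N C" and p: "p \<in> N"
    by (rule local_coords_at[OF c UNIV_I open_UNIV])
  then interpret local_coords A U x \<beta> N C by simp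
  show ?thesis
    by (rule that[of "range (\<lambda>k. dh k p)"])
      (simp_all add: card_image dh_inj[OF p] dh_independent[OF p] dh_span[OF p])
qed

context
  fixes p :: 'a and F :: "'a tvec set"
  assumes F: "orthonormal_set p F"
begin

lemma orthonormalD: "finite F" "v \<in> F \<Longrightarrow> v \<in> T p" "v \<in> F \<Longrightarrow> g p v v * g p v v = 1"
  "v \<in> F \<Longrightarrow> w \<in> F \<Longrightarrow> v \<noteq> w \<Longrightarrow> g p v w = 0"
proof -
  show "v \<in> F \<Longrightarrow> g p v v * g p v v = 1"
    using F unfolding orthonormal_set_def by (metis abs_mult_self_eq mult_1)
qed (use F in \<open>auto simp: orthonormal_set_def\<close>)

lemma orthonormal_sum:
  assumes "w \<in> F"
  shows "g p (\<Sum>v\<in>F. c v *\<^sub>R v) w = c w * g p w w"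
proof -
  have "g p (\<Sum>v\<in>F. c v *\<^sub>R v) w = (\<Sum>v\<in>F. c v * g p v w)"
    using assms by (simp add: g_sum g_scale orthonormalD ts_scale)
  also have "\<dots> = (\<Sum>v\<in>F. if v = w then c w * g p w w else 0)"
    using assms orthonormalD(4) by (intro sum.cong) auto
  also have "\<dots> = c w * g p w w" using assms orthonormalD(1) by simp
  finally show ?thesis .
qed

lemma orthonormal_independent: "independent F"
proof -
  have key: "c w = 0" if s: "(\<Sum>v\<in>F. c v *\<^sub>R v) = 0" and w: "w \<in> F" for c w
  proof -
    have "c w * g p w w = 0"
      using orthonormal_sum[OF w, of c] s orthonormalD(2)[OF w] by (simp add: g_zero)
    then show ?thesis using orthonormalD(3)[OF w] by auto
  qed
  show ?thesis
    using key independent_if_scalars_zero[of F] orthonormalD(1) by auto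
qed

definition "proj u = u - (\<Sum>v\<in>F. (g p v v * g p u v) *\<^sub>R v)"

lemma proj_tangent: "u \<in> T p \<Longrightarrow> proj u \<in> T p"
  unfolding proj_def by (simp add: ts_diff ts_sum ts_scale orthonormalD(2))

lemma proj_orth:
  assumes "u \<in> T p" "w \<in> F"
  shows "g p (proj u) w = 0"
proof -
  have "g p (proj u) w = g p u w - g p w w * g p u w * g p w w"
    unfolding proj_def using assms orthonormalD(2)
    by (simp add: g_diff ts_sum ts_scale orthonormal_sum)
  also have "\<dots> = g p u w * (1 - g p w w * g p w w)" by (simp add: algebra_simps)
  finally show ?thesis using orthonormalD(3)[OF assms(2)] by simp
qed

text \<open>Gram-Schmidt for an indefinite metric: the projection of a new vector may be null and
  cannot simply be normalised. If all vectors orthogonal to \<open>F\<close> were null, polarisation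
  would make that nonzero projection orthogonal to everything, against nondegeneracy.\<close>

lemma orthonormal_insert:
  assumes "card F < CARD('n)"
  shows "\<exists>e. e \<notin> F \<and> orthonormal_set p (insert e F)"
proof -
  obtain B where B: "finite B" "card B = CARD('n)" "independent B" "span B = T p"
    by (rule tangent_basis)
  have "\<not> T p \<subseteq> span F"
  proof
    assume "T p \<subseteq> span F"
    then have "B \<subseteq> span F" using B(4) span_superset by blast
    then have "card B \<le> card F" using independent_span_bound[OF orthonormalD(1) B(3)] by simp
    then show False using assms B(2) by simp
  qed
  then obtain w where w: "w \<in> T p" "w \<notin> span F" by blast
  have "proj w \<noteq> 0"
  proof
    assume "proj w = 0"
    then have "w = (\<Sum>v\<in>F. (g p v v * g p w v) *\<^sub>R v)" by (simp add: proj_def)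
    also have "\<dots> \<in> span F" by (intro span_sum span_scale span_base)
    finally show False using w by simp
  qed
  note pw = proj_tangent[OF w(1)]
  have "\<exists>u\<in>T p. (\<forall>z\<in>F. g p u z = 0) \<and> g p u u \<noteq> 0"
  proof (rule ccontr)
    assume "\<not> ?thesis"
    then have null: "g p u u = 0" if "u \<in> T p" "\<And>z. z \<in> F \<Longrightarrow> g p u z = 0" for u
      using that by blast
    have "g p (proj w) y = 0" if y: "y \<in> T p" for y
    proof -
      note py = proj_tangent[OF y]
      \<comment> \<open>Three null vectors, the last being the sum of the first two: polarisation
        gives their inner product.\<close>
      have n: "g p (proj w) (proj w) = 0" "g p (proj y) (proj y) = 0"
        "g p (proj w + proj y) (proj w + proj y) = 0"
        by (rule null; simp add: pw py ts_add g_add orthonormalD(2) proj_orth w y)+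
      have "g p (proj w) (proj y) = 0"
        using n g_sym[OF pw py] by (simp add: g_add g_add2 pw py ts_add)
      moreover define s where "s = (\<Sum>v\<in>F. (g p v v * g p y v) *\<^sub>R v)"
      have sT: "s \<in> T p" unfolding s_def by (simp add: ts_sum ts_scale orthonormalD(2))
      have "g p (proj w) s = 0"
        by (simp add: s_def g_sum pw orthonormalD(2) ts_scale g_scale2 proj_orth w)
      moreover have "proj y + s = y" by (simp add: proj_def s_def)
      ultimately show ?thesis
        using g_add2[OF py sT pw] by simp
    qed
    then show False using g_nondeg[OF pw] \<open>proj w \<noteq> 0\<close> by blast
  qed
  then obtain u where u: "u \<in> T p" "\<And>z. z \<in> F \<Longrightarrow> g p u z = 0" "g p u u \<noteq> 0" by blast
  define e where "e = (1 / sqrt \<bar>g p u u\<bar>) *\<^sub>R u"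
  have eT: "e \<in> T p" unfolding e_def by (rule ts_scale[OF u(1)])
  have "g p e e = g p u u / (sqrt \<bar>g p u u\<bar> * sqrt \<bar>g p u u\<bar>)"
    unfolding e_def using u(1) by (simp add: g_scale g_scale2 ts_scale)
  then have ee: "\<bar>g p e e\<bar> = 1" using u(3) by simp
  have ez: "g p e z = 0" "g p z e = 0" if "z \<in> F" for z
    using u that orthonormalD(2)[OF that] by (simp_all add: e_def g_scale g_scale2 g_sym[of z])
  have "e \<notin> F" using ez ee by fastforce
  moreover have "orthonormal_set p (insert e F)"
    using F ee ez eT by (auto simp: orthonormal_set_def)
  ultimately show ?thesis by blast
qed

text \<open>The difference \<open>proj u\<close> is orthogonal to \<open>F\<close>; \<open>F\<close>
  spans by counting dimensions, so nondegeneracy makes the difference zero.\<close>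

lemma orthonormal_expand:
  assumes "card F = CARD('n)" "u \<in> T p"
  shows "u = (\<Sum>v\<in>F. (g p v v * g p u v) *\<^sub>R v)"
proof -
  obtain B where B: "finite B" "card B = CARD('n)" "independent B" "span B = T p"
    by (rule tangent_basis)
  have sp: "T p \<subseteq> span F"
  proof
    fix w assume w: "w \<in> T p"
    show "w \<in> span F"
    proof (rule ccontr)
      assume nw: "w \<notin> span F"
      then have wF: "w \<notin> F" using span_base by blast
      have "independent (insert w F)"
        using nw wF orthonormal_independent by (simp add: independent_insert)
      moreover have "insert w F \<subseteq> span B" using w B(4) orthonormalD(2) by auto
      ultimately have "card (insert w F) \<le> card B" using independent_span_bound[OF B(1)] by blast
      then show False using assms(1) B(2) wF orthonormalD(1) by simp
    qed
  qed
  note pu = proj_tangent[OF assms(2)]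
  have "g p (proj u) w = 0" if w: "w \<in> T p" for w
  proof -
    have "subspace {w \<in> T p. g p (proj u) w = 0}"
      by (auto simp: subspace_def ts_zero ts_add ts_scale g_zero g_add2 g_scale2 pu)
    moreover have "F \<subseteq> {w \<in> T p. g p (proj u) w = 0}"
      using proj_orth[OF assms(2)] orthonormalD(2) by auto
    ultimately have "span F \<subseteq> {w \<in> T p. g p (proj u) w = 0}" by (rule span_minimal[rotated])
    then show ?thesis using sp w by auto
  qed
  then have "proj u = 0" by (rule g_nondeg[OF pu])
  then show ?thesis by (simp add: proj_def)
qed

end

lemma orthonormal_basis_exists: "\<exists>F. orthonormal_set p F \<and> card F = CARD('n)"
proof -
  have "m \<le> CARD('n) \<Longrightarrow> \<exists>F. orthonormal_set p F \<and> card F = m" for m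
  proof (induction m)
    case 0
    then show ?case by (intro exI[of _ "{}"]) (simp add: orthonormal_set_def)
  next
    case (Suc m)
    then obtain F where F: "orthonormal_set p F" "card F = m" by auto
    then obtain e where "e \<notin> F" "orthonormal_set p (insert e F)"
      using orthonormal_insert[OF F(1)] Suc.prems by auto
    then show ?case using F orthonormalD(1)[OF F(1)] by (intro exI[of _ "insert e F"]) simp
  qed
  then show ?thesis by blast
qed

lemma frame_exists: "\<exists>E. frame_at A g p E"
proof -
  obtain F where F: "orthonormal_set p F" "card F = CARD('n)"
    using orthonormal_basis_exists by blast
  obtain e :: "'n \<Rightarrow> _" where e: "bij_betw e UNIV F"
    using finite_same_card_bij[of "UNIV :: 'n set" F] F orthonormalD(1)[OF F(1)] by auto
  have eF: "e i \<in> F" for i using e by (auto simp: bij_betw_def)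
  have "\<exists>X. X \<in> vfields A \<and> X p = e i" for i
    using tangent_extend[OF orthonormalD(2)[OF F(1) eF]] by metis
  then obtain E where E: "\<And>i. E i \<in> vfields A \<and> E i p = e i" by metis
  have "e i \<noteq> e j" if "i \<noteq> j" for i j
    using e that by (auto simp: bij_betw_def inj_on_def)
  then have "frame_at A g p E"
    using F(1) eF by (auto simp: frame_at_def E orthonormal_set_def)
  then show ?thesis by blast
qed

text \<open>The same choice as inside \<open>metric_trace\<close>, named so that traces unfold into
  it. Frames at different points are unrelated.\<close>

definition "fr p = (SOME E. frame_at A g p E)"

definition "\<epsilon> p i = g p (fr p i p) (fr p i p)"

lemma fr_frame: "frame_at A g p (fr p)"
  unfolding fr_def by (rule someI_ex[OF frame_exists])

lemma fr_vf: "fr p i \<in> vfields A"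
  using fr_frame unfolding frame_at_def by blast

lemma fr_T: "fr p i q \<in> T q"
  by (rule vfieldsD(1)[OF fr_vf])

lemma \<epsilon>_sq: "\<epsilon> p i * \<epsilon> p i = 1"
  using fr_frame[of p] unfolding frame_at_def \<epsilon>_def by (metis abs_mult_self_eq mult_1)

lemma fr_orth: "g p (fr p i p) (fr p j p) = (if i = j then \<epsilon> p i else 0)"
  using fr_frame[of p] by (simp add: frame_at_def \<epsilon>_def)

lemma metric_trace_fr: "metric_trace A g B p = (\<Sum>i\<in>UNIV. \<epsilon> p i *\<^sub>R B (fr p i) (fr p i) p)"
  unfolding metric_trace_def Let_def \<epsilon>_def fr_def by (rule refl)

lemma fr_expand:
  assumes "u \<in> T p"
  shows "u = (\<Sum>i\<in>UNIV. (\<epsilon> p i * g p u (fr p i p)) *\<^sub>R fr p i p)"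
proof -
  have inj: "inj (\<lambda>i. fr p i p)"
    using fr_orth \<epsilon>_sq by (intro injI) (metis mult_zero_left zero_neq_one)
  have "orthonormal_set p (range (\<lambda>i. fr p i p))"
    using fr_frame[of p] unfolding orthonormal_set_def frame_at_def by (auto simp: fr_T) metis
  from orthonormal_expand[OF this _ assms] show ?thesis
    by (simp add: card_image[OF inj] sum.reindex[OF inj] o_def \<epsilon>_def)
qed

lemma tensorial_fr:
  assumes "tensorial p B" "X \<in> vfields A"
  shows "B X = (\<Sum>i\<in>UNIV. (\<epsilon> p i * g p (X p) (fr p i p)) *\<^sub>R B (fr p i))"
  by (rule tensorial_expand[OF assms fr_vf fr_expand[OF vfieldsD(1)[OF assms(2)]]])

end

section \<open>Metric traces in coordinates\<close>

locale metric_coords = pseudo_riemannian A g + local_coords A U x \<beta> N C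
  for A :: "('a::{t2_space,second_countable_topology}, 'n::finite) chart set" and g U x \<beta> N C
begin

text \<open>The inverse of the Gram matrix of the coordinate fields, read off the chosen frame at \<open>q\<close>.\<close>

definition Hinv :: "'a \<Rightarrow> real^'n^'n"
  where "Hinv q = (\<chi> j k. \<Sum>i\<in>UNIV. \<epsilon> q i * fr q i q (xh j) * fr q i q (xh k))"

definition Gram :: "'a \<Rightarrow> real^'n^'n"
  where "Gram q = (\<chi> j k. g q (dh j q) (dh k q))"

lemma metric_trace_coords:
  assumes q: "q \<in> N" and B: "bitensorial q (\<lambda>X Y. B X Y q)"
  shows "metric_trace A g B q = (\<Sum>j\<in>UNIV. \<Sum>k\<in>UNIV. Hinv q $ j $ k *\<^sub>R B (dh j) (dh k) q)"
proof -
  have ex: "fr q i q = (\<Sum>k\<in>UNIV. fr q i q (xh k) *\<^sub>R dh k q)" for i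
    by (rule tangent_expand[OF q fr_T])
  have "B (fr q i) (fr q i) q =
      (\<Sum>j\<in>UNIV. \<Sum>k\<in>UNIV. (fr q i q (xh j) * fr q i q (xh k)) *\<^sub>R B (dh j) (dh k) q)" for i
    by (simp add: tensorial_expand[OF bitensorialD(2)[OF B fr_vf] fr_vf dh_vf ex]
        tensorial_expand[OF bitensorialD(1)[OF B dh_vf] fr_vf dh_vf ex] scaleR_sum_right)
  then have "metric_trace A g B q = (\<Sum>i\<in>UNIV. \<Sum>j\<in>UNIV. \<Sum>k\<in>UNIV.
      (\<epsilon> q i * fr q i q (xh j) * fr q i q (xh k)) *\<^sub>R B (dh j) (dh k) q)"
    by (simp add: metric_trace_fr scaleR_sum_right mult.assoc)
  also have "\<dots> = (\<Sum>j\<in>UNIV. \<Sum>k\<in>UNIV. \<Sum>i\<in>UNIV.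
      (\<epsilon> q i * fr q i q (xh j) * fr q i q (xh k)) *\<^sub>R B (dh j) (dh k) q)"
    by (subst sum.swap) (intro sum.cong refl sum.swap)
  finally show ?thesis by (simp add: Hinv_def scaleR_sum_left)
qed

text \<open>Raising an index: contracting the covector g(u, .) with \<open>Hinv\<close> returns the
  components of \<open>u\<close>. Summing over coordinates first rebuilds the frame vectors, and
  \<open>fr_expand\<close> does the rest.\<close>

lemma Hinv_component:
  assumes q: "q \<in> N" and u: "u \<in> T q"
  shows "(\<Sum>l\<in>UNIV. Hinv q $ j $ l * g q u (dh l q)) = u (xh j)"
proof -
  have "(\<Sum>l\<in>UNIV. fr q i q (xh l) * g q u (dh l q)) = g q u (fr q i q)" for i
  proof -
    have "(\<Sum>l\<in>UNIV. fr q i q (xh l) * g q u (dh l q)) =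
        g q u (\<Sum>l\<in>UNIV. fr q i q (xh l) *\<^sub>R dh l q)"
      by (simp add: g_sum g_scale2 dh_tangent ts_scale u)
    then show ?thesis using tangent_expand[OF q fr_T] by simp
  qed
  then have "(\<Sum>i\<in>UNIV. \<epsilon> q i * fr q i q (xh j) *
        (\<Sum>l\<in>UNIV. fr q i q (xh l) * g q u (dh l q))) =
      (\<Sum>i\<in>UNIV. (\<epsilon> q i * g q u (fr q i q)) *\<^sub>R fr q i q) (xh j)"
    by (simp add: sum_fun_app scaleR_fun_def mult_ac)
  also have "\<dots> = u (xh j)" using fr_expand[OF u] by simp
  finally have *: "(\<Sum>i\<in>UNIV. \<epsilon> q i * fr q i q (xh j) *
        (\<Sum>l\<in>UNIV. fr q i q (xh l) * g q u (dh l q))) = u (xh j)" .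
  have "(\<Sum>l\<in>UNIV. Hinv q $ j $ l * g q u (dh l q)) =
      (\<Sum>l\<in>UNIV. \<Sum>i\<in>UNIV. \<epsilon> q i * fr q i q (xh j) * (fr q i q (xh l) * g q u (dh l q)))"
    by (simp add: Hinv_def sum_distrib_right mult.assoc)
  also have "\<dots> = (\<Sum>i\<in>UNIV. \<epsilon> q i * fr q i q (xh j) *
        (\<Sum>l\<in>UNIV. fr q i q (xh l) * g q u (dh l q)))"
    by (subst sum.swap) (simp add: sum_distrib_left)
  finally show ?thesis using * by simp
qed

lemma Hinv_Gram:
  assumes q: "q \<in> N"
  shows "Hinv q ** Gram q = mat 1"
proof -
  have "(\<Sum>k\<in>UNIV. Hinv q $ j $ k * Gram q $ k $ l) = (if j = l then 1 else 0)" for j l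
  proof -
    have "Gram q $ k $ l = g q (dh l q) (dh k q)" for k
      by (simp add: Gram_def) (rule g_sym[OF dh_tangent dh_tangent])
    then show ?thesis by (simp only: Hinv_component[OF q dh_tangent] dh_xh[OF q])
  qed
  then show ?thesis by (simp add: vec_eq_iff matrix_matrix_mult_def mat_def)
qed

lemma Gram_Hinv: "q \<in> N \<Longrightarrow> Gram q ** Hinv q = mat 1"
  using Hinv_Gram matrix_left_right_inverse by blast

lemma det_Gram: "q \<in> N \<Longrightarrow> det (Gram q) \<noteq> 0"
  using Hinv_Gram invertible_det_nz invertible_def matrix_left_right_inverse by metis

lemma Gram_smooth: "smooth_fun A (\<lambda>q. Gram q $ j $ k)"
  by (simp add: Gram_def g_smooth dh_vf)

text \<open>\<open>Hinv\<close> is built from arbitrarily chosen frames. Cramer's rule exhibits it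
  as a rational function of the smooth Gram matrix, which is where its continuity comes
  from.\<close>

lemma Hinv_cramer:
  assumes q: "q \<in> N"
  shows "Hinv q $ k $ j =
    det (\<chi> i l. if l = k then axis j 1 $ i else Gram q $ i $ l) / det (Gram q)"
proof -
  have "Gram q *v column j (Hinv q) = axis j 1"
  proof -
    have "(Gram q ** Hinv q) $ i $ j = (Gram q *v column j (Hinv q)) $ i" for i
      by (simp add: matrix_matrix_mult_def matrix_vector_mult_def column_def)
    then show ?thesis
      using Gram_Hinv[OF q] by (simp add: vec_eq_iff mat_def axis_def)
  qed
  then have "column j (Hinv q) =
      (\<chi> k. det (\<chi> i l. if l = k then axis j 1 $ i else Gram q $ i $ l) / det (Gram q))"
    using cramer[OF det_Gram[OF q]] by blast
  then have "column j (Hinv q) $ k =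
      det (\<chi> i l. if l = k then axis j 1 $ i else Gram q $ i $ l) / det (Gram q)"
    by simp
  then show ?thesis by (simp add: column_def)
qed

lemma Hinv_continuous: "continuous_on N (\<lambda>q. Hinv q $ k $ j)"
proof -
  have c: "continuous_on N (\<lambda>q. Gram q $ i $ l)" for i l
    using smooth_fun_continuous[OF Gram_smooth] continuous_on_subset by blast
  have "continuous_on N (\<lambda>q. if l = k then axis j 1 $ i else Gram q $ i $ l)" for i l
    by (cases "l = k") (auto simp: c)
  then have "continuous_on N (\<lambda>q.
      det (\<chi> i l. if l = k then axis j 1 $ i else Gram q $ i $ l) / det (Gram q))"
    unfolding det_def using det_Gram[unfolded det_def] c
    by (intro continuous_on_divide continuous_on_sum continuous_on_mult continuous_on_const
        continuous_on_prod) auto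
  then show ?thesis
    by (rule continuous_on_eq) (simp add: Hinv_cramer)
qed

end

context pseudo_riemannian
begin

lemma metric_coords_at:
  assumes "(U, x) \<in> A" "p \<in> U" "p \<in> W" "open W"
  obtains \<beta> N C where "metric_coords A g U x \<beta> N C" "p \<in> N" "C \<subseteq> W"
  using local_coords_at[OF assms] pseudo_riemannian_axioms
  unfolding metric_coords_def by metis

lemma metric_trace_continuous:
  fixes B :: "'a vfield \<Rightarrow> 'a vfield \<Rightarrow> 'a \<Rightarrow> real"
  assumes B: "\<And>q. bitensorial q (\<lambda>X Y. B X Y q)"
    and c: "\<And>X Y. X \<in> vfields A \<Longrightarrow> Y \<in> vfields A \<Longrightarrow> continuous_on UNIV (B X Y)"
  shows "continuous_on UNIV (metric_trace A g B)"
proof -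
  have "continuous (at p) (metric_trace A g B)" for p
  proof -
    obtain U x where ch: "(U, x) \<in> A" "p \<in> U" by (rule chart_at)
    obtain \<beta> N C where "metric_coords A g U x \<beta> N C" and p: "p \<in> N"
      by (rule metric_coords_at[OF ch UNIV_I open_UNIV])
    then interpret metric_coords A g U x \<beta> N C by simp
    have "continuous_on N (\<lambda>q. \<Sum>j\<in>UNIV. \<Sum>k\<in>UNIV. Hinv q $ j $ k *\<^sub>R B (dh j) (dh k) q)"
      by (intro continuous_on_sum continuous_on_scaleR Hinv_continuous
          continuous_on_subset[OF c[OF dh_vf dh_vf]] subset_UNIV)
    then have "continuous_on N (metric_trace A g B)"
      by (rule continuous_on_eq) (simp add: metric_trace_coords[OF _ B])
    then show ?thesis using N(1) p by (simp add: continuous_on_eq_continuous_at)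
  qed
  then show ?thesis by (simp add: continuous_at_imp_continuous_on)
qed

end

section \<open>Euclidean preliminaries for the divergence theorem\<close>

text \<open>The derivative is a limit of difference quotients, whose integrals vanish by translation
  invariance of Lebesgue measure. Dominated convergence passes this to the limit.\<close>

lemma integral_directional_derivative:
  fixes F :: "'a::euclidean_space \<Rightarrow> real"
  assumes F: "smooth_on F UNIV" and S: "compact S" and z: "\<And>y. y \<notin> S \<Longrightarrow> F y = 0"
  shows "integrable lborel (\<lambda>y. frechet_derivative F (at y) v)" (is "integrable _ ?D")
    and "(LINT y|lborel. frechet_derivative F (at y) v) = 0"
proof -
  have Fd: "(F has_derivative frechet_derivative F (at y)) (at y)" for y
    by (rule smooth_on_has_derivative[OF F]) simp
  have Fc: "continuous_on UNIV F" by (rule smooth_on_imp_continuous_on[OF F])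
  have Dc: "continuous_on UNIV ?D"
    by (rule smooth_on_imp_continuous_on[OF smooth_on_frechet_derivative[OF F]])
  have Dz: "?D y = 0" if "y \<notin> S" for y
  proof -
    have "open (- S)" using compact_imp_closed[OF S] by auto
    from has_derivative_transform_within_open[OF _ this, of "\<lambda>_. 0" "\<lambda>_. 0" y UNIV F] z that
    have "(F has_derivative (\<lambda>_. 0)) (at y)" by auto
    then show ?thesis using frechet_derivative_at by metis
  qed
  have indD: "?D = (\<lambda>y. indicator S y *\<^sub>R ?D y)"
  proof
    fix y show "?D y = indicator S y *\<^sub>R ?D y" by (cases "y \<in> S") (simp_all add: Dz)
  qed
  have indF: "F = (\<lambda>y. indicator S y *\<^sub>R F y)"
  proof
    fix y show "F y = indicator S y *\<^sub>R F y" by (cases "y \<in> S") (simp_all add: z)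
  qed
  show iD: "integrable lborel ?D"
    by (subst indD) (rule borel_integrable_compact[OF S continuous_on_subset[OF Dc subset_UNIV]])
  have iF: "integrable lborel F"
    by (subst indF) (rule borel_integrable_compact[OF S continuous_on_subset[OF Fc subset_UNIV]])
  have tr: "integrable lborel (\<lambda>y. F (c + y))" "(LINT y|lborel. F (c + y)) = (LINT y|lborel. F y)" for c
    using iF integrable_distr_eq[of "(+) c" lborel borel F] integral_distr[of "(+) c" lborel borel F]
    by (auto simp: lborel_distr_plus)
  obtain Bd where Bd: "\<And>y. \<bar>?D y\<bar> \<le> Bd" "Bd \<ge> 0"
  proof -
    have "bounded (?D ` S)"
      by (intro compact_imp_bounded compact_continuous_image continuous_on_subset[OF Dc] S) simp
    then obtain b where b: "\<And>y. y \<in> S \<Longrightarrow> \<bar>?D y\<bar> \<le> b"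
      unfolding bounded_iff by auto
    have "\<bar>?D y\<bar> \<le> max b 0" for y
    proof (cases "y \<in> S")
      case True
      then show ?thesis using b[of y] by linarith
    qed (simp add: Dz)
    then show ?thesis by (rule that) simp
  qed
  obtain R where "\<And>y. y \<in> S \<Longrightarrow> norm y \<le> R"
    using compact_imp_bounded[OF S] unfolding bounded_iff by auto
  then have R: "S \<subseteq> cball 0 R" by auto
  define h where "h n = inverse (real (Suc n))" for n
  have h: "0 < h n" "h n \<le> 1" for n by (auto simp: h_def inverse_le_1_iff)
  define s where "s n y = (F (h n *\<^sub>R v + y) - F y) / h n" for n y
  have line: "((\<lambda>t. F (t *\<^sub>R v + y)) has_real_derivative ?D (t *\<^sub>R v + y)) (at t)" for t y
  proof -
    have "((\<lambda>t. t *\<^sub>R v + y) has_derivative (\<lambda>t. t *\<^sub>R v)) (at t)"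
      by (auto intro!: derivative_eq_intros)
    from has_derivative_compose[OF this Fd]
    have "((\<lambda>t. F (t *\<^sub>R v + y)) has_derivative (\<lambda>x. x * ?D (t *\<^sub>R v + y))) (at t)"
      using linear_cmul[OF has_derivative_linear[OF Fd]] by simp
    then show ?thesis by (simp add: has_field_derivative_def mult_commute_abs)
  qed
  \<comment> \<open>The mean value theorem bounds the quotient by \<open>Bd\<close>. The steps
    \<open>h n\<close> are at most 1, so the quotients are supported in a ball whose radius exceeds
    that of \<open>S\<close> by \<open>norm v\<close>.\<close>
  have bound: "\<bar>s n y\<bar> \<le> indicator (cball 0 (R + norm v)) y *\<^sub>R Bd" for n y
  proof (cases "y \<in> cball 0 (R + norm v)")
    case True
    obtain t where "0 < t" "t < h n" "F (h n *\<^sub>R v + y) - F (0 *\<^sub>R v + y) = (h n - 0) * ?D (t *\<^sub>R v + y)"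
      using MVT2[OF h(1)[of n], of "\<lambda>t. F (t *\<^sub>R v + y)" "\<lambda>t. ?D (t *\<^sub>R v + y)"] line by blast
    then have "s n y = ?D (t *\<^sub>R v + y)" using h(1)[of n] by (simp add: s_def)
    then show ?thesis using Bd True by simp
  next
    case False
    have "norm (h n *\<^sub>R v) \<le> norm v" using h[of n] by (simp add: mult_left_le_one_le)
    moreover have "norm y \<le> norm (h n *\<^sub>R v + y) + norm (h n *\<^sub>R v)"
      using norm_triangle_ineq4[of "h n *\<^sub>R v + y" "h n *\<^sub>R v"] by simp
    moreover have "norm y > R + norm v" using False by simp
    ultimately have "norm (h n *\<^sub>R v + y) > R" by linarith
    moreover have "norm y > R" using \<open>norm y > R + norm v\<close> norm_ge_zero[of v] by linarith
    ultimately have "h n *\<^sub>R v + y \<notin> S" "y \<notin> S" using R by auto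
    then show ?thesis using z Bd(2) by (simp add: s_def)
  qed
  have "(\<lambda>n. integral\<^sup>L lborel (s n)) \<longlonglongrightarrow> integral\<^sup>L lborel ?D"
  proof (rule integral_dominated_convergence)
    show "integrable lborel (\<lambda>y. indicator (cball 0 (R + norm v)) y *\<^sub>R Bd)"
      by (rule borel_integrable_compact) auto
    show "?D \<in> borel_measurable lborel" using iD by simp
    show "s n \<in> borel_measurable lborel" for n
      unfolding s_def using tr(1)[of "h n *\<^sub>R v"] iF by (intro borel_measurable_divide borel_measurable_diff) auto
    show "AE y in lborel. (\<lambda>n. s n y) \<longlonglongrightarrow> ?D y"
    proof (rule AE_I2)
      fix y
      have "((\<lambda>t. (F ((0 + t) *\<^sub>R v + y) - F (0 *\<^sub>R v + y)) / t) \<longlongrightarrow> ?D (0 *\<^sub>R v + y)) (at 0)"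
        using line[where t = 0 and y = y] by (simp add: DERIV_def)
      moreover have "filterlim h (at 0) sequentially"
        using LIMSEQ_inverse_real_of_nat h(1) unfolding h_def
        by (auto simp: filterlim_at)
      ultimately show "(\<lambda>n. s n y) \<longlonglongrightarrow> ?D y"
        using filterlim_compose[of "\<lambda>t. (F ((0 + t) *\<^sub>R v + y) - F (0 *\<^sub>R v + y)) / t"]
        by (fastforce simp: s_def)
    qed
    show "AE y in lborel. norm (s n y) \<le> indicator (cball 0 (R + norm v)) y *\<^sub>R Bd" for n
      using bound by simp
  qed
  moreover have "integral\<^sup>L lborel (s n) = 0" for n
    using tr[of "h n *\<^sub>R v"] iF unfolding s_def by simp
  ultimately show "(LINT y|lborel. ?D y) = 0"
    using LIMSEQ_unique[of "\<lambda>n. 0"] by (auto simp: LIMSEQ_const_iff)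
qed

text \<open>A permutation other than the identity moves at least two indices. Differentiating one
  factor of its product leaves another off-diagonal entry, which is zero at the identity matrix;
  only the trace survives.\<close>

lemma has_derivative_det_at_mat_1:
  fixes P :: "'x::real_normed_vector \<Rightarrow> real^'n::finite^'n"
  assumes P: "\<And>i j. ((\<lambda>y. P y $ i $ j) has_derivative P' i j) (at y0)" and P1: "P y0 = mat 1"
  shows "((\<lambda>y. det (P y)) has_derivative (\<lambda>v. \<Sum>i\<in>UNIV. P' i i v)) (at y0)"
proof -
  have *: "((\<lambda>y. det (P y)) has_derivative (\<lambda>v. \<Sum>\<sigma> | \<sigma> permutes UNIV.
      of_int (sign \<sigma>) * (\<Sum>i\<in>UNIV. P' i (\<sigma> i) v * (\<Prod>j\<in>UNIV - {i}. P y0 $ j $ \<sigma> j)))) (at y0)"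
    unfolding det_def
    by (rule has_derivative_sum, rule has_derivative_mult_right, rule has_derivative_prod) (rule P)
  have z: "(\<Prod>j\<in>UNIV - {i}. P y0 $ j $ \<sigma> j) = (if \<sigma> = id then 1 else 0)"
    if \<sigma>: "\<sigma> permutes UNIV" for i and \<sigma> :: "'n \<Rightarrow> 'n"
  proof (cases "\<sigma> = id")
    case True
    then show ?thesis by (simp add: P1 mat_def)
  next
    case False
    have "\<exists>j. j \<noteq> i \<and> \<sigma> j \<noteq> j"
    proof (rule ccontr)
      assume "\<not> ?thesis"
      then have "\<sigma> j = j" if "j \<noteq> i" for j using that by blast
      moreover from this have "\<sigma> i = i"
        using permutes_inj[OF \<sigma>] by (metis injD)
      ultimately show False using False by (metis eq_id_iff)
    qed
    then obtain j where "j \<noteq> i" "\<sigma> j \<noteq> j" by blast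
    then have "(\<Prod>j\<in>UNIV - {i}. P y0 $ j $ \<sigma> j) = 0"
      by (intro prod_zero) (auto simp: P1 mat_def intro!: bexI[of _ j])
    then show ?thesis using False by simp
  qed
  have "(\<Sum>\<sigma> | \<sigma> permutes UNIV. of_int (sign \<sigma>) *
        (\<Sum>i\<in>UNIV. P' i (\<sigma> i) v * (\<Prod>j\<in>UNIV - {i}. P y0 $ j $ \<sigma> j))) = (\<Sum>i\<in>UNIV. P' i i v)" for v
  proof -
    have "of_int (sign \<sigma>) * (\<Sum>i\<in>UNIV. P' i (\<sigma> i) v * (\<Prod>j\<in>UNIV - {i}. P y0 $ j $ \<sigma> j)) =
        (if \<sigma> = id then \<Sum>i\<in>UNIV. P' i i v else 0)" if "\<sigma> \<in> {\<sigma>. \<sigma> permutes UNIV}" for \<sigma>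
      using that by (auto simp: z sign_id)
    then have "(\<Sum>\<sigma> | \<sigma> permutes UNIV. of_int (sign \<sigma>) *
        (\<Sum>i\<in>UNIV. P' i (\<sigma> i) v * (\<Prod>j\<in>UNIV - {i}. P y0 $ j $ \<sigma> j))) =
      (\<Sum>\<sigma> | \<sigma> permutes (UNIV :: 'n set). if \<sigma> = id then \<Sum>i\<in>UNIV. P' i i v else 0)"
      by (rule sum.cong[OF refl])
    then show ?thesis
      by (simp add: sum.delta finite_permutations permutes_id)
  qed
  then show ?thesis using * by simp
qed

text \<open>Jacobi's formula, reduced to the identity matrix through left multiplication by
  \<open>H\<close>.\<close>

lemma has_derivative_det:
  fixes M :: "'x::real_normed_vector \<Rightarrow> real^'n::finite^'n"
  assumes M: "\<And>i j. ((\<lambda>y. M y $ i $ j) has_derivative M' i j) (at y0)" and H: "H ** M y0 = mat 1"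
  shows "((\<lambda>y. det (M y)) has_derivative
    (\<lambda>v. det (M y0) * (\<Sum>i\<in>UNIV. \<Sum>l\<in>UNIV. H $ i $ l * M' l i v))) (at y0)"
proof -
  have "((\<lambda>y. det (H ** M y)) has_derivative (\<lambda>v. \<Sum>i\<in>UNIV. \<Sum>l\<in>UNIV. H $ i $ l * M' l i v)) (at y0)"
    by (rule has_derivative_det_at_mat_1[where P' = "\<lambda>i j v. \<Sum>l\<in>UNIV. H $ i $ l * M' l j v"])
      (auto simp: matrix_matrix_mult_def H[unfolded matrix_matrix_mult_def]
        intro!: has_derivative_sum has_derivative_mult_right M)
  moreover have "det (M y0) * det (H ** M y) = det (M y)" for y
  proof -
    have "det (M y0) * det H = 1"
      using arg_cong[OF H, of det] by (simp add: det_mul mult.commute)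
    then show ?thesis by (simp add: det_mul mult.assoc[symmetric])
  qed
  ultimately show ?thesis
    using has_derivative_mult_right[of "\<lambda>y. det (H ** M y)" _ "at y0" "det (M y0)"] by simp
qed

text \<open>Obtained from \<open>sqrt (sqrt (d * d))\<close>. The logarithmic form of the derivative
  is the one that combines with Jacobi's formula, since det M factors out there.\<close>

lemma has_derivative_sqrt_abs:
  fixes d :: "'x::real_normed_vector \<Rightarrow> real"
  assumes d: "(d has_derivative d') (at y0)" and nz: "d y0 \<noteq> 0"
  shows "((\<lambda>y. sqrt \<bar>d y\<bar>) has_derivative (\<lambda>v. sqrt \<bar>d y0\<bar> / 2 * (d' v / d y0))) (at y0)"
proof -
  have e: "((\<lambda>y. d y * d y) has_derivative (\<lambda>v. d y0 * d' v + d' v * d y0)) (at y0)"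
    by (rule has_derivative_mult[OF d d])
  have pos: "d y0 * d y0 > 0" using nz by (auto simp: zero_less_mult_iff linorder_neq_iff)
  have D: "((\<lambda>t. sqrt (sqrt t)) has_real_derivative
      inverse (sqrt (sqrt (d y0 * d y0))) / 2 * (inverse (sqrt (d y0 * d y0)) / 2)) (at (d y0 * d y0))"
    by (rule DERIV_chain2[OF DERIV_real_sqrt DERIV_real_sqrt[OF pos]]) (use nz in simp)
  have key: "inverse (sqrt \<bar>d y0\<bar>) / 2 * (inverse \<bar>d y0\<bar> / 2) * (d y0 * t + t * d y0) =
      sqrt \<bar>d y0\<bar> / 2 * (t / d y0)" for t
  proof -
    have s: "sqrt \<bar>d y0\<bar> * sqrt \<bar>d y0\<bar> = \<bar>d y0\<bar>" by simp
    have a: "\<bar>d y0\<bar> * \<bar>d y0\<bar> = d y0 * d y0" by simp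
    have "sqrt \<bar>d y0\<bar> > 0" "\<bar>d y0\<bar> > 0" using nz by simp_all
    then have "inverse (sqrt \<bar>d y0\<bar>) = sqrt \<bar>d y0\<bar> * inverse \<bar>d y0\<bar>"
      by (subst s[symmetric]) (simp add: field_simps)
    then have "inverse (sqrt \<bar>d y0\<bar>) / 2 * (inverse \<bar>d y0\<bar> / 2) * (d y0 * t + t * d y0) =
        sqrt \<bar>d y0\<bar> / 2 * (inverse (\<bar>d y0\<bar> * \<bar>d y0\<bar>) * d y0 * t)"
      by (simp add: algebra_simps flip: inverse_mult_distrib)
    also have "inverse (\<bar>d y0\<bar> * \<bar>d y0\<bar>) * d y0 * t = t / d y0"
      unfolding a using nz by (simp add: field_simps)
    finally show ?thesis .
  qed
  show ?thesis
    using has_derivative_compose[OF e D[unfolded has_field_derivative_def]]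
    unfolding real_sqrt_abs2 key .
qed

section \<open>Levi-Civita connections\<close>

lemma fun_plus_app: "(f + h) q = f q + h q"
  by (subst plus_fun_def) (rule refl)

lemma fun_scaleR_app: "(c *\<^sub>R f) q = c *\<^sub>R f q"
  by (subst scaleR_fun_def) (rule refl)

lemma smul_app: "smul f X q = f q *\<^sub>R X q"
  by (simp add: smul_def)

lemma fun_zero_app: "0 q = 0"
  by (subst (1) zero_fun_def) (rule refl)

lemma tvec_plus_app: "(v + w) f = v f + (w f :: real)"
  by (simp add: plus_fun_def)

lemma tvec_scaleR_app: "(c *\<^sub>R v) f = c * (v f :: real)"
  by (simp add: scaleR_fun_def)

locale levi_civita_manifold = pseudo_riemannian A g
  for A :: "('a::{t2_space,second_countable_topology}, 'n::finite) chart set" and g +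
  fixes nabla :: "'a vfield \<Rightarrow> 'a vfield \<Rightarrow> 'a vfield"
  assumes lc: "levi_civita A g nabla"
begin

lemmas lc' = lc[unfolded levi_civita_def]

lemma nabla_vf [simp]: "X \<in> vfields A \<Longrightarrow> Y \<in> vfields A \<Longrightarrow> nabla X Y \<in> vfields A"
  using conjunct1[OF lc'] by simp

lemma nabla_add:
  "X \<in> vfields A \<Longrightarrow> Y \<in> vfields A \<Longrightarrow> Z \<in> vfields A \<Longrightarrow> nabla (X + Y) Z = nabla X Z + nabla Y Z"
  "X \<in> vfields A \<Longrightarrow> Y \<in> vfields A \<Longrightarrow> Z \<in> vfields A \<Longrightarrow> nabla Z (X + Y) = nabla Z X + nabla Z Y"
  using conjunct1[OF conjunct2[OF lc']] by simp_all

lemma nabla_smul: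
  "smooth_fun A f \<Longrightarrow> X \<in> vfields A \<Longrightarrow> Y \<in> vfields A \<Longrightarrow> nabla (smul f X) Y = smul f (nabla X Y)"
  "smooth_fun A f \<Longrightarrow> X \<in> vfields A \<Longrightarrow> Y \<in> vfields A \<Longrightarrow>
    nabla X (smul f Y) = smul (\<lambda>p. X p f) Y + smul f (nabla X Y)"
  using conjunct1[OF conjunct2[OF conjunct2[OF lc']]] by simp_all

lemma torsion_free:
  "X \<in> vfields A \<Longrightarrow> Y \<in> vfields A \<Longrightarrow> bracket X Y = nabla X Y - nabla Y X"
  using conjunct1[OF conjunct2[OF conjunct2[OF conjunct2[OF lc']]]] by simp

lemma metric_compat:
  "X \<in> vfields A \<Longrightarrow> Y \<in> vfields A \<Longrightarrow> Z \<in> vfields A \<Longrightarrow>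
    X p (\<lambda>q. g q (Y q) (Z q)) = g p (nabla X Y p) (Z p) + g p (Y p) (nabla X Z p)"
  using conjunct2[OF conjunct2[OF conjunct2[OF conjunct2[OF lc']]]] by simp

lemma vf_T: "X \<in> vfields A \<Longrightarrow> X p \<in> T p"
  by (rule vfieldsD(1))

lemma tensorial_id: "tensorial p (\<lambda>X. X p)"
  by (rule tensorialI) (simp_all add: fun_plus_app smul_app)

lemma tensorial_nabla: "Z \<in> vfields A \<Longrightarrow> tensorial p (\<lambda>X. nabla X Z p)"
  by (rule tensorialI) (simp_all add: nabla_add nabla_smul fun_plus_app smul_app)

lemma tensorial_g1:
  assumes B: "tensorial p B" "\<And>X. X \<in> vfields A \<Longrightarrow> B X \<in> T p" and w: "w \<in> T p"
  shows "tensorial p (\<lambda>X. g p (B X) w)"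
  by (rule tensorialI)
    (simp_all add: tensorial_add[OF B(1)] tensorial_smul[OF B(1)] B(2) w g_add g_scale)

lemma tensorial_g2:
  assumes B: "tensorial p B" "\<And>X. X \<in> vfields A \<Longrightarrow> B X \<in> T p" and w: "w \<in> T p"
  shows "tensorial p (\<lambda>X. g p w (B X))"
  by (rule tensorialI)
    (simp_all add: tensorial_add[OF B(1)] tensorial_smul[OF B(1)] B(2) w g_add2 g_scale2)

lemma nabla_zero: "X \<in> vfields A \<Longrightarrow> nabla X 0 = 0"
  using nabla_add(2)[OF vf_zero vf_zero, of X] by simp

lemma nabla_scaleR:
  "X \<in> vfields A \<Longrightarrow> Y \<in> vfields A \<Longrightarrow> nabla X (c *\<^sub>R Y) = c *\<^sub>R nabla X Y"
  "X \<in> vfields A \<Longrightarrow> Y \<in> vfields A \<Longrightarrow> nabla (c *\<^sub>R X) Y = c *\<^sub>R nabla X Y"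
proof -
  assume X: "X \<in> vfields A" "Y \<in> vfields A"
  have "smul (\<lambda>p. X p (\<lambda>q. c)) Y = 0"
    by (rule ext) (simp add: smul_app tv_const[OF vf_T[OF X(1)]] fun_zero_app)
  then show "nabla X (c *\<^sub>R Y) = c *\<^sub>R nabla X Y" "nabla (c *\<^sub>R X) Y = c *\<^sub>R nabla X Y"
    by (simp_all add: scaleR_eq_smul nabla_smul smooth_fun_const X)
qed

lemma nabla_diff:
  assumes X: "X \<in> vfields A" "Y \<in> vfields A" "Z \<in> vfields A"
  shows "nabla Z (X - Y) = nabla Z X - nabla Z Y" "nabla (X - Y) Z = nabla X Z - nabla Y Z"
proof -
  have "X - Y = X + (-1) *\<^sub>R Y" by simp
  then show "nabla Z (X - Y) = nabla Z X - nabla Z Y" "nabla (X - Y) Z = nabla X Z - nabla Y Z"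
    using X by (simp_all only: nabla_add nabla_scaleR vf_scaleR) simp_all
qed

lemma nabla_sum:
  "Z \<in> vfields A \<Longrightarrow> (\<And>i. i \<in> I \<Longrightarrow> X i \<in> vfields A) \<Longrightarrow>
    nabla Z (\<Sum>i\<in>I. X i) = (\<Sum>i\<in>I. nabla Z (X i))"
  by (induction I rule: infinite_finite_induct) (simp_all add: nabla_zero nabla_add vf_sum)

text \<open>The cutoff times the difference of the two fields is the zero field. In the Leibniz rule
  at \<open>p\<close> the term that differentiates the cutoff carries the difference itself, which
  vanishes there.\<close>

lemma nabla_local:
  assumes X: "X \<in> vfields A" and Y: "Y \<in> vfields A" "Y' \<in> vfields A"
    and M: "open M" "p \<in> M" "\<And>q. q \<in> M \<Longrightarrow> Y q = Y' q"
  shows "nabla X Y p = nabla X Y' p"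
proof -
  obtain U x where c: "(U, x) \<in> A" "p \<in> U" by (rule chart_at)
  obtain \<beta> N C where b: "smooth_fun A \<beta>" "p \<in> N" "C \<subseteq> M"
    "\<And>q. q \<in> N \<Longrightarrow> \<beta> q = 1" "\<And>q. q \<notin> C \<Longrightarrow> \<beta> q = 0"
    by (rule bump_at[OF c M(2,1)]) blast
  let ?W = "Y - Y'"
  have W: "?W \<in> vfields A" by (rule vf_diff[OF Y])
  have W0: "?W q = 0" if "q \<in> M" for q using M(3)[OF that] by (simp add: minus_apply)
  have "smul \<beta> ?W = 0"
  proof
    fix q show "smul \<beta> ?W q = 0 q"
      using W0[of q] b(3,5) by (cases "q \<in> C") (auto simp: smul_app fun_zero_app)
  qed
  then have "nabla X (smul \<beta> ?W) p = 0" by (simp add: nabla_zero X fun_zero_app)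
  moreover have "nabla X (smul \<beta> ?W) p = nabla X ?W p"
    by (simp add: nabla_smul(2)[OF b(1) X W] fun_plus_app smul_app W0 M(2) b(2,4) M(3)[OF M(2)])
  ultimately show ?thesis by (simp add: nabla_diff X Y minus_apply)
qed

definition divg :: "'a vfield \<Rightarrow> 'a \<Rightarrow> real"
  where "divg Z = metric_trace A g (\<lambda>X Y p. g p (nabla X Z p) (Y p))"

lemma bitensorial_nabla:
  "Z \<in> vfields A \<Longrightarrow> bitensorial p (\<lambda>X Y. g p (nabla X Z p) (Y p))"
  by (intro bitensorialI tensorial_g1 tensorial_g2 tensorial_nabla tensorial_id) (auto intro: vf_T)

lemma divg_add: "Y \<in> vfields A \<Longrightarrow> Z \<in> vfields A \<Longrightarrow> divg (Y + Z) p = divg Y p + divg Z p"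
  by (simp add: divg_def metric_trace_fr nabla_add fun_plus_app g_add vf_T fr_vf sum.distrib distrib_left)

lemma divg_zero: "divg 0 p = 0"
  by (simp add: divg_def metric_trace_fr nabla_zero fun_zero_app fr_vf fr_T g_zero)

lemma divg_continuous: "Z \<in> vfields A \<Longrightarrow> continuous_on UNIV (divg Z)"
  unfolding divg_def
  by (intro metric_trace_continuous bitensorial_nabla smooth_fun_continuous g_smooth nabla_vf)

lemma divg_zero_near:
  assumes "Z \<in> vfields A" "open M" "p \<in> M" "\<And>q. q \<in> M \<Longrightarrow> Z q = 0"
  shows "divg Z p = 0"
proof -
  have "nabla (fr p i) Z p = 0" for i
    using nabla_local[OF fr_vf assms(1) vf_zero assms(2,3), of p i] assms(4)
    by (simp add: fun_zero_app nabla_zero fr_vf)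
  then show ?thesis by (simp add: divg_def metric_trace_fr g_zero fr_T)
qed

end

section \<open>The divergence in coordinates\<close>

locale levi_civita_coords = levi_civita_manifold A g nabla + metric_coords A g U x \<beta> N C
  for A :: "('a::{t2_space,second_countable_topology}, 'n::finite) chart set"
    and g nabla U x \<beta> N C
begin

lemma nabla_coords:
  assumes q: "q \<in> N" and Z: "Z \<in> vfields A"
  shows "nabla (dh j) Z q =
    (\<Sum>k\<in>UNIV. dh j q (\<lambda>p. Z p (xh k)) *\<^sub>R dh k q + Z q (xh k) *\<^sub>R nabla (dh j) (dh k) q)"
proof -
  note smooth = vfieldsD(2)[OF Z xh_smooth]
  define S where "S = (\<Sum>k\<in>UNIV. smul (\<lambda>p. Z p (xh k)) (dh k))"
  have sv: "smul (\<lambda>p. Z p (xh k)) (dh k) \<in> vfields A" for k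
    by (rule vf_smul[OF smooth dh_vf])
  have S: "S \<in> vfields A" unfolding S_def by (intro vf_sum sv)
  have "Z p = S p" if "p \<in> N" for p
    using tangent_expand[OF that vf_T[OF Z]] by (simp add: S_def sum_fun_app smul_app)
  then have "nabla (dh j) Z q = nabla (dh j) S q"
    by (rule nabla_local[OF dh_vf Z S N(1) q])
  also have "\<dots> = (\<Sum>k\<in>UNIV. dh j q (\<lambda>p. Z p (xh k)) *\<^sub>R dh k q + Z q (xh k) *\<^sub>R nabla (dh j) (dh k) q)"
    unfolding S_def
    by (simp add: nabla_sum dh_vf sv nabla_smul(2)[OF smooth] sum_fun_app fun_plus_app smul_app)
  finally show ?thesis .
qed

text \<open>The undifferentiated term is the contracted Christoffel symbol, expressed as half the
  trace of the inverse Gram matrix times a derivative of the Gram matrix.\<close>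

lemma divg_coords:
  assumes q: "q \<in> N" and Z: "Z \<in> vfields A"
  shows "divg Z q = (\<Sum>k\<in>UNIV. dh k q (\<lambda>p. Z p (xh k)) +
    Z q (xh k) * (1/2 * (\<Sum>j\<in>UNIV. \<Sum>l\<in>UNIV. Hinv q $ j $ l * dh k q (\<lambda>p. Gram p $ l $ j))))"
proof -
  note smooth = vfieldsD(2)[OF Z xh_smooth]
  have "divg Z q = (\<Sum>j\<in>UNIV. \<Sum>l\<in>UNIV. Hinv q $ j $ l * g q (nabla (dh j) Z q) (dh l q))"
    unfolding divg_def by (simp add: metric_trace_coords[OF q, where B = "\<lambda>X Y p. g p (nabla X Z p) (Y p)"]
        bitensorial_nabla[OF Z])
  also have "\<dots> = (\<Sum>j\<in>UNIV. nabla (dh j) Z q (xh j))"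
    by (simp add: Hinv_component[OF q] vf_T Z dh_vf)
  also have "\<dots> = (\<Sum>j\<in>UNIV. dh j q (\<lambda>p. Z p (xh j)) +
      (\<Sum>k\<in>UNIV. Z q (xh k) * nabla (dh j) (dh k) q (xh j)))"
  proof (rule sum.cong[OF refl])
    fix j
    have "nabla (dh j) Z q (xh j) =
        (\<Sum>k\<in>UNIV. dh j q (\<lambda>p. Z p (xh k)) * (if j = k then 1 else 0) +
          Z q (xh k) * nabla (dh j) (dh k) q (xh j))"
      by (simp add: nabla_coords[OF q Z] sum_fun_app tvec_plus_app tvec_scaleR_app dh_xh[OF q])
    also have "\<dots> = (\<Sum>k\<in>UNIV. (if k = j then dh j q (\<lambda>p. Z p (xh j)) else 0)) +
        (\<Sum>k\<in>UNIV. Z q (xh k) * nabla (dh j) (dh k) q (xh j))"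
      unfolding sum.distrib[symmetric] by (rule sum.cong) auto
    finally show "nabla (dh j) Z q (xh j) = dh j q (\<lambda>p. Z p (xh j)) +
        (\<Sum>k\<in>UNIV. Z q (xh k) * nabla (dh j) (dh k) q (xh j))" by simp
  qed
  also have "\<dots> = (\<Sum>k\<in>UNIV. dh k q (\<lambda>p. Z p (xh k)) +
      Z q (xh k) * (\<Sum>j\<in>UNIV. nabla (dh j) (dh k) q (xh j)))"
    by (simp add: sum.distrib sum_distrib_left) (rule sum.swap)
  also have "(\<lambda>k. \<Sum>j\<in>UNIV. nabla (dh j) (dh k) q (xh j)) =
      (\<lambda>k. 1/2 * (\<Sum>j\<in>UNIV. \<Sum>l\<in>UNIV. Hinv q $ j $ l * dh k q (\<lambda>p. Gram p $ l $ j)))"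
  proof
    fix k
    \<comment> \<open>On \<open>N\<close> the functions \<open>dh b p (xh l)\<close> are constant,
      so the cut-off coordinate fields commute there and torsion-freeness swaps the two
      indices.\<close>
    have br: "nabla (dh j) (dh k) q = nabla (dh k) (dh j) q" for j
    proof -
      have "dh a q (\<lambda>p. dh b p (xh l)) = 0" for a b l
      proof -
        have "dh a q (\<lambda>p. dh b p (xh l)) = dh a q (\<lambda>p. if l = b then 1 else 0)"
          by (rule tv_local[OF dh_tangent N(1) q])
            (auto simp: dh_xh smooth_fun_const intro: vfieldsD(2)[OF dh_vf xh_smooth])
        then show ?thesis by (simp only: tv_const[OF dh_tangent])
      qed
      then have "bracket (dh j) (dh k) q (xh l) = 0" for l
        by (simp add: bracket_def)
      then have "bracket (dh j) (dh k) q = 0"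
        by (intro tangent_eqI[OF q vf_T[OF vf_bracket[OF dh_vf dh_vf]] ts_zero]) (simp add: fun_zero_app)
      then show ?thesis
        using fun_cong[OF torsion_free[OF dh_vf dh_vf, of j k], of q] by (simp add: minus_apply)
    qed
    have gs: "g q (dh j q) (nabla (dh k) (dh l) q) = g q (nabla (dh k) (dh l) q) (dh j q)" for j l
      by (rule g_sym[OF dh_tangent vf_T[OF nabla_vf[OF dh_vf dh_vf]]])
    have Hs: "Hinv q $ j $ l = Hinv q $ l $ j" for j l by (simp add: Hinv_def mult_ac)
    \<comment> \<open>\<open>?S1\<close> and \<open>?S2\<close> agree because \<open>Hinv\<close> is
      symmetric, and metric compatibility evaluates their sum. This is the origin of the factor
      1/2.\<close>
    have "(\<Sum>j\<in>UNIV. nabla (dh j) (dh k) q (xh j)) =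
        (\<Sum>j\<in>UNIV. \<Sum>l\<in>UNIV. Hinv q $ j $ l * g q (nabla (dh k) (dh j) q) (dh l q))" (is "_ = ?S1")
      by (simp add: br Hinv_component[OF q] vf_T dh_vf)
    moreover have "?S1 = (\<Sum>j\<in>UNIV. \<Sum>l\<in>UNIV. Hinv q $ j $ l * g q (nabla (dh k) (dh l) q) (dh j q))"
      (is "_ = ?S2") by (subst sum.swap) (simp add: Hs)
    moreover have "?S1 + ?S2 = (\<Sum>j\<in>UNIV. \<Sum>l\<in>UNIV. Hinv q $ j $ l * dh k q (\<lambda>p. Gram p $ l $ j))"
      unfolding sum.distrib[symmetric]
      by (intro sum.cong refl)
        (simp add: Gram_def metric_compat dh_vf distrib_left gs)
    ultimately show "(\<Sum>j\<in>UNIV. nabla (dh j) (dh k) q (xh j)) =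
      1/2 * (\<Sum>j\<in>UNIV. \<Sum>l\<in>UNIV. Hinv q $ j $ l * dh k q (\<lambda>p. Gram p $ l $ j))" by simp
  qed
  finally show ?thesis .
qed

definition "\<rho> y = sqrt \<bar>det (Gram (inv_x y))\<bar>"

lemma xN_open: "open (x ` N)"
  using chart_image_open[OF chart N(1)] N C by (simp add: Int_absorb1 subset_trans)

lemma xN_sub: "x ` N \<subseteq> x ` U"
  using N C by blast

lemma inv_xN: "y \<in> x ` N \<Longrightarrow> inv_x y \<in> N" "y \<in> x ` N \<Longrightarrow> x (inv_x y) = y"
  using NU cf(6) by auto

lemma \<rho>_smooth: "smooth_on \<rho> (x ` N)"
  unfolding \<rho>_def
proof (rule smooth_on_sqrt_abs[OF xN_open])
  show "det (Gram (inv_x y)) \<noteq> 0" if "y \<in> x ` N" for y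
    using det_Gram inv_xN(1) that by blast
  have "smooth_on (\<lambda>y. Gram (inv_x y) $ j $ k) (x ` N)" for j k
    by (rule smooth_on_subset[OF smooth_funD[OF Gram_smooth chart] xN_sub])
  then show "smooth_on (\<lambda>y. det (Gram (inv_x y))) (x ` N)"
    unfolding det_def
    by (intro smooth_on_sum smooth_on_mult smooth_on_prod smooth_on_const xN_open)
qed

lemma dh_frechet:
  assumes "y \<in> x ` N" "smooth_fun A f"
  shows "((\<lambda>y. f (inv_x y)) has_derivative frechet_derivative (\<lambda>y. f (inv_x y)) (at y)) (at y)"
    "frechet_derivative (\<lambda>y. f (inv_x y)) (at y) (axis k 1) = dh k (inv_x y) f"
  using smooth_on_has_derivative[OF smooth_funD[OF assms(2) chart]] assms xN_sub
    inv_xN[OF assms(1)] by (auto simp: dh_eq coord_vec_def o_def)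

text \<open>By Jacobi's formula the trace term of \<open>divg_coords\<close> is the logarithmic
  derivative of the density \<open>\<rho>\<close>, so the product rule collects everything into
  Euclidean partial derivatives.\<close>

lemma divg_chart:
  assumes Z: "Z \<in> vfields A" and y: "y \<in> x ` N"
  shows "\<rho> y * divg Z (inv_x y) =
    (\<Sum>k\<in>UNIV. frechet_derivative (\<lambda>y. \<rho> y * Z (inv_x y) (xh k)) (at y) (axis k 1))"
proof -
  let ?q = "inv_x y"
  have q: "?q \<in> N" using inv_xN[OF y] by simp
  note smooth = vfieldsD(2)[OF Z xh_smooth]
  define \<Gamma>' where "\<Gamma>' l j = frechet_derivative (\<lambda>y. Gram (inv_x y) $ l $ j) (at y)" for l j
  have d: "((\<lambda>y. det (Gram (inv_x y))) has_derivative
      (\<lambda>v. det (Gram ?q) * (\<Sum>j\<in>UNIV. \<Sum>l\<in>UNIV. Hinv ?q $ j $ l * \<Gamma>' l j v))) (at y)"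
    unfolding \<Gamma>'_def
    by (rule has_derivative_det[OF dh_frechet(1)[OF y Gram_smooth] Hinv_Gram[OF q]])
  have r: "(\<rho> has_derivative (\<lambda>v. \<rho> y / 2 *
      (\<Sum>j\<in>UNIV. \<Sum>l\<in>UNIV. Hinv ?q $ j $ l * \<Gamma>' l j v))) (at y)"
    using has_derivative_sqrt_abs[OF d det_Gram[OF q]] det_Gram[OF q] by (simp add: \<rho>_def[abs_def])
  have "frechet_derivative (\<lambda>y. \<rho> y * Z (inv_x y) (xh k)) (at y) (axis k 1) =
      \<rho> y * dh k ?q (\<lambda>p. Z p (xh k)) + \<rho> y / 2 *
        (\<Sum>j\<in>UNIV. \<Sum>l\<in>UNIV. Hinv ?q $ j $ l * dh k ?q (\<lambda>p. Gram p $ l $ j)) * Z ?q (xh k)" for k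
    using fun_cong[OF frechet_derivative_at[OF has_derivative_mult[OF r dh_frechet(1)[OF y smooth[of k]]]],
        of "axis k 1"]
    by (simp add: dh_frechet(2)[OF y smooth] \<Gamma>'_def dh_frechet(2)[OF y Gram_smooth])
  then show ?thesis
    by (simp add: divg_coords[OF q Z] sum_distrib_left distrib_left mult_ac)
qed

end

section \<open>The divergence theorem\<close>

locale volume_manifold = levi_civita_manifold A g nabla
  for A :: "('a::{t2_space,second_countable_topology}, 'n::finite) chart set" and g nabla +
  fixes vol :: "'a measure"
  assumes volume: "volume_measure A g vol"
begin

lemma sets_vol [measurable_cong]: "sets vol = sets borel"
  using volume by (simp add: volume_measure_def)

lemma space_vol: "space vol = UNIV"
  using sets_eq_imp_space_eq[OF sets_vol] by simp

lemma continuous_measurable_vol: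
  fixes f :: "'a \<Rightarrow> real"
  shows "continuous_on UNIV f \<Longrightarrow> f \<in> borel_measurable vol"
  using borel_measurable_continuous_onI[of f] measurable_cong_sets[OF sets_vol refl] by blast

end

section \<open>The volume measure in one chart\<close>

locale volume_coords = volume_manifold A g nabla vol + levi_civita_coords A g nabla U x \<beta> N C
  for A :: "('a::{t2_space,second_countable_topology}, 'n::finite) chart set"
    and g nabla vol U x \<beta> N C
begin

definition "w y = (if y \<in> x ` N then \<rho> y else 0)"

text \<open>A total Borel measurable version of the inverse chart. The default value falls where the
  weight \<open>w\<close> is zero and never reaches an integral.\<close>

definition "iN y = (if y \<in> x ` N then inv_x y else undefined)"

lemma iN_measurable: "iN \<in> borel_measurable borel"
  unfolding iN_def[abs_def]
  by (rule borel_measurable_continuous_on_if)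
    (auto intro: borel_open xN_open continuous_on_subset[OF cf(5) xN_sub])

lemma iN_measurable': "iN \<in> measurable (density lborel w) borel"
  using iN_measurable measurable_cong_sets[of "density lborel w" borel borel borel] by simp

lemma w_measurable: "w \<in> borel_measurable borel"
  unfolding w_def[abs_def]
  by (rule borel_measurable_continuous_on_if)
    (auto intro: borel_open xN_open smooth_on_imp_continuous_on[OF \<rho>_smooth])

lemma w_nonneg: "w y \<ge> 0"
  by (simp add: w_def \<rho>_def)

text \<open>\<open>volume_measure\<close> prescribes the measure of Borel sets inside a chart. As an
  equality of measures the prescription transfers integrals of functions supported in
  \<open>N\<close>.\<close>

lemma distr_density_chart:
  "distr (density lborel w) borel iN = density vol (indicator N)"
proof (rule measure_eqI)
  fix B assume "B \<in> sets (distr (density lborel w) borel iN)"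
  then have B: "B \<in> sets borel" by simp
  have Nb: "N \<in> sets borel" using N(1) by simp
  have NB: "N \<inter> B \<in> sets borel" "N \<inter> B \<subseteq> U" using B Nb NU by auto
  have "emeasure vol (N \<inter> B) = (\<integral>\<^sup>+y\<in>x ` (N \<inter> B).
      ennreal (sqrt \<bar>det (\<chi> i j. let p = inv_x y in
        g p (coord_vec A (U, x) i p) (coord_vec A (U, x) j p))\<bar>) \<partial>lborel)"
    using volume chart NB unfolding volume_measure_def by fast
  also have "\<dots> = (\<integral>\<^sup>+y. ennreal (w y) * indicator (iN -` B) y \<partial>lborel)"
  proof (rule nn_integral_cong)
    fix y
    show "ennreal (sqrt \<bar>det (\<chi> i j. let p = inv_x y in
        g p (coord_vec A (U, x) i p) (coord_vec A (U, x) j p))\<bar>) * indicator (x ` (N \<inter> B)) y =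
      ennreal (w y) * indicator (iN -` B) y"
    proof (cases "y \<in> x ` N")
      case True
      note i = inv_xN[OF True]
      have "(\<chi> i j. let p = inv_x y in
          g p (coord_vec A (U, x) i p) (coord_vec A (U, x) j p)) = Gram (inv_x y)"
        by (simp add: Gram_def Let_def dh_eq i)
      moreover have "y \<in> x ` (N \<inter> B) \<longleftrightarrow> inv_x y \<in> B"
        using i cf(6) NU by (metis IntD1 IntD2 IntI imageE imageI)
      ultimately show ?thesis
        using True by (simp add: w_def iN_def \<rho>_def indicator_def)
    next
      case False
      then have "y \<notin> x ` (N \<inter> B)" by blast
      then show ?thesis using False by (simp add: w_def)
    qed
  qed
  also have "\<dots> = emeasure (density lborel w) (iN -` B \<inter> space (density lborel w))"
    using measurable_sets[OF iN_measurable B] w_measurable by (simp add: emeasure_density)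
  also have "\<dots> = emeasure (distr (density lborel w) borel iN) B"
    by (rule emeasure_distr[OF iN_measurable' B, symmetric])
  finally show "emeasure (distr (density lborel w) borel iN) B = emeasure (density vol (indicator N)) B"
    using B Nb by (simp add: emeasure_restricted sets_vol)
qed (simp add: sets_vol)

lemma vol_transfer:
  fixes f :: "'a \<Rightarrow> real"
  assumes f: "f \<in> borel_measurable borel" and z: "\<And>q. q \<notin> N \<Longrightarrow> f q = 0"
  shows "integrable vol f \<longleftrightarrow> integrable lborel (\<lambda>y. w y * f (iN y))"
    and "integral\<^sup>L vol f = (LINT y|lborel. w y * f (iN y))"
proof -
  have fv: "f \<in> borel_measurable vol" using f measurable_cong_sets[OF sets_vol refl] by blast
  have iv: "(indicator N :: 'a \<Rightarrow> real) \<in> borel_measurable vol"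
    by (rule borel_measurable_indicator) (simp add: sets_vol N(1))
  have ind: "(\<lambda>q. indicator N q *\<^sub>R f q) = f"
  proof
    fix q show "indicator N q *\<^sub>R f q = f q" by (cases "q \<in> N") (simp_all add: z)
  qed
  have d: "density vol (\<lambda>q. ennreal (indicator N q)) = density vol (indicator N)"
    by (simp add: ennreal_indicator)
  note i = iN_measurable'
  have fi: "(\<lambda>y. f (iN y)) \<in> borel_measurable lborel"
    using measurable_compose[OF iN_measurable f] by simp
  have wl: "w \<in> borel_measurable lborel" using w_measurable by simp
  show "integrable vol f \<longleftrightarrow> integrable lborel (\<lambda>y. w y * f (iN y))"
    using integrable_density[OF fv iv] ind d integrable_distr_eq[OF i f] integrable_density[OF fi wl]
    by (simp add: distr_density_chart w_nonneg)
  show "integral\<^sup>L vol f = (LINT y|lborel. w y * f (iN y))"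
    using integral_density[OF fv iv] ind d integral_distr[OF i f] integral_density[OF fi wl]
    by (simp add: distr_density_chart w_nonneg)
qed

lemma compact_image: "compact K \<Longrightarrow> K \<subseteq> N \<Longrightarrow> compact (x ` K)"
  using NU by (intro compact_continuous_image continuous_on_subset[OF cf(4)]) auto

lemma compact_finite_chart:
  assumes K: "compact K" "K \<subseteq> N"
  shows "emeasure vol K < \<infinity>"
proof -
  have Kb: "K \<in> sets borel" using compact_imp_closed[OF K(1)] by simp
  have eq: "w y * indicator K (iN y) = indicator (x ` K) y *\<^sub>R \<rho> y" for y
  proof (cases "y \<in> x ` N")
    case True
    have "y \<in> x ` K \<longleftrightarrow> inv_x y \<in> K"
      using inv_xN[OF True] cf(6) NU K(2) by (metis imageE imageI subsetD)
    then show ?thesis using True by (simp add: w_def iN_def indicator_def)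
  next
    case False
    then have "y \<notin> x ` K" using K(2) by blast
    then show ?thesis using False by (simp add: w_def)
  qed
  have "integrable lborel (\<lambda>y. indicator (x ` K) y *\<^sub>R \<rho> y)"
    using K by (intro borel_integrable_compact compact_image
        continuous_on_subset[OF smooth_on_imp_continuous_on[OF \<rho>_smooth]]) auto
  then have "integrable lborel (\<lambda>y. w y * indicator K (iN y))" by (simp add: eq)
  then have "integrable vol (indicator K :: 'a \<Rightarrow> real)"
    using vol_transfer(1)[of "indicator K"] Kb K(2) by (auto simp: indicator_def)
  then show ?thesis
    using Kb by (simp add: integrable_indicator_iff sets_vol space_vol)
qed

text \<open>In the chart the weighted divergence is the Euclidean divergence of the functions
  \<open>F k\<close>, that is \<open>\<rho>\<close> times the components of Z, extended smoothly by
  zero because Z vanishes off \<open>K\<close>.\<close>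

lemma divergence_theorem_chart:
  assumes Z: "Z \<in> vfields A" and K: "compact K" "K \<subseteq> N" and z: "\<And>q. q \<notin> K \<Longrightarrow> Z q = 0"
  shows "integrable vol (divg Z)" "integral\<^sup>L vol (divg Z) = 0"
proof -
  have Ko: "open (- K)" "open (- x ` K)"
    using compact_imp_closed[OF K(1)] compact_imp_closed[OF compact_image[OF K]] by auto
  have dz: "divg Z q = 0" if "q \<notin> K" for q
    using divg_zero_near[OF Z Ko(1)] z that by auto
  define F where "F k y = (if y \<in> x ` N then \<rho> y * Z (inv_x y) (xh k) else 0)" for k y
  have F0: "F k y = 0" if "y \<notin> x ` K" for k y
  proof (cases "y \<in> x ` N")
    case True
    then have "inv_x y \<notin> K" using that inv_xN(2)[OF True] by (metis imageI)
    then show ?thesis by (simp add: F_def z fun_zero_app)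
  qed (simp add: F_def)
  have Fs: "smooth_on (F k) UNIV" for k
  proof (rule smooth_on_local)
    fix y
    show "\<exists>T. open T \<and> y \<in> T \<and> smooth_on (F k) T"
    proof (cases "y \<in> x ` N")
      case True
      have "smooth_on (\<lambda>y. Z (inv_x y) (xh k)) (x ` N)"
        by (rule smooth_on_subset[OF smooth_funD[OF vfieldsD(2)[OF Z xh_smooth] chart] xN_sub])
      from smooth_on_mult[OF xN_open \<rho>_smooth this] have "smooth_on (F k) (x ` N)"
        by (rule smooth_on_cong[OF xN_open, rotated]) (simp add: F_def)
      then show ?thesis using True xN_open by blast
    next
      case False
      have "smooth_on (F k) (- x ` K)"
        by (rule smooth_on_cong[OF Ko(2) _ smooth_on_const[of 0]]) (simp add: F0)
      moreover have "y \<in> - x ` K" using False K(2) by auto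
      ultimately show ?thesis using Ko(2) by blast
    qed
  qed
  have eq: "w y * divg Z (iN y) = (\<Sum>k\<in>UNIV. frechet_derivative (F k) (at y) (axis k 1))" for y
  proof (cases "y \<in> x ` N")
    case True
    have "frechet_derivative (F k) (at y) =
        frechet_derivative (\<lambda>y. \<rho> y * Z (inv_x y) (xh k)) (at y)" for k
    proof (rule frechet_derivative_transform_within_open[OF _ xN_open True])
      show "F k differentiable at y"
        using smooth_on_has_derivative[OF Fs, of y k] by (auto simp: differentiable_def)
    qed (simp add: F_def)
    then show ?thesis using True divg_chart[OF Z True] by (simp add: w_def iN_def)
  next
    case False
    then have y: "y \<in> - x ` K" using K(2) by auto
    have "frechet_derivative (F k) (at y) = frechet_derivative (\<lambda>_. 0) (at y)" for k
    proof (rule frechet_derivative_transform_within_open[OF _ Ko(2) y])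
      show "F k differentiable at y"
        using smooth_on_has_derivative[OF Fs, of y k] by (auto simp: differentiable_def)
    qed (simp add: F0)
    then show ?thesis using False by (simp add: w_def)
  qed
  note int = integral_directional_derivative[OF Fs compact_image[OF K] F0]
  have m: "divg Z \<in> borel_measurable borel"
    by (rule borel_measurable_continuous_onI[OF divg_continuous[OF Z]])
  have zN: "divg Z q = 0" if "q \<notin> N" for q using dz that K(2) by blast
  show "integrable vol (divg Z)"
    by (subst vol_transfer(1)[OF m zN], assumption)
      (unfold eq, intro Bochner_Integration.integrable_sum int(1))
  show "integral\<^sup>L vol (divg Z) = 0"
    by (subst vol_transfer(2)[OF m zN], assumption) (simp add: eq int)
qed

end

section \<open>From one chart to the whole manifold\<close>

context volume_manifold
begin

lemma volume_coords_at:
  assumes "(U, x) \<in> A" "p \<in> U"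
  obtains \<beta> N C where "volume_coords A g nabla vol U x \<beta> N C" "p \<in> N"
proof -
  obtain \<beta> N C where "metric_coords A g U x \<beta> N C" "p \<in> N"
    by (rule metric_coords_at[OF assms UNIV_I open_UNIV])
  then show ?thesis
    using that volume_manifold_axioms levi_civita_manifold_axioms
    unfolding volume_coords_def levi_civita_coords_def by metis
qed

text \<open>Collects what the global theorem takes from a chart: a neighbourhood of finite volume
  and a cutoff, equal to 1 there, whose product with any field has an integrable divergence of
  integral zero.\<close>

lemma divergence_bump:
  "\<exists>b M. smooth_fun A b \<and> open M \<and> p \<in> M \<and> (\<forall>q\<in>M. b q = 1) \<and> emeasure vol M < \<infinity> \<and>
    (\<forall>Z\<in>vfields A. integrable vol (divg (smul b Z)) \<and> integral\<^sup>L vol (divg (smul b Z)) = 0)"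
proof -
  obtain U x where c: "(U, x) \<in> A" "p \<in> U" by (rule chart_at)
  obtain \<beta> N C where "volume_coords A g nabla vol U x \<beta> N C" and p: "p \<in> N"
    by (rule volume_coords_at[OF c])
  then interpret volume_coords A g nabla vol U x \<beta> N C by simp
  obtain b M K where b: "smooth_fun A b" "open M" "p \<in> M" "M \<subseteq> K" "compact K" "K \<subseteq> U" "K \<subseteq> N"
    "\<And>q. q \<in> M \<Longrightarrow> b q = 1" "\<And>q. q \<notin> K \<Longrightarrow> b q = 0"
    by (rule bump_at[OF c p N(1)]) blast
  have "emeasure vol M \<le> emeasure vol K"
    using b(4) compact_imp_closed[OF b(5)] by (intro emeasure_mono) (auto simp: sets_vol)
  also have "\<dots> < \<infinity>" by (rule compact_finite_chart[OF b(5,7)])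
  finally have fin: "emeasure vol M < \<infinity>" .
  have "integrable vol (divg (smul b Z)) \<and> integral\<^sup>L vol (divg (smul b Z)) = 0"
    if Z: "Z \<in> vfields A" for Z
    using divergence_theorem_chart[OF vf_smul[OF b(1) Z] b(5,7)] b(9) by (simp add: smul_app)
  then show ?thesis using b fin by blast
qed

definition "bmp p = (SOME (b, M). smooth_fun A b \<and> open M \<and> p \<in> M \<and> (\<forall>q\<in>M. b q = 1) \<and>
    emeasure vol M < \<infinity> \<and>
    (\<forall>Z\<in>vfields A. integrable vol (divg (smul b Z)) \<and> integral\<^sup>L vol (divg (smul b Z)) = 0))"

lemma bmp:
  defines "b \<equiv> \<lambda>p. fst (bmp p)" and "M \<equiv> \<lambda>p. snd (bmp p)"
  shows "smooth_fun A (b p)" "open (M p)" "p \<in> M p" "\<And>q. q \<in> M p \<Longrightarrow> b p q = 1"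
    "emeasure vol (M p) < \<infinity>" "\<And>Z. Z \<in> vfields A \<Longrightarrow> integrable vol (divg (smul (b p) Z))"
    "\<And>Z. Z \<in> vfields A \<Longrightarrow> integral\<^sup>L vol (divg (smul (b p) Z)) = 0"
proof -
  let ?P = "\<lambda>(b, M). smooth_fun A b \<and> open M \<and> p \<in> M \<and> (\<forall>q\<in>M. b q = 1) \<and>
    emeasure vol M < \<infinity> \<and>
    (\<forall>Z\<in>vfields A. integrable vol (divg (smul b Z)) \<and> integral\<^sup>L vol (divg (smul b Z)) = 0)"
  have "\<exists>y. ?P y" using divergence_bump[of p] by auto
  from someI_ex[OF this] have "?P (bmp p)" unfolding bmp_def .
  then show "smooth_fun A (b p)" "open (M p)" "p \<in> M p" "\<And>q. q \<in> M p \<Longrightarrow> b p q = 1"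
    "emeasure vol (M p) < \<infinity>" "\<And>Z. Z \<in> vfields A \<Longrightarrow> integrable vol (divg (smul (b p) Z))"
    "\<And>Z. Z \<in> vfields A \<Longrightarrow> integral\<^sup>L vol (divg (smul (b p) Z)) = 0"
    unfolding b_def M_def by (simp_all add: case_prod_beta)
qed

lemma finite_cover:
  assumes "compact K"
  obtains I where "finite I" "K \<subseteq> (\<Union>p\<in>I. snd (bmp p))"
proof -
  have "K \<subseteq> (\<Union>p\<in>K. snd (bmp p))" using bmp(3) by blast
  then show ?thesis
    using compactE_image[OF assms, of K "\<lambda>p. snd (bmp p)"] bmp(2) that by metis
qed

lemma compact_finite:
  assumes "compact K"
  shows "emeasure vol K < \<infinity>"
proof -
  obtain I where I: "finite I" "K \<subseteq> (\<Union>p\<in>I. snd (bmp p))" by (rule finite_cover[OF assms])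
  have s: "snd (bmp p) \<in> sets vol" for p by (simp add: sets_vol bmp(2))
  have "emeasure vol K \<le> emeasure vol (\<Union>p\<in>I. snd (bmp p))"
    using I s by (intro emeasure_mono sets.finite_UN) auto
  also have "\<dots> \<le> (\<Sum>p\<in>I. emeasure vol (snd (bmp p)))"
    using I s by (intro emeasure_subadditive_finite) auto
  also have "\<dots> < \<infinity>" using I(1) bmp(5) by (simp add: ennreal_sum_less_top infinity_ennreal_def)
  finally show ?thesis .
qed

lemma set_integrable_continuous:
  fixes f :: "'a \<Rightarrow> real"
  assumes f: "continuous_on UNIV f" and D: "open D" "compact (closure D)"
  shows "set_integrable vol D f"
proof -
  have "bounded (f ` closure D)"
    by (intro compact_imp_bounded compact_continuous_image continuous_on_subset[OF f] D) simp
  then obtain B where B: "\<And>p. p \<in> D \<Longrightarrow> norm (f p) \<le> B"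
    unfolding bounded_iff using closure_subset by blast
  have "emeasure vol D \<le> emeasure vol (closure D)"
    by (intro emeasure_mono closure_subset) (simp add: sets_vol)
  also have "\<dots> < \<infinity>" by (rule compact_finite[OF D(2)])
  finally show ?thesis
    unfolding set_integrable_def using D(1) B
    by (intro integrableI_bounded_set_indicator[where B = B] continuous_measurable_vol f)
      (auto simp: sets_vol)
qed

text \<open>Induction over a finite cover takes the place of a partition of unity: the piece
  \<open>smul b Z\<close> is handled by one chart, and the rest \<open>(1 - b) Z\<close> vanishes on
  the corresponding neighbourhood, so one set fewer is enough for it.\<close>

theorem divergence_theorem:
  assumes Z: "Z \<in> vfields A" and K: "compact K" and z: "\<And>q. q \<notin> K \<Longrightarrow> Z q = 0"
  shows "integrable vol (divg Z)" "integral\<^sup>L vol (divg Z) = 0"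
proof -
  obtain I where I: "finite I" "K \<subseteq> (\<Union>p\<in>I. snd (bmp p))" by (rule finite_cover[OF K])
  \<comment> \<open>The induction carries vanishing off the union of the cover; unlike support in
    the fixed set \<open>K\<close>, this condition shrinks with the cover.\<close>
  have "integrable vol (divg Z) \<and> integral\<^sup>L vol (divg Z) = 0"
    if "Z \<in> vfields A" "\<And>q. q \<notin> (\<Union>p\<in>I. snd (bmp p)) \<Longrightarrow> Z q = 0" for Z
    using I(1) that
  proof (induction I arbitrary: Z rule: finite_induct)
    case empty
    then have zq: "Z q = 0" for q by blast
    have "Z = 0" by (rule ext) (simp only: zq fun_zero_app)
    then have "divg Z = (\<lambda>p. 0)" by (intro ext) (simp add: divg_zero)
    then show ?case by simp
  next
    case (insert p I)
    let ?b = "fst (bmp p)"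
    define Y where "Y = smul (\<lambda>q. 1 - ?b q) Z"
    have Y: "Y \<in> vfields A" unfolding Y_def
      by (intro vf_smul smooth_fun_diff smooth_fun_const bmp(1) insert.prems(1))
    have bZ: "smul ?b Z \<in> vfields A" by (intro vf_smul bmp(1) insert.prems(1))
    have "Y q = 0" if "q \<notin> (\<Union>p\<in>I. snd (bmp p))" for q
      using insert.prems(2)[of q] bmp(4)[of q p] that
      by (cases "q \<in> snd (bmp p)") (auto simp: Y_def smul_app)
    then have Yi: "integrable vol (divg Y)" "integral\<^sup>L vol (divg Y) = 0"
      using insert.IH[OF Y] by auto
    have "Z = smul ?b Z + Y"
      by (rule ext) (simp add: Y_def fun_plus_app smul_app flip: scaleR_add_left)
    then have "divg Z = (\<lambda>q. divg (smul ?b Z) q + divg Y q)"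
      using divg_add[OF bZ Y] by (intro ext) metis
    then show ?case
      using Yi bmp(6,7)[OF insert.prems(1), of p] by simp
  qed
  then show "integrable vol (divg Z)" "integral\<^sup>L vol (divg Z) = 0"
    using Z z I(2) by blast+
qed

end

section \<open>Curvature\<close>

context levi_civita_manifold
begin

declare vf_add [simp] vf_diff [simp] vf_uminus [simp] vf_zero [simp] vf_bracket [simp] vf_scaleR [simp]
  fr_vf [simp]

definition "ip p X Y = g p (X p) (Y p)"

lemma ip_sym: "X \<in> vfields A \<Longrightarrow> Y \<in> vfields A \<Longrightarrow> ip p X Y = ip p Y X"
  by (simp add: ip_def g_sym vf_T)

lemma ip_simps [simp]:
  shows "X \<in> vfields A \<Longrightarrow> Y \<in> vfields A \<Longrightarrow> Z \<in> vfields A \<Longrightarrow> ip p (X + Y) Z = ip p X Z + ip p Y Z"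
    "X \<in> vfields A \<Longrightarrow> Y \<in> vfields A \<Longrightarrow> Z \<in> vfields A \<Longrightarrow> ip p Z (X + Y) = ip p Z X + ip p Z Y"
    "X \<in> vfields A \<Longrightarrow> Y \<in> vfields A \<Longrightarrow> Z \<in> vfields A \<Longrightarrow> ip p (X - Y) Z = ip p X Z - ip p Y Z"
    "X \<in> vfields A \<Longrightarrow> Y \<in> vfields A \<Longrightarrow> Z \<in> vfields A \<Longrightarrow> ip p Z (X - Y) = ip p Z X - ip p Z Y"
    "X \<in> vfields A \<Longrightarrow> Z \<in> vfields A \<Longrightarrow> ip p (- X) Z = - ip p X Z"
    "X \<in> vfields A \<Longrightarrow> Z \<in> vfields A \<Longrightarrow> ip p Z (- X) = - ip p Z X"
    "X \<in> vfields A \<Longrightarrow> Z \<in> vfields A \<Longrightarrow> ip p (smul f X) Z = f p * ip p X Z"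
    "X \<in> vfields A \<Longrightarrow> Z \<in> vfields A \<Longrightarrow> ip p Z (smul f X) = f p * ip p Z X"
    "X \<in> vfields A \<Longrightarrow> Z \<in> vfields A \<Longrightarrow> ip p (c *\<^sub>R X) Z = c * ip p X Z"
    "X \<in> vfields A \<Longrightarrow> Z \<in> vfields A \<Longrightarrow> ip p Z (c *\<^sub>R X) = c * ip p Z X"
    "Z \<in> vfields A \<Longrightarrow> ip p 0 Z = 0" "Z \<in> vfields A \<Longrightarrow> ip p Z 0 = 0"
  by (simp_all add: ip_def fun_plus_app minus_apply uminus_apply fun_zero_app smul_app fun_scaleR_app
      g_add g_add2 g_diff g_minus g_zero g_scale g_scale2 vf_T)

lemma ip_smooth: "X \<in> vfields A \<Longrightarrow> Y \<in> vfields A \<Longrightarrow> smooth_fun A (\<lambda>q. ip q X Y)"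
  unfolding ip_def by (rule g_smooth)

lemma ip_deriv:
  "X \<in> vfields A \<Longrightarrow> Y \<in> vfields A \<Longrightarrow> Z \<in> vfields A \<Longrightarrow>
    X p (\<lambda>q. ip q Y Z) = ip p (nabla X Y) Z + ip p Y (nabla X Z)"
  unfolding ip_def by (rule metric_compat)

lemma ip_nondeg:
  assumes X: "X \<in> vfields A" and z: "\<And>Z. Z \<in> vfields A \<Longrightarrow> ip p X Z = 0"
  shows "X p = 0"
proof (rule g_nondeg[OF vf_T[OF X]])
  fix w assume "w \<in> T p"
  then obtain W where "W \<in> vfields A" "W p = w" by (rule tangent_extend)
  then show "g p (X p) w = 0" using z[of W] by (simp add: ip_def)
qed

lemma vf_eqI:
  assumes "X \<in> vfields A" "Y \<in> vfields A" "\<And>p Z. Z \<in> vfields A \<Longrightarrow> ip p X Z = ip p Y Z"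
  shows "X = Y"
proof
  fix p
  have "(X - Y) p = 0" by (rule ip_nondeg[of "X - Y"]) (use assms in simp_all)
  then show "X p = Y p" by (simp add: minus_apply)
qed

abbreviation "R \<equiv> curvature nabla"

lemma R_vf [simp]: "X \<in> vfields A \<Longrightarrow> Y \<in> vfields A \<Longrightarrow> Z \<in> vfields A \<Longrightarrow> R X Y Z \<in> vfields A"
  by (simp add: curvature_def)

lemma nabla_uminus: "X \<in> vfields A \<Longrightarrow> Z \<in> vfields A \<Longrightarrow> nabla Z (- X) = - nabla Z X"
  using nabla_scaleR(1)[of Z X "-1"] by simp

lemma R_swap:
  assumes "X \<in> vfields A" "Y \<in> vfields A" "Z \<in> vfields A" "W \<in> vfields A"
  shows "ip p (R X Y Z) W = - ip p (R Y X Z) W"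
  using assms by (simp add: curvature_def torsion_free nabla_diff)

text \<open>Both sides come from applying a bracket to the function g(Z, W): once by metric
  compatibility directly, once through second derivatives, whose mixed terms cancel.\<close>

lemma R_skew:
  assumes [simp]: "X \<in> vfields A" "Y \<in> vfields A" "Z \<in> vfields A" "W \<in> vfields A"
  shows "ip p (R X Y Z) W = - ip p (R X Y W) Z"
proof -
  have second: "P p (\<lambda>q. Q q (\<lambda>r. ip r Z W)) =
      ip p (nabla P (nabla Q Z)) W + ip p (nabla Q Z) (nabla P W) +
      (ip p (nabla P Z) (nabla Q W) + ip p Z (nabla P (nabla Q W)))"
    if P[simp]: "P \<in> vfields A" and [simp]: "Q \<in> vfields A" for P Q
    by (simp add: ip_deriv tv_add[OF vf_T[OF P] ip_smooth ip_smooth])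
  have "bracket X Y p (\<lambda>q. ip q Z W) = X p (\<lambda>q. Y q (\<lambda>r. ip r Z W)) - Y p (\<lambda>q. X q (\<lambda>r. ip r Z W))"
    by (simp add: bracket_def)
  moreover have "bracket X Y p (\<lambda>q. ip q Z W) =
      ip p (nabla (bracket X Y) Z) W + ip p Z (nabla (bracket X Y) W)"
    by (rule ip_deriv) simp_all
  ultimately have "ip p (nabla (bracket X Y) Z) W + ip p Z (nabla (bracket X Y) W) =
      ip p (nabla X (nabla Y Z)) W + ip p Z (nabla X (nabla Y W)) -
      (ip p (nabla Y (nabla X Z)) W + ip p Z (nabla Y (nabla X W)))"
    using second[of X Y] second[of Y X] by simp
  then show ?thesis
    by (simp add: curvature_def ip_sym[of Z])
qed

lemma jacobi:
  assumes X: "X \<in> vfields A" and Y: "Y \<in> vfields A" and Z: "Z \<in> vfields A"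
  shows "bracket X (bracket Y Z) p f + bracket Y (bracket Z X) p f + bracket Z (bracket X Y) p f = 0"
proof (cases "smooth_fun A f")
  case True
  note s = vfieldsD(2)[OF X] vfieldsD(2)[OF Y] vfieldsD(2)[OF Z]
  show ?thesis
    by (simp add: bracket_def tv_diff[OF vf_T[OF X]] tv_diff[OF vf_T[OF Y]] tv_diff[OF vf_T[OF Z]] s True)
next
  case False
  have "bracket P (bracket Q V) p f = 0" if "P \<in> vfields A" "Q \<in> vfields A" "V \<in> vfields A" for P Q V
    by (rule tv_nonsmooth[OF vf_T False]) (use that in simp)
  then show ?thesis using assms by simp
qed

text \<open>After torsion-freeness is used, the cyclic sum collapses to the Jacobi identity.\<close>

lemma bianchi:
  assumes [simp]: "X \<in> vfields A" "Y \<in> vfields A" "Z \<in> vfields A" "W \<in> vfields A"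
  shows "ip p (R X Y Z) W + ip p (R Y Z X) W + ip p (R Z X Y) W = 0"
proof -
  have "bracket X (bracket Y Z) + bracket Y (bracket Z X) + bracket Z (bracket X Y) = 0"
    by (intro ext) (simp add: fun_plus_app fun_zero_app jacobi)
  then have "ip p (bracket X (bracket Y Z) + bracket Y (bracket Z X) + bracket Z (bracket X Y)) W = 0"
    by simp
  then show ?thesis
    by (simp add: curvature_def torsion_free nabla_diff)
qed

text \<open>Four cyclic identities are combined with the two skew symmetries. Every instance that
  occurs is supplied, and what remains is linear algebra over the values.\<close>

lemma R_pair:
  assumes "X \<in> vfields A" "Y \<in> vfields A" "Z \<in> vfields A" "W \<in> vfields A"
  shows "ip p (R X Y Z) W = ip p (R Z W X) Y"
  using bianchi[OF assms(1,2,3,4), of p] bianchi[OF assms(2,3,4,1), of p]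
    bianchi[OF assms(3,4,1,2), of p] bianchi[OF assms(4,1,2,3), of p]
    R_skew[OF assms(1,2,3,4), of p] R_skew[OF assms(2,3,1,4), of p] R_skew[OF assms(3,1,2,4), of p]
    R_skew[OF assms(3,4,1,2), of p] R_skew[OF assms(4,2,3,1), of p] R_skew[OF assms(4,1,3,2), of p]
    R_swap[OF assms(2,4,3,1), of p] R_swap[OF assms(1,3,4,2), of p] R_swap[OF assms(1,3,2,4), of p]
    R_swap[OF assms(1,4,2,3), of p] R_swap[OF assms(4,2,1,3), of p] R_swap[OF assms(1,4,3,2), of p]
    R_skew[OF assms(1,3,4,2), of p] R_skew[OF assms(2,4,1,3), of p] R_skew[OF assms(2,3,4,1), of p]
    R_skew[OF assms(4,2,1,3), of p] R_skew[OF assms(1,3,2,4), of p] R_skew[OF assms(4,1,2,3), of p]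
    R_swap[OF assms(2,4,1,3), of p]
  by linarith

subsection \<open>Traces of tensor fields\<close>

text \<open>(1,1)-tensor fields as operators on fields. In this form \<phi>, \<nabla>\<xi> and their
  covariant derivatives are treated alike.\<close>

definition endo :: "('a vfield \<Rightarrow> 'a vfield) \<Rightarrow> bool"
  where "endo L \<longleftrightarrow> (\<forall>X\<in>vfields A. L X \<in> vfields A) \<and>
    (\<forall>X\<in>vfields A. \<forall>Y\<in>vfields A. L (X + Y) = L X + L Y) \<and>
    (\<forall>f. smooth_fun A f \<longrightarrow> (\<forall>X\<in>vfields A. L (smul f X) = smul f (L X)))"

lemma endoI:
  assumes "\<And>X. X \<in> vfields A \<Longrightarrow> L X \<in> vfields A"
    and "\<And>X Y. X \<in> vfields A \<Longrightarrow> Y \<in> vfields A \<Longrightarrow> L (X + Y) = L X + L Y"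
    and "\<And>f X. smooth_fun A f \<Longrightarrow> X \<in> vfields A \<Longrightarrow> L (smul f X) = smul f (L X)"
  shows "endo L"
  using assms unfolding endo_def by simp

lemma endoD:
  assumes "endo L" "X \<in> vfields A"
  shows "L X \<in> vfields A" "Y \<in> vfields A \<Longrightarrow> L (X + Y) = L X + L Y"
    "smooth_fun A f \<Longrightarrow> L (smul f X) = smul f (L X)"
  using assms unfolding endo_def by simp_all

lemma endo_tensorial:
  assumes L: "endo L" and "W \<in> vfields A"
  shows "tensorial p (\<lambda>X. ip p W (L X))"
  by (rule tensorialI) (simp_all add: endoD[OF L] assms(2))

lemma endo_tensorial':
  assumes L: "endo L" and "W \<in> vfields A"
  shows "tensorial p (\<lambda>X. ip p (L X) W)"
  by (rule tensorialI) (simp_all add: endoD[OF L] assms(2))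

lemma endo_bitensorial:
  assumes L: "endo L" and M: "endo M"
  shows "bitensorial p (\<lambda>X Y. ip p (L X) (M Y))"
proof (rule bitensorialI)
  fix X assume X: "X \<in> vfields A"
  show "tensorial p (\<lambda>Y. ip p (L X) (M Y))" by (rule endo_tensorial[OF M endoD(1)[OF L X]])
  show "tensorial p (\<lambda>Y. ip p (L Y) (M X))" by (rule endo_tensorial'[OF L endoD(1)[OF M X]])
qed

lemma endo_id: "endo (\<lambda>X. X)"
  by (rule endoI) simp_all

lemma smul_add: "smul f (X + Y) = smul f X + smul f Y"
  by (rule ext) (simp add: smul_app fun_plus_app scaleR_add_right)

lemma smul_diff: "smul f (X - Y) = smul f X - smul f Y"
  by (rule ext) (simp add: smul_app minus_apply scaleR_diff_right)

lemma
  assumes L: "endo L" and M: "endo M"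
  shows endo_add: "endo (\<lambda>X. L X + M X)"
    and endo_compose: "endo (\<lambda>X. L (M X))"
  by (rule endoI; simp add: endoD[OF L] endoD[OF M] smul_add algebra_simps)+

text \<open>\<open>B\<close> is the diagonal E \<mapsto> b(E, E) of a bilinear form b, so integrands
  can be rewritten one E at a time by \<open>Tr_cong\<close>.\<close>

definition "Tr p B = (\<Sum>i\<in>UNIV. \<epsilon> p i * B (fr p i))"

lemma Tr_cong: "(\<And>X. X \<in> vfields A \<Longrightarrow> B X = B' X) \<Longrightarrow> Tr p B = Tr p B'"
  by (simp add: Tr_def)

lemma Tr_simps:
  "Tr p (\<lambda>X. B X + B' X) = Tr p B + Tr p B'"
  "Tr p (\<lambda>X. B X - B' X) = Tr p B - Tr p B'"
  "Tr p (\<lambda>X. c * B X) = c * Tr p B"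
  "Tr p (\<lambda>X. - B X) = - Tr p B"
  "Tr p (\<lambda>X. 0) = 0"
  by (simp_all add: Tr_def sum.distrib sum_subtractf sum_distrib_left distrib_left right_diff_distrib
      sum_negf mult_ac)

lemma metric_trace_Tr: "metric_trace A g B p = Tr p (\<lambda>X. B X X p)"
  by (simp add: metric_trace_fr Tr_def)

lemma Tr_contract:
  assumes B: "tensorial p B" and V: "V \<in> vfields A"
  shows "Tr p (\<lambda>E. ip p V E * B E) = B V"
  using tensorial_fr[OF B V] by (simp add: Tr_def ip_def mult.assoc)

text \<open>With \<open>c = -1\<close> this moves a skew operator from one slot of a trace to the
  other. The proof expands \<open>L E\<close> in the frame on both sides and exchanges the
  sums.\<close>

lemma Tr_adjoint:
  fixes B :: "'a vfield \<Rightarrow> 'a vfield \<Rightarrow> real"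
  assumes B: "bitensorial p B" and L: "\<And>X. X \<in> vfields A \<Longrightarrow> L X \<in> vfields A"
    and adj: "\<And>X Y. X \<in> vfields A \<Longrightarrow> Y \<in> vfields A \<Longrightarrow> ip p (L X) Y = c * ip p (L Y) X"
  shows "Tr p (\<lambda>E. B (L E) E) = c * Tr p (\<lambda>E. B E (L E))"
proof -
  have "Tr p (\<lambda>E. B (L E) E) = (\<Sum>i\<in>UNIV. \<Sum>j\<in>UNIV. \<epsilon> p i * \<epsilon> p j *
      (c * ip p (L (fr p j)) (fr p i)) * B (fr p j) (fr p i))"
    unfolding Tr_def
  proof (rule sum.cong[OF refl])
    fix i
    show "\<epsilon> p i * B (L (fr p i)) (fr p i) = (\<Sum>j\<in>UNIV. \<epsilon> p i * \<epsilon> p j *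
      (c * ip p (L (fr p j)) (fr p i)) * B (fr p j) (fr p i))"
      by (subst tensorial_fr[OF bitensorialD(2)[OF B fr_vf] L[OF fr_vf]])
        (simp add: sum_distrib_left mult.assoc adj[OF fr_vf fr_vf, symmetric] flip: ip_def)
  qed
  also have "\<dots> = c * (\<Sum>j\<in>UNIV. \<Sum>i\<in>UNIV. \<epsilon> p i * \<epsilon> p j *
      ip p (L (fr p j)) (fr p i) * B (fr p j) (fr p i))"
    by (subst sum.swap) (simp add: sum_distrib_left mult_ac)
  also have "\<dots> = c * Tr p (\<lambda>E. B E (L E))"
    unfolding Tr_def
  proof (intro arg_cong[where f = "\<lambda>t. c * t"] sum.cong[OF refl])
    fix j
    show "(\<Sum>i\<in>UNIV. \<epsilon> p i * \<epsilon> p j * ip p (L (fr p j)) (fr p i) * B (fr p j) (fr p i)) =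
        \<epsilon> p j * B (fr p j) (L (fr p j))"
      by (subst tensorial_fr[OF bitensorialD(1)[OF B fr_vf] L[OF fr_vf]])
        (simp add: sum_distrib_left mult_ac flip: ip_def)
  qed
  finally show ?thesis .
qed

lemma Tr_skew:
  assumes "\<And>X. X \<in> vfields A \<Longrightarrow> B X = 0"
  shows "Tr p B = 0"
  by (simp add: Tr_def assms)

end

section \<open>Paracontact metric \<open>(\<kappa>, \<mu>)\<close>-spaces\<close>

locale kappa_mu_manifold = levi_civita_manifold A g nabla
  for A :: "('a::{t2_space,second_countable_topology}, 'n::finite) chart set" and g nabla +
  fixes n :: nat and \<phi> :: "'a \<Rightarrow> 'a tvec \<Rightarrow> 'a tvec" and \<xi> :: "'a vfield"
    and \<eta> :: "'a \<Rightarrow> 'a tvec \<Rightarrow> real" and \<kappa> \<mu> :: "'a \<Rightarrow> real"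
  assumes kms: "kappa_mu_space A n \<phi> \<xi> \<eta> g nabla \<kappa> \<mu>"
begin

lemma pmm: "paracontact_metric_manifold A n \<phi> \<xi> \<eta> g"
  using kms by (simp add: kappa_mu_space_def)

lemma pmm_facts: "reeb_field A \<eta> \<xi>" "endo_field A \<phi>"
  "\<And>p v. v \<in> T p \<Longrightarrow> \<eta> p v = g p (\<xi> p) v"
  "\<And>X Y p. X \<in> vfields A \<Longrightarrow> Y \<in> vfields A \<Longrightarrow> ext_deriv \<eta> X Y p = g p (X p) (\<phi> p (Y p))"
  "\<And>p v. v \<in> T p \<Longrightarrow> \<phi> p (\<phi> p v) = v - \<eta> p v *\<^sub>R \<xi> p"
  using pmm unfolding paracontact_metric_manifold_def by simp_all

lemma \<xi>_vf [simp]: "\<xi> \<in> vfields A"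
  using pmm_facts(1) by (simp add: reeb_field_def)

definition "Phi X = (\<lambda>p. \<phi> p (X p))"

text \<open>\<open>sig\<close> is the symmetric part \<open>S\<close> of \<open>\<nabla>\<xi>\<close>; \<open>nphi X\<close>, \<open>hess X\<close> and \<open>nsig X\<close> are the tensors \<open>\<nabla>\<^sub>X \<phi>\<close>,
  \<open>\<nabla>\<^sub>X \<nabla>\<xi>\<close> and \<open>\<nabla>\<^sub>X S\<close>.\<close>

definition "tau X = nabla X \<xi>"

definition "sig X = tau X + Phi X"

definition "nphi X Y = nabla X (Phi Y) - Phi (nabla X Y)"

definition "hess X Y = nabla X (tau Y) - tau (nabla X Y)"

definition "nsig X Y = nabla X (sig Y) - sig (nabla X Y)"

lemma \<phi>_lin: "v \<in> T p \<Longrightarrow> w \<in> T p \<Longrightarrow> \<phi> p (a *\<^sub>R v + b *\<^sub>R w) = a *\<^sub>R \<phi> p v + b *\<^sub>R \<phi> p w"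
  using conjunct1[OF conjunct2[OF pmm_facts(2)[unfolded endo_field_def]]] by simp

lemma Phi_vf [simp]: "X \<in> vfields A \<Longrightarrow> Phi X \<in> vfields A"
  using conjunct2[OF conjunct2[OF pmm_facts(2)[unfolded endo_field_def]]] by (simp add: Phi_def)

lemma endo_Phi: "endo Phi"
proof (rule endoI)
  fix X Y assume X: "X \<in> vfields A" and Y: "Y \<in> vfields A"
  show "Phi (X + Y) = Phi X + Phi Y"
  proof
    fix p show "Phi (X + Y) p = (Phi X + Phi Y) p"
      using \<phi>_lin[OF vf_T[OF X] vf_T[OF Y], of p 1 1] by (simp add: Phi_def fun_plus_app)
  qed
next
  fix f X assume X: "X \<in> vfields A"
  show "Phi (smul f X) = smul f (Phi X)"
  proof
    fix p show "Phi (smul f X) p = smul f (Phi X) p"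
      using \<phi>_lin[OF vf_T[OF X] vf_T[OF X], of p "f p" 0] by (simp add: Phi_def smul_app)
  qed
qed simp

lemma tau_vf [simp]: "X \<in> vfields A \<Longrightarrow> tau X \<in> vfields A"
  by (simp add: tau_def)

lemma endo_tau: "endo tau"
  unfolding tau_def by (rule endoI) (simp_all add: nabla_add nabla_smul)

lemma endo_sig: "endo sig"
  unfolding sig_def by (intro endo_add endo_tau endo_Phi)

lemma sig_vf [simp]: "X \<in> vfields A \<Longrightarrow> sig X \<in> vfields A"
  by (simp add: sig_def)

lemma endo_derivative:
  assumes L: "endo L"
  shows "X \<in> vfields A \<Longrightarrow> endo (\<lambda>Y. nabla X (L Y) - L (nabla X Y))"
    and "Y \<in> vfields A \<Longrightarrow> endo (\<lambda>X. nabla X (L Y) - L (nabla X Y))"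
proof -
  show "X \<in> vfields A \<Longrightarrow> endo (\<lambda>Y. nabla X (L Y) - L (nabla X Y))"
    by (rule endoI) (simp_all add: endoD[OF L] nabla_add nabla_smul vf_smul vfieldsD smul_diff)
  show "Y \<in> vfields A \<Longrightarrow> endo (\<lambda>X. nabla X (L Y) - L (nabla X Y))"
    by (rule endoI) (simp_all add: endoD[OF L] nabla_add nabla_smul smul_diff)
qed

lemmas endo_nphi = endo_derivative[OF endo_Phi, folded nphi_def]
  and endo_hess = endo_derivative[OF endo_tau, folded hess_def]
  and endo_nsig = endo_derivative[OF endo_sig, folded nsig_def]

lemma derivative_vf [simp]:
  "X \<in> vfields A \<Longrightarrow> Y \<in> vfields A \<Longrightarrow> nphi X Y \<in> vfields A"
  "X \<in> vfields A \<Longrightarrow> Y \<in> vfields A \<Longrightarrow> hess X Y \<in> vfields A"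
  "X \<in> vfields A \<Longrightarrow> Y \<in> vfields A \<Longrightarrow> nsig X Y \<in> vfields A"
  by (simp_all add: nphi_def hess_def nsig_def)

lemma endo_diff_app: "endo L \<Longrightarrow> X \<in> vfields A \<Longrightarrow> Y \<in> vfields A \<Longrightarrow> L (X - Y) = L X - L Y"
proof -
  assume L: "endo L" and X: "X \<in> vfields A" "Y \<in> vfields A"
  have "L (X - Y) + L Y = L X" using endoD(2)[OF L, of "X - Y" Y] X by simp
  then show ?thesis by (simp add: eq_diff_eq)
qed

lemma endo_uminus_app: "endo L \<Longrightarrow> X \<in> vfields A \<Longrightarrow> L (- X) = - L X"
  using endo_diff_app[of L X X] endo_diff_app[of L "X - X" X] by simp

section \<open>Algebra of \<phi> and of the symmetric part of \<nabla>\<xi>\<close>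

lemma \<eta>_ip: "X \<in> vfields A \<Longrightarrow> \<eta> p (X p) = ip p \<xi> X"
  by (simp add: pmm_facts(3) vf_T ip_def)

lemma ip_\<xi>_\<xi>: "ip p \<xi> \<xi> = 1"
  using pmm_facts(1) \<eta>_ip[OF \<xi>_vf, of p] by (simp add: reeb_field_def)

text \<open>For a metric torsion-free connection the exterior derivative of g(\<xi>, .) is the skew
  part of \<nabla>\<xi>. This identifies that skew part as -\<phi> and gives the skewness of \<phi>
  itself.\<close>

lemma deta: 
  assumes [simp]: "X \<in> vfields A" "Y \<in> vfields A"
  shows "ip p (tau X) Y - ip p (tau Y) X = 2 * ip p X (Phi Y)"
proof -
  have "2 * ext_deriv \<eta> X Y p = X p (\<lambda>q. ip q \<xi> Y) - Y p (\<lambda>q. ip q \<xi> X) - ip p \<xi> (bracket X Y)"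
    by (simp add: ext_deriv_def \<eta>_ip)
  also have "\<dots> = ip p (tau X) Y - ip p (tau Y) X"
    by (simp add: ip_deriv torsion_free tau_def)
  finally show ?thesis by (simp add: pmm_facts(4) ip_def Phi_def)
qed

lemma Phi_skew:
  assumes "X \<in> vfields A" "Y \<in> vfields A"
  shows "ip p (Phi X) Y = - ip p X (Phi Y)" "ip p (Phi X) Y = - ip p (Phi Y) X"
  using deta[OF assms, of p] deta[OF assms(2,1), of p] ip_sym[of "Phi X" Y p] ip_sym[of "Phi Y" X p] assms
  by simp_all

lemma Phi_adj: "X \<in> vfields A \<Longrightarrow> Y \<in> vfields A \<Longrightarrow> ip p (Phi X) Y = (-1) * ip p (Phi Y) X"
  using Phi_skew(2)[of X Y p] by simp

lemma ip_tau_\<xi>: "X \<in> vfields A \<Longrightarrow> ip p (tau X) \<xi> = 0"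
proof -
  assume [simp]: "X \<in> vfields A"
  have "X p (\<lambda>q. ip q \<xi> \<xi>) = 0" by (simp add: ip_\<xi>_\<xi> tv_const[OF vf_T])
  then show ?thesis by (simp add: ip_deriv tau_def ip_sym[of \<xi> "nabla X \<xi>"])
qed

lemma ip_\<xi>_Phi: "X \<in> vfields A \<Longrightarrow> ip p \<xi> (Phi X) = 0"
  using pmm_facts(1) pmm_facts(4)[of \<xi> X p] by (simp add: reeb_field_def ip_def Phi_def)

lemma Phi_\<xi>: "Phi \<xi> = 0"
  by (rule vf_eqI) (simp_all add: Phi_skew(1) ip_\<xi>_Phi)

text \<open>\<xi> is geodesic: since d\<eta>(\<xi>, .) = 0, the pairing of \<open>tau \<xi>\<close>
  with Z equals that of \<open>tau Z\<close> with \<xi>, which the unit length of \<xi> makes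
  zero.\<close>

lemma tau_\<xi>: "tau \<xi> = 0"
proof (rule vf_eqI)
  fix p Z assume "Z \<in> vfields A"
  then show "ip p (tau \<xi>) Z = ip p 0 Z"
    using deta[of \<xi> Z p] by (simp add: ip_\<xi>_Phi ip_tau_\<xi>)
qed simp_all

lemma sig_\<xi>: "sig \<xi> = 0"
  by (simp add: sig_def Phi_\<xi> tau_\<xi>)

lemma ip_\<xi>_tau: "X \<in> vfields A \<Longrightarrow> ip p \<xi> (tau X) = 0"
  using ip_tau_\<xi>[of X p] by (simp add: ip_sym[of \<xi>])

lemma ip_\<xi>_sig: "X \<in> vfields A \<Longrightarrow> ip p \<xi> (sig X) = 0"
  by (simp add: sig_def ip_\<xi>_tau ip_\<xi>_Phi)

lemma Phi_Phi: "X \<in> vfields A \<Longrightarrow> Phi (Phi X) = X - smul (\<lambda>p. ip p \<xi> X) \<xi>"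
proof
  fix p assume "X \<in> vfields A"
  then show "Phi (Phi X) p = (X - smul (\<lambda>p. ip p \<xi> X) \<xi>) p"
    by (simp add: Phi_def minus_apply smul_app pmm_facts(5) vf_T \<eta>_ip)
qed

lemma sig_sym:
  assumes "X \<in> vfields A" "Y \<in> vfields A"
  shows "ip p (sig X) Y = ip p (sig Y) X" "ip p (sig X) Y = ip p X (sig Y)"
proof -
  show "ip p (sig X) Y = ip p (sig Y) X"
    using deta[OF assms, of p] Phi_skew[OF assms, of p] assms by (simp add: sig_def)
  then show "ip p (sig X) Y = ip p X (sig Y)" using assms by (simp add: ip_sym[of X])
qed

lemma nphi_skew:
  assumes [simp]: "X \<in> vfields A" "Y \<in> vfields A" "Z \<in> vfields A"
  shows "ip p (nphi X Y) Z = - ip p Y (nphi X Z)"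
proof -
  have "(\<lambda>q. ip q (Phi Y) Z) = (\<lambda>q. (-1) * ip q Y (Phi Z))"
    by (simp add: Phi_skew(1))
  then have "X p (\<lambda>q. ip q (Phi Y) Z) = - X p (\<lambda>q. ip q Y (Phi Z))"
    using tv_cmult[OF vf_T ip_smooth, of X Y "Phi Z" p "-1"] by simp
  then have "ip p (nabla X (Phi Y)) Z + ip p (Phi Y) (nabla X Z) =
      - (ip p (nabla X Y) (Phi Z) + ip p Y (nabla X (Phi Z)))"
    by (simp add: ip_deriv)
  then show ?thesis by (simp add: nphi_def Phi_skew(1))
qed

lemma nphi_adj:
  assumes "X \<in> vfields A" "Y \<in> vfields A" "Z \<in> vfields A"
  shows "ip p (nphi X Y) Z = (-1) * ip p (nphi X Z) Y"
  using nphi_skew[OF assms, of p] ip_sym[of "nphi X Z" Y p] assms by simp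

text \<open>The covariant derivative of \<phi>\<phi> = I - \<eta> \<otimes> \<xi>, paired with
  Z.\<close>

lemma nphi_Phi:
  assumes [simp]: "X \<in> vfields A" "Y \<in> vfields A" "Z \<in> vfields A"
  shows "ip p (nphi X (Phi Y)) Z + ip p (Phi (nphi X Y)) Z =
    - ip p (tau X) Y * ip p \<xi> Z - ip p \<xi> Y * ip p (tau X) Z"
proof -
  have s: "smooth_fun A (\<lambda>p. ip p \<xi> V)" if "V \<in> vfields A" for V using that by (simp add: ip_smooth)
  have [simp]: "smul (\<lambda>p. ip p \<xi> V) \<xi> \<in> vfields A" if "V \<in> vfields A" for V
    using that by (simp add: vf_smul s)
  have s2: "smooth_fun A (\<lambda>p. X p (\<lambda>q. ip q \<xi> Y))" by (simp add: vfieldsD(2)[OF _ s])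
  have [simp]: "smul (\<lambda>p. ip p (tau X) Y + ip p \<xi> (nabla X Y)) \<xi> \<in> vfields A"
    by (intro vf_smul smooth_fun_add ip_smooth) simp_all
  have [simp]: "smul (\<lambda>p. ip p \<xi> Y) (tau X) \<in> vfields A" by (simp add: vf_smul s)
  have "nabla X (Phi (Phi Y)) = nabla X Y -
      (smul (\<lambda>p. ip p (tau X) Y + ip p \<xi> (nabla X Y)) \<xi> + smul (\<lambda>p. ip p \<xi> Y) (tau X))"
    by (simp add: Phi_Phi nabla_diff nabla_smul(2)[OF s] ip_deriv tau_def)
  then show ?thesis
    by (simp add: nphi_def endo_diff_app[OF endo_Phi] Phi_Phi[of "nabla X Y"] distrib_right)
qed

lemma hess_swap:
  assumes [simp]: "X \<in> vfields A" "Y \<in> vfields A" "Z \<in> vfields A"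
  shows "ip p (hess X Y) Z - ip p (hess Y X) Z = - ip p (R X Y \<xi>) Z"
  by (simp add: hess_def curvature_def tau_def torsion_free nabla_diff)

lemma nphi_hess:
  assumes [simp]: "X \<in> vfields A" "Y \<in> vfields A" "Z \<in> vfields A"
  shows "2 * ip p Y (nphi X Z) = ip p (hess X Y) Z - ip p (hess X Z) Y"
proof -
  have "(\<lambda>q. ip q (tau Y) Z - ip q (tau Z) Y) = (\<lambda>q. 2 * ip q Y (Phi Z))"
    by (simp add: deta)
  then have "X p (\<lambda>q. ip q (tau Y) Z) - X p (\<lambda>q. ip q (tau Z) Y) = 2 * X p (\<lambda>q. ip q Y (Phi Z))"
    using tv_cmult[OF vf_T ip_smooth, of X Y "Phi Z" p 2]
      tv_diff[OF vf_T ip_smooth ip_smooth, of X "tau Y" Z "tau Z" Y p] by simp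
  then have "ip p (nabla X (tau Y)) Z + ip p (tau Y) (nabla X Z) -
      (ip p (nabla X (tau Z)) Y + ip p (tau Z) (nabla X Y)) =
      2 * (ip p (nabla X Y) (Phi Z) + ip p Y (nabla X (Phi Z)))"
    by (simp add: ip_deriv)
  then show ?thesis
    using deta[of "nabla X Y" Z p] deta[of Y "nabla X Z" p] by (simp add: nphi_def hess_def)
qed

text \<open>This is d(d\<eta>) = 0. The sum equals half the cyclic sum of the skew parts of
  \<open>hess\<close>; these are curvatures R X Y \<xi>, and the first Bianchi identity removes
  them.\<close>

lemma nphi_cyclic:
  assumes [simp]: "X \<in> vfields A" "Y \<in> vfields A" "Z \<in> vfields A"
  shows "ip p Y (nphi X Z) + ip p Z (nphi Y X) + ip p X (nphi Z Y) = 0"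
proof -
  have "ip p (R X Y \<xi>) Z + ip p (R Y Z \<xi>) X + ip p (R Z X \<xi>) Y = 0"
    using bianchi[of X Y Z \<xi> p] by (simp add: R_skew[of _ _ \<xi>])
  then show ?thesis
    using nphi_hess[of X Y Z p] nphi_hess[of Y Z X p] nphi_hess[of Z X Y p]
      hess_swap[of X Y Z p] hess_swap[of Y Z X p] hess_swap[of Z X Y p] by simp
qed

lemma nphi_\<xi>_right: "X \<in> vfields A \<Longrightarrow> nphi X \<xi> = - Phi (tau X)"
  by (simp add: nphi_def Phi_\<xi> nabla_zero tau_def)

text \<open>Taking one argument of \<open>nphi_cyclic\<close> to be \<xi> yields minus the
  anticommutator of S and \<phi>. That it vanishes is only known after \<open>sig_Phi\<close>, whose
  proof starts from this formula.\<close>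

lemma nphi_\<xi>:
  assumes [simp]: "Y \<in> vfields A" "Z \<in> vfields A"
  shows "ip p (nphi \<xi> Z) Y = - ip p (sig (Phi Z) + Phi (sig Z)) Y"
proof -
  have t: "tau V = sig V - Phi V" for V by (simp add: sig_def)
  have "ip p Y (nphi \<xi> Z) + ip p Z (nphi Y \<xi>) + ip p \<xi> (nphi Z Y) = 0"
    by (rule nphi_cyclic) simp_all
  moreover have "ip p \<xi> (nphi Z Y) = - ip p (nphi Z \<xi>) Y"
    using nphi_skew[of Z \<xi> Y p] by simp
  ultimately have "ip p (nphi \<xi> Z) Y - ip p Z (Phi (tau Y)) + ip p (Phi (tau Z)) Y = 0"
    by (simp add: nphi_\<xi>_right ip_sym[of Y "nphi \<xi> Z"])
  moreover have "ip p Z (Phi (tau Y)) = - ip p (Phi Z) (tau Y)" by (simp add: Phi_skew)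
  moreover have "ip p (Phi Z) (sig Y) = ip p (sig (Phi Z)) Y" by (simp add: sig_sym(2))
  moreover have "ip p (Phi Z) (Phi Y) = - ip p (Phi (Phi Z)) Y"
    using Phi_skew(1)[of "Phi Z" Y p] by simp
  ultimately show ?thesis
    by (simp add: t endo_diff_app[OF endo_Phi])
qed

lemma Phi_Phi_sig: "Y \<in> vfields A \<Longrightarrow> Phi (Phi (sig Y)) = sig Y"
  by (rule vf_eqI) (simp_all add: Phi_Phi ip_\<xi>_sig vf_smul smooth_fun_const)

lemma sig_Phi_Phi: "Y \<in> vfields A \<Longrightarrow> sig (Phi (Phi Y)) = sig Y"
proof -
  assume [simp]: "Y \<in> vfields A"
  have s: "smooth_fun A (\<lambda>p. ip p \<xi> Y)" by (simp add: ip_smooth)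
  have "sig (smul (\<lambda>p. ip p \<xi> Y) \<xi>) = smul (\<lambda>p. ip p \<xi> Y) 0"
    by (simp add: endoD(3)[OF endo_sig _ s] sig_\<xi>)
  also have "\<dots> = 0" by (rule ext) (simp add: smul_app fun_zero_app)
  finally show ?thesis
    by (simp add: Phi_Phi endo_diff_app[OF endo_sig] vf_smul s)
qed

text \<open>Let D be the anticommutator S\<phi> + \<phi>S, so that the derivative of \<phi> along
  \<xi> is -D. As \<xi> is geodesic, differentiating \<phi>\<phi> along \<xi> gives D\<phi> +
  \<phi>D = 0. Since \<phi>\<phi> acts as the identity on either side of S, this reads 2S +
  2\<phi>S\<phi> = 0.\<close>

lemma sig_eq: "Y \<in> vfields A \<Longrightarrow> sig Y = - Phi (sig (Phi Y))"
proof (rule vf_eqI)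
  fix p Z assume [simp]: "Y \<in> vfields A" "Z \<in> vfields A"
  have "ip p (nphi \<xi> (Phi Y)) Z + ip p (Phi (nphi \<xi> Y)) Z = 0"
    using nphi_Phi[of \<xi> Y Z p] by (simp add: tau_\<xi>)
  moreover have "ip p (Phi (nphi \<xi> Y)) Z = - ip p (nphi \<xi> Y) (Phi Z)" by (simp add: Phi_skew(1))
  ultimately have "ip p (sig Y) Z + ip p (Phi (sig (Phi Y))) Z -
      (ip p (sig (Phi Y)) (Phi Z) + ip p (Phi (sig Y)) (Phi Z)) = 0"
    by (simp add: nphi_\<xi> sig_Phi_Phi)
  moreover have "ip p (sig (Phi Y)) (Phi Z) = - ip p (Phi (sig (Phi Y))) Z"
    using Phi_skew(1)[of "sig (Phi Y)" Z p] by simp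
  moreover have "ip p (Phi (sig Y)) (Phi Z) = - ip p (sig Y) Z"
    using Phi_skew(1)[of "Phi (sig Y)" Z p] by (simp add: Phi_Phi_sig)
  ultimately show "ip p (sig Y) Z = ip p (- Phi (sig (Phi Y))) Z" by simp
qed simp_all

lemma sig_Phi: "Y \<in> vfields A \<Longrightarrow> sig (Phi Y) = - Phi (sig Y)"
  using sig_eq[of Y] by (simp add: endo_uminus_app[OF endo_Phi] Phi_Phi_sig)

text \<open>Expanded by torsion-freeness, the Lie derivative is \<nabla>\<phi> along \<xi> plus the
  commutator of \<phi> with \<nabla>\<xi>. The \<phi>\<phi> terms cancel, the first term vanishes by
  anticommutation, and the commutator of \<phi> with S is 2\<phi>S.\<close>

lemma h_eq: "X \<in> vfields A \<Longrightarrow> h_tensor \<phi> \<xi> X = Phi (sig X)"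
proof (rule vf_eqI)
  assume [simp]: "X \<in> vfields A"
  have h: "h_tensor \<phi> \<xi> X = (1/2) *\<^sub>R (bracket \<xi> (Phi X) - Phi (bracket \<xi> X))"
    by (simp add: h_tensor_def Phi_def)
  then show "h_tensor \<phi> \<xi> X \<in> vfields A" by simp
  fix p Z assume [simp]: "Z \<in> vfields A"
  have t: "nabla V \<xi> = sig V - Phi V" for V by (simp add: sig_def tau_def)
  have "bracket \<xi> (Phi X) - Phi (bracket \<xi> X) = nphi \<xi> X - (sig (Phi X) - Phi (Phi X)) + (Phi (sig X) - Phi (Phi X))"
    by (simp add: torsion_free t endo_diff_app[OF endo_Phi] nphi_def)
  then have "ip p (h_tensor \<phi> \<xi> X) Z = 1/2 * (ip p (nphi \<xi> X) Z - ip p (sig (Phi X)) Z + ip p (Phi (sig X)) Z)"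
    unfolding h by simp
  then show "ip p (h_tensor \<phi> \<xi> X) Z = ip p (Phi (sig X)) Z"
    by (simp add: nphi_\<xi> sig_Phi)
qed simp

section \<open>Curvature in the direction \<xi> and vanishing traces\<close>

lemma R_\<xi>:
  assumes [simp]: "X \<in> vfields A" "Y \<in> vfields A" "Z \<in> vfields A"
  shows "ip p (R X Y \<xi>) Z = \<kappa> p * (ip p \<xi> X * ip p Y Z - ip p \<xi> Y * ip p X Z) +
    \<mu> p * (ip p \<xi> X * ip p (Phi (sig Y)) Z - ip p \<xi> Y * ip p (Phi (sig X)) Z)"
proof -
  have "R X Y \<xi> p =
         \<kappa> p *\<^sub>R (\<eta> p (X p) *\<^sub>R Y p - \<eta> p (Y p) *\<^sub>R X p) +
         \<mu> p *\<^sub>R (\<eta> p (X p) *\<^sub>R h_tensor \<phi> \<xi> Y p - \<eta> p (Y p) *\<^sub>R h_tensor \<phi> \<xi> X p)"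
    using kms by (simp add: kappa_mu_space_def)
  then show ?thesis
    by (simp add: ip_def[of p "R X Y \<xi>"] h_eq \<eta>_ip g_add g_diff g_scale vf_T ts_add ts_diff ts_scale
        flip: ip_def)
qed

text \<open>S = -\<phi>S\<phi> gives g(SE, E) = g(S\<phi>E, \<phi>E). Moving the first \<phi> across
  the trace changes the sign and produces \<phi>\<phi>, so the trace is its own negative.\<close>

lemma Tr_sig: "Tr p (\<lambda>E. ip p (sig E) E) = 0"
proof -
  have "Tr p (\<lambda>E. ip p (sig E) E) = Tr p (\<lambda>E. ip p (sig (Phi E)) (Phi E))"
  proof (rule Tr_cong)
    fix X assume "X \<in> vfields A"
    then show "ip p (sig X) X = ip p (sig (Phi X)) (Phi X)"
      using Phi_skew(1)[of "sig (Phi X)" X p] sig_eq[of X] by simp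
  qed
  also have "\<dots> = (-1) * Tr p (\<lambda>E. ip p (sig E) (Phi (Phi E)))"
    by (rule Tr_adjoint[where B = "\<lambda>X Y. ip p (sig X) (Phi Y)", OF _ _ Phi_adj])
      (simp_all add: endo_bitensorial endo_sig endo_Phi)
  also have "Tr p (\<lambda>E. ip p (sig E) (Phi (Phi E))) = Tr p (\<lambda>E. ip p (sig E) E)"
    by (rule Tr_cong) (simp add: Phi_Phi vf_smul ip_smooth ip_\<xi>_sig ip_sym[of "sig _" \<xi>])
  finally show ?thesis by simp
qed

lemma tau_eq: "tau X = sig X - Phi X"
  by (simp add: sig_def)

lemma Phi_alternating: "X \<in> vfields A \<Longrightarrow> ip p (Phi X) X = 0"
  using Phi_skew(2)[of X X p] by simp

lemma Tr_tau: "Tr p (\<lambda>E. ip p (tau E) E) = 0"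
proof -
  have "Tr p (\<lambda>E. ip p (tau E) E) = Tr p (\<lambda>E. ip p (sig E) E)"
    by (rule Tr_cong) (simp add: tau_eq Phi_alternating)
  then show ?thesis by (simp add: Tr_sig)
qed

text \<open>The divergence of \<phi> is a multiple of \<xi>: tracing the derivative of \<phi>\<phi>
  against \<phi>Z leaves this divergence paired with \<phi>\<phi>Z, which is Z at
  \<open>p\<close>.\<close>

lemma Tr_nphi_diag:
  assumes [simp]: "Z \<in> vfields A" and Z: "ip p \<xi> Z = 0"
  shows "Tr p (\<lambda>E. ip p (nphi E E) Z) = 0"
proof -
  have contr: "Tr p (\<lambda>E. ip p \<xi> E * ip p (tau E) V) = 0" if [simp]: "V \<in> vfields A" for V
    using Tr_contract[OF endo_tensorial'[OF endo_tau that] \<xi>_vf, of p] by (simp add: tau_\<xi>)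
  \<comment> \<open>Let t be this trace. In the traced cyclic identity the first term is 0, skewness
    makes the second -t, and \<open>Tr_adjoint\<close> makes the third -t; hence 2t = 0.\<close>
  have *: "Tr p (\<lambda>E. ip p (nphi E (Phi E)) V) = 0" if [simp]: "V \<in> vfields A" for V
  proof -
    have a: "Tr p (\<lambda>E. ip p E (nphi V (Phi E))) = 0"
    proof -
      have "Tr p (\<lambda>E. ip p E (nphi V (Phi E))) = Tr p (\<lambda>E. (-1) * (ip p \<xi> E * ip p (tau V) E))"
      proof (rule Tr_cong)
        fix E assume [simp]: "E \<in> vfields A"
        have "ip p (Phi (nphi V E)) E = - ip p (nphi V E) (Phi E)" by (simp add: Phi_skew(1))
        then have "ip p (Phi (nphi V E)) E = ip p E (nphi V (Phi E))"
          using nphi_skew[of V E "Phi E" p] by simp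
        then show "ip p E (nphi V (Phi E)) = (-1) * (ip p \<xi> E * ip p (tau V) E)"
          using nphi_Phi[of V E E p] by (simp add: ip_sym[of "nphi V (Phi E)" E])
      qed
      also have "\<dots> = - ip p (tau V) \<xi>"
        using Tr_contract[OF endo_tensorial[OF endo_id tau_vf[OF that]] \<xi>_vf, of p]
        by (simp only: Tr_simps(3))
      finally show ?thesis by (simp add: ip_tau_\<xi>)
    qed
    have b: "Tr p (\<lambda>E. ip p V (nphi (Phi E) E)) = (-1) * Tr p (\<lambda>E. ip p V (nphi E (Phi E)))"
      by (rule Tr_adjoint[where B = "\<lambda>X Y. ip p V (nphi X Y)", OF _ _ Phi_adj])
        (simp_all add: bitensorialI endo_tensorial endo_nphi)
    have "Tr p (\<lambda>E. ip p E (nphi V (Phi E)) + ip p (Phi E) (nphi E V) + ip p V (nphi (Phi E) E)) = 0"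
      by (rule Tr_skew) (simp add: nphi_cyclic)
    then have "Tr p (\<lambda>E. ip p (Phi E) (nphi E V)) = Tr p (\<lambda>E. ip p V (nphi E (Phi E)))"
      by (simp add: Tr_simps a b)
    moreover have "Tr p (\<lambda>E. ip p (Phi E) (nphi E V)) = Tr p (\<lambda>E. - ip p (nphi E (Phi E)) V)"
      by (rule Tr_cong) (simp add: nphi_skew)
    moreover have "Tr p (\<lambda>E. ip p V (nphi E (Phi E))) = Tr p (\<lambda>E. ip p (nphi E (Phi E)) V)"
      by (rule Tr_cong) (simp add: ip_sym[of V])
    ultimately show ?thesis by (simp add: Tr_simps)
  qed
  have "Tr p (\<lambda>E. ip p (nphi E (Phi E)) (Phi Z) + ip p (Phi (nphi E E)) (Phi Z)) =
      Tr p (\<lambda>E. (- ip p \<xi> (Phi Z)) * ip p (tau E) E - ip p \<xi> E * ip p (tau E) (Phi Z))"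
    by (rule Tr_cong) (simp add: nphi_Phi)
  then have "Tr p (\<lambda>E. ip p (Phi (nphi E E)) (Phi Z)) = 0"
    by (simp add: Tr_simps * contr ip_\<xi>_Phi Tr_tau)
  moreover have "Tr p (\<lambda>E. ip p (Phi (nphi E E)) (Phi Z)) = Tr p (\<lambda>E. - ip p (nphi E E) Z)"
    by (rule Tr_cong) (simp add: Phi_skew(1) Phi_Phi vf_smul ip_smooth Z)
  ultimately show ?thesis by (simp add: Tr_simps)
qed

text \<open>The trace of S is identically 0, but frames chosen pointwise give nothing to
  differentiate. Instead S = -\<phi>S\<phi> is differentiated and the argument of
  \<open>Tr_sig\<close> repeated; the terms with \<nabla>\<phi> contribute \<open>2 * Q\<close>,
  where Q = -Q.\<close>

lemma Tr_nsig:
  assumes [simp]: "Z \<in> vfields A"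
  shows "Tr p (\<lambda>E. ip p (nsig Z E) E) = 0"
proof -
  define Q where "Q = Tr p (\<lambda>E. ip p (nphi Z E) (sig (Phi E)))"
  have "Q = (-1) * Tr p (\<lambda>E. ip p E (sig (Phi (nphi Z E))))"
    unfolding Q_def
    by (rule Tr_adjoint[where B = "\<lambda>X Y. ip p X (sig (Phi Y))", OF _ _ nphi_adj])
      (simp_all add: endo_bitensorial endo_id endo_compose[OF endo_sig endo_Phi])
  also have "Tr p (\<lambda>E. ip p E (sig (Phi (nphi Z E)))) = Q"
    unfolding Q_def
  proof (rule Tr_cong)
    fix E assume [simp]: "E \<in> vfields A"
    have "ip p E (sig (Phi (nphi Z E))) = ip p (Phi (nphi Z E)) (sig E)"
      by (simp add: sig_sym(2)[symmetric] ip_sym[of "sig E"])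
    then show "ip p E (sig (Phi (nphi Z E))) = ip p (nphi Z E) (sig (Phi E))"
      by (simp add: Phi_skew(1) sig_Phi)
  qed
  finally have Q: "Q = 0" by simp
  have ns: "ip p (nsig Z E) E = ip p (nsig Z (Phi E)) (Phi E) + 2 * ip p (nphi Z E) (sig (Phi E))"
    if [simp]: "E \<in> vfields A" for E
  proof -
    have "nsig Z E = - (nphi Z (sig (Phi E)) + Phi (nsig Z (Phi E)) + Phi (sig (nphi Z E)))"
      using sig_eq[of E] sig_eq[of "nabla Z E"]
      by (simp add: nsig_def nphi_def endo_diff_app[OF endo_Phi] endo_diff_app[OF endo_sig]
          nabla_uminus)
    moreover have "ip p (nphi Z (sig (Phi E))) E = - ip p (nphi Z E) (sig (Phi E))"
      by (simp add: nphi_skew[of Z "sig (Phi E)"] ip_sym[of "sig (Phi E)"])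
    moreover have "ip p (Phi (sig (nphi Z E))) E = - ip p (nphi Z E) (sig (Phi E))"
      by (simp add: Phi_skew(1) sig_sym(2))
    ultimately show ?thesis by (simp add: Phi_skew(1))
  qed
  have "Tr p (\<lambda>E. ip p (nsig Z E) E) = Tr p (\<lambda>E. ip p (nsig Z (Phi E)) (Phi E)) + 2 * Q"
    unfolding Q_def by (simp only: Tr_simps[symmetric]) (rule Tr_cong, rule ns)
  also have "Tr p (\<lambda>E. ip p (nsig Z (Phi E)) (Phi E)) = (-1) * Tr p (\<lambda>E. ip p (nsig Z E) (Phi (Phi E)))"
    by (rule Tr_adjoint[where B = "\<lambda>X Y. ip p (nsig Z X) (Phi Y)", OF _ _ Phi_adj])
      (simp_all add: endo_bitensorial endo_nsig endo_Phi)
  also have "Tr p (\<lambda>E. ip p (nsig Z E) (Phi (Phi E))) =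
      Tr p (\<lambda>E. ip p (nsig Z E) E - ip p \<xi> E * ip p (nsig Z E) \<xi>)"
    by (rule Tr_cong) (simp add: Phi_Phi vf_smul ip_smooth)
  also have "\<dots> = Tr p (\<lambda>E. ip p (nsig Z E) E) - ip p (nsig Z \<xi>) \<xi>"
    using Tr_contract[OF endo_tensorial'[OF endo_nsig(1)[OF assms] \<xi>_vf] \<xi>_vf, of p]
    by (simp add: Tr_simps)
  also have "ip p (nsig Z \<xi>) \<xi> = 0"
    by (simp add: nsig_def sig_\<xi> nabla_zero ip_sym[of "sig _" \<xi>] ip_\<xi>_sig)
  finally show ?thesis using Q by simp
qed

theorem Tr_hess:
  assumes [simp]: "Z \<in> vfields A" and Z: "ip p \<xi> Z = 0"
  shows "Tr p (\<lambda>E. ip p (hess E E) Z) = 0"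
proof -
  have "Tr p (\<lambda>E. ip p (hess E E) Z) =
      Tr p (\<lambda>E. ip p (nsig Z E) E - (ip p \<xi> E * (\<kappa> p * ip p Z E + \<mu> p * ip p (Phi (sig Z)) E)) -
        2 * ip p (nphi E E) Z)"
  proof (rule Tr_cong)
    fix E assume [simp]: "E \<in> vfields A"
    \<comment> \<open>\<open>nphi_hess\<close> exchanges the last two arguments of
      \<open>hess\<close> at the price of \<nabla>\<phi>, and \<open>hess_swap\<close> the first two
      at the price of curvature. This brings Z to the differentiating slot, where the trace is that
      of \<open>nsig Z\<close>.\<close>
    have "ip p (hess Z E) E = ip p (nsig Z E) E - ip p (nphi Z E) E"
      by (simp add: hess_def nsig_def nphi_def tau_eq nabla_diff)
    moreover have "ip p (nphi Z E) E = 0" using nphi_skew[of Z E E p] by (simp add: ip_sym[of E])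
    moreover have "ip p E (nphi E Z) = - ip p (nphi E E) Z" by (simp add: nphi_skew)
    ultimately show "ip p (hess E E) Z =
        ip p (nsig Z E) E - (ip p \<xi> E * (\<kappa> p * ip p Z E + \<mu> p * ip p (Phi (sig Z)) E)) -
        2 * ip p (nphi E E) Z"
      using nphi_hess[of E E Z p] hess_swap[of E Z E p] R_\<xi>[of E Z E p]
      by (simp add: Z algebra_simps)
  qed
  also have "\<dots> = - (\<kappa> p * ip p Z \<xi> + \<mu> p * ip p (Phi (sig Z)) \<xi>)"
  proof -
    have "tensorial p (\<lambda>E. \<kappa> p * ip p Z E + \<mu> p * ip p (Phi (sig Z)) E)"
      by (rule tensorialI) (simp_all add: algebra_simps)
    from Tr_contract[OF this \<xi>_vf] show ?thesis
      by (simp add: Tr_simps(2,3) Tr_nsig Tr_nphi_diag[OF _ Z])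
  qed
  also have "\<dots> = 0"
    using Z by (simp add: ip_sym[of _ \<xi>] ip_\<xi>_Phi)
  finally show ?thesis .
qed

theorem Tr_curvature:
  assumes [simp]: "Z \<in> vfields A"
  shows "Tr p (\<lambda>E. ip p (R (tau E) \<xi> E) Z) = 0"
proof -
  let ?h = "\<lambda>X. Phi (sig X)"
  have "Tr p (\<lambda>E. ip p (R (tau E) \<xi> E) Z) =
      Tr p (\<lambda>E. (\<kappa> p * ip p \<xi> Z) * ip p (tau E) E + (\<mu> p * ip p \<xi> Z) * ip p (sig E) E -
        ip p \<xi> E * (\<kappa> p * ip p Z (tau E) + \<mu> p * ip p (?h Z) (tau E)))"
  proof (rule Tr_cong)
    fix E assume [simp]: "E \<in> vfields A"
    \<comment> \<open>With h = \<phi>S, the S part of \<nabla>\<xi> pairs to zero because \<phi> is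
      alternating, and the \<phi> part restores \<phi>\<phi>. The diagonal of h\<nabla>\<xi> is
      therefore that of S.\<close>
    have "ip p (?h E) (tau E) = ip p (sig E) E"
    proof -
      have "ip p (?h E) (sig E) = 0" by (simp add: Phi_alternating)
      moreover have "ip p (?h E) (Phi E) = - ip p (sig E) E"
        using Phi_skew(1)[of "?h E" E p] by (simp add: Phi_Phi_sig)
      ultimately show ?thesis by (simp add: tau_eq)
    qed
    then show "ip p (R (tau E) \<xi> E) Z =
        (\<kappa> p * ip p \<xi> Z) * ip p (tau E) E + (\<mu> p * ip p \<xi> Z) * ip p (sig E) E -
        ip p \<xi> E * (\<kappa> p * ip p Z (tau E) + \<mu> p * ip p (?h Z) (tau E))"
      using R_pair[of "tau E" \<xi> E Z p] R_skew[of E Z "tau E" \<xi> p] R_\<xi>[of E Z "tau E" p]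
      by (simp add: algebra_simps ip_sym[of E "tau E"])
  qed
  also have "\<dots> = - (\<kappa> p * ip p Z (tau \<xi>) + \<mu> p * ip p (?h Z) (tau \<xi>))"
  proof -
    have "tensorial p (\<lambda>E. \<kappa> p * ip p Z (tau E) + \<mu> p * ip p (?h Z) (tau E))"
      by (rule tensorialI) (simp_all add: endoD[OF endo_tau] algebra_simps)
    from Tr_contract[OF this \<xi>_vf] show ?thesis
      by (simp add: Tr_simps Tr_tau Tr_sig)
  qed
  finally show ?thesis by (simp add: tau_\<xi>)
qed

end

section \<open>The first variation of the energy\<close>

text \<open>Mean value theorem in t. Halving the time interval makes it compact, so that the time
  derivative is bounded over it and \<open>C\<close>.\<close>

lemma smooth_on_lipschitz_time:
  fixes u :: "real \<times> 'b::euclidean_space \<Rightarrow> real"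
  assumes u: "smooth_on u ({-\<epsilon><..<\<epsilon>} \<times> S)" and \<epsilon>: "\<epsilon> > 0" and C: "compact C" "C \<subseteq> S"
  shows "\<exists>B\<ge>0. \<forall>t. \<bar>t\<bar> \<le> \<epsilon>/2 \<longrightarrow> (\<forall>y\<in>C. \<bar>u (t, y) - u (0, y)\<bar> \<le> B * \<bar>t\<bar>)"
proof -
  let ?D = "\<lambda>z. frechet_derivative u (at z) (1, 0)"
  let ?Q = "{-(\<epsilon>/2)..\<epsilon>/2} \<times> C"
  have sub: "?Q \<subseteq> {-\<epsilon><..<\<epsilon>} \<times> S" using \<epsilon> C(2) by auto
  have "continuous_on ?Q ?D"
    by (rule continuous_on_subset[OF smooth_on_imp_continuous_on[OF smooth_on_frechet_derivative[OF u]] sub])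
  then have "bounded (?D ` ?Q)"
    by (intro compact_imp_bounded compact_continuous_image compact_Times C compact_Icc)
  then obtain b where b: "\<And>z. z \<in> ?Q \<Longrightarrow> norm (?D z) \<le> b"
    unfolding bounded_iff by auto
  have "\<bar>u (t, y) - u (0, y)\<bar> \<le> max b 0 * \<bar>t\<bar>" if t: "\<bar>t\<bar> \<le> \<epsilon>/2" and y: "y \<in> C" for t y
  proof -
    have "norm (u (t, y) - u (0, y)) \<le> max b 0 * norm (t - 0)"
    proof (rule field_differentiable_bound[where S = "{-(\<epsilon>/2)..\<epsilon>/2}" and f = "\<lambda>s. u (s, y)" and f' = "\<lambda>s. ?D (s, y)"])
      fix s assume s: "s \<in> {-(\<epsilon>/2)..\<epsilon>/2}"
      have z: "(s, y) \<in> ?Q" using s y by simp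
      have zd: "(u has_derivative frechet_derivative u (at (s, y))) (at (s, y))"
        by (rule smooth_on_has_derivative[OF u]) (use z sub in blast)
      have "((\<lambda>s. (s, y)) has_derivative (\<lambda>h. (h, 0))) (at s)"
        by (auto intro!: derivative_eq_intros)
      from has_derivative_compose[OF this zd]
      have "((\<lambda>s. u (s, y)) has_derivative (\<lambda>h. frechet_derivative u (at (s, y)) (h, 0))) (at s)" .
      moreover have eq: "frechet_derivative u (at (s, y)) (h, 0) = ?D (s, y) * h" for h
        using linear_cmul[OF has_derivative_linear[OF zd], of h "(1, 0)"] by simp
      ultimately have "((\<lambda>s. u (s, y)) has_derivative (\<lambda>h. ?D (s, y) * h)) (at s)"
        by (subst (asm) eq)
      then show "((\<lambda>s. u (s, y)) has_field_derivative ?D (s, y)) (at s within {-(\<epsilon>/2)..\<epsilon>/2})"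
        unfolding has_field_derivative_def by (rule has_derivative_at_withinI)
      show "norm (?D (s, y)) \<le> max b 0" using b[OF z] by simp
    qed (use t \<epsilon> in auto)
    then show ?thesis by simp
  qed
  then show ?thesis by (intro exI[of _ "max b 0"]) simp
qed

lemma has_real_derivative_0_of_quadratic:
  fixes f :: "real \<Rightarrow> real"
  assumes "\<delta> > 0" "\<And>t. \<bar>t\<bar> < \<delta> \<Longrightarrow> \<bar>f t - f 0\<bar> \<le> C * t\<^sup>2"
  shows "(f has_real_derivative 0) (at 0)"
proof -
  have "((\<lambda>h. (f (0 + h) - f 0) / h) \<longlongrightarrow> 0) (at 0)"
  proof (rule Lim_null_comparison)
    show "\<forall>\<^sub>F h in at 0. norm ((f (0 + h) - f 0) / h) \<le> C * \<bar>h\<bar>"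
      unfolding eventually_at
    proof (intro exI[of _ \<delta>] conjI ballI impI assms(1))
      fix h :: real assume h: "h \<noteq> 0 \<and> dist h 0 < \<delta>"
      then have "\<bar>f h - f 0\<bar> \<le> C * (\<bar>h\<bar> * \<bar>h\<bar>)" using assms(2)[of h] by (simp add: power2_eq_square)
      then show "norm ((f (0 + h) - f 0) / h) \<le> C * \<bar>h\<bar>"
        using h by (simp add: divide_le_eq mult.assoc)
    qed
    show "((\<lambda>h. C * \<bar>h\<bar>) \<longlongrightarrow> 0) (at 0)"
      by (auto intro!: tendsto_eq_intros)
  qed
  then show ?thesis by (simp add: DERIV_def)
qed

lemma length_variationD:
  assumes var: "length_variation A g r D V e W"
  shows "e > 0" "W 0 = V" "\<bar>t\<bar> < e \<Longrightarrow> W t \<in> vfields A" "\<bar>t\<bar> < e \<Longrightarrow> g p (W t p) (W t p) = r"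
    "smooth_fun A f \<Longrightarrow> (U, x) \<in> A \<Longrightarrow>
      smooth_on (\<lambda>(t, y). W t (inv_into U x y) f) ({-e<..<e} \<times> x ` U)"
    "\<exists>K. compact K \<and> K \<subseteq> D \<and> (\<forall>t. \<bar>t\<bar> < e \<longrightarrow> (\<forall>p. p \<notin> K \<longrightarrow> W t p = V p))"
proof -
  note v = var[unfolded length_variation_def]
  have I: "t \<in> {-e<..<e}" if "\<bar>t\<bar> < e" for t using that by auto
  show "e > 0" by (rule conjunct1[OF v])
  show "W 0 = V" by (rule conjunct1[OF conjunct2[OF v]])
  note 3 = bspec[OF conjunct1[OF conjunct2[OF conjunct2[OF v]]] I]
  show "\<bar>t\<bar> < e \<Longrightarrow> W t \<in> vfields A" by (rule conjunct1[OF 3])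
  show "\<bar>t\<bar> < e \<Longrightarrow> g p (W t p) (W t p) = r" by (rule spec[OF conjunct2[OF 3]])
  show "smooth_fun A f \<Longrightarrow> (U, x) \<in> A \<Longrightarrow>
      smooth_on (\<lambda>(t, y). W t (inv_into U x y) f) ({-e<..<e} \<times> x ` U)"
    using conjunct1[OF conjunct2[OF conjunct2[OF conjunct2[OF v]]]] by fast
  obtain K where K: "compact K" "K \<subseteq> D" "\<forall>t\<in>{-e<..<e}. \<forall>p. p \<notin> K \<longrightarrow> W t p = V p"
    using conjunct2[OF conjunct2[OF conjunct2[OF conjunct2[OF v]]]] by blast
  show "\<exists>K. compact K \<and> K \<subseteq> D \<and> (\<forall>t. \<bar>t\<bar> < e \<longrightarrow> (\<forall>p. p \<notin> K \<longrightarrow> W t p = V p))"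
    by (rule exI[of _ K]) (use K I in blast)
qed

section \<open>Pointwise estimates for a variation\<close>

context levi_civita_coords
begin

text \<open>The fields \<open>\<partial>\<^sub>k\<close> and \<open>\<nabla>\<^sub>i \<partial>\<^sub>k\<close>: both a vector field and its first covariant derivatives are
  combinations of them with coefficients of first order in the components.\<close>

definition jet :: "'n option \<times> 'n \<Rightarrow> 'a vfield"
  where "jet = (\<lambda>(i, k). case i of None \<Rightarrow> dh k | Some i \<Rightarrow> nabla (dh i) (dh k))"

lemma jet_vf: "jet m \<in> vfields A"
  by (cases m) (auto simp: jet_def dh_vf split: option.split)

lemma sum_jet:
  "(\<Sum>m\<in>UNIV. c m *\<^sub>R jet m q) =
    (\<Sum>k\<in>UNIV. c (None, k) *\<^sub>R dh k q) +
    (\<Sum>i\<in>UNIV. \<Sum>k\<in>UNIV. c (Some i, k) *\<^sub>R nabla (dh i) (dh k) q)"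
proof -
  have "(\<Sum>m\<in>UNIV. c m *\<^sub>R jet m q) = (\<Sum>i\<in>UNIV. \<Sum>k\<in>UNIV. c (i, k) *\<^sub>R jet (i, k) q)"
    by (simp add: sum.cartesian_product)
  also have "\<dots> = (\<Sum>k\<in>UNIV. c (None, k) *\<^sub>R jet (None, k) q) +
      (\<Sum>i\<in>UNIV. \<Sum>k\<in>UNIV. c (Some i, k) *\<^sub>R jet (Some i, k) q)"
    by (simp add: UNIV_option_conv sum.reindex)
  finally show ?thesis by (simp add: jet_def)
qed

text \<open>An indefinite g gives no norm, so the size of a vector is measured by its coefficients
  in the fields \<open>jet\<close>, whose mutual inner products are bounded on
  \<open>K\<close>.\<close>

lemma jet_bound:
  assumes K: "compact K"
  shows "\<exists>B\<ge>0. \<forall>p\<in>K. \<forall>a c d. (\<forall>m. \<bar>c m\<bar> \<le> a) \<longrightarrow> (\<forall>m. \<bar>d m\<bar> \<le> a) \<longrightarrow>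
    \<bar>g p (\<Sum>m\<in>UNIV. c m *\<^sub>R jet m p) (\<Sum>m\<in>UNIV. d m *\<^sub>R jet m p)\<bar> \<le> B * a\<^sup>2"
proof -
  have "\<exists>b. \<forall>p\<in>K. \<bar>g p (jet m p) (jet l p)\<bar> \<le> b" for m l
  proof -
    have "continuous_on K (\<lambda>p. g p (jet m p) (jet l p))"
      by (rule continuous_on_subset[OF smooth_fun_continuous[OF g_smooth[OF jet_vf jet_vf]]]) simp
    then have "bounded ((\<lambda>p. g p (jet m p) (jet l p)) ` K)"
      by (intro compact_imp_bounded compact_continuous_image K)
    then show ?thesis unfolding bounded_iff by auto
  qed
  then obtain b where b: "\<And>m l p. p \<in> K \<Longrightarrow> \<bar>g p (jet m p) (jet l p)\<bar> \<le> b m l" by metis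
  have "\<bar>g p (\<Sum>m\<in>UNIV. c m *\<^sub>R jet m p) (\<Sum>m\<in>UNIV. d m *\<^sub>R jet m p)\<bar> \<le>
      (\<Sum>m\<in>UNIV. \<Sum>l\<in>UNIV. \<bar>b m l\<bar>) * a\<^sup>2"
    if p: "p \<in> K" and c: "\<forall>m. \<bar>c m\<bar> \<le> a" and d: "\<forall>m. \<bar>d m\<bar> \<le> a" for p a c d
  proof -
    have eq: "g p (\<Sum>m\<in>UNIV. c m *\<^sub>R jet m p) (\<Sum>m\<in>UNIV. d m *\<^sub>R jet m p) =
        (\<Sum>m\<in>UNIV. \<Sum>l\<in>UNIV. c m * d l * g p (jet m p) (jet l p))"
    proof -
      have T: "(\<Sum>m\<in>UNIV. d m *\<^sub>R jet m p) \<in> T p" by (simp add: ts_sum ts_scale vf_T[OF jet_vf])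
      have "g p (\<Sum>m\<in>UNIV. c m *\<^sub>R jet m p) (\<Sum>m\<in>UNIV. d m *\<^sub>R jet m p) =
          (\<Sum>m\<in>UNIV. c m * g p (jet m p) (\<Sum>l\<in>UNIV. d l *\<^sub>R jet l p))"
        by (simp add: g_sum(1)[OF T] g_scale T vf_T[OF jet_vf] ts_scale)
      also have "\<dots> = (\<Sum>m\<in>UNIV. c m * (\<Sum>l\<in>UNIV. d l * g p (jet m p) (jet l p)))"
        by (simp add: g_sum(2) g_scale2 vf_T[OF jet_vf] ts_scale)
      finally show ?thesis by (simp add: sum_distrib_left mult.assoc)
    qed
    have "\<bar>g p (\<Sum>m\<in>UNIV. c m *\<^sub>R jet m p) (\<Sum>m\<in>UNIV. d m *\<^sub>R jet m p)\<bar> \<le>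
        (\<Sum>m\<in>UNIV. \<Sum>l\<in>UNIV. \<bar>c m * d l * g p (jet m p) (jet l p)\<bar>)"
      unfolding eq by (rule order_trans[OF sum_abs]) (intro sum_mono sum_abs)
    also have "\<dots> \<le> (\<Sum>m\<in>UNIV. \<Sum>l\<in>UNIV. \<bar>b m l\<bar> * a\<^sup>2)"
    proof (intro sum_mono)
      fix m l
      have "0 \<le> a" using order_trans[OF abs_ge_zero spec[OF c]] .
      then have "\<bar>c m\<bar> * \<bar>d l\<bar> \<le> a * a"
        using spec[OF c, of m] spec[OF d, of l] by (intro mult_mono) simp_all
      moreover have "\<bar>g p (jet m p) (jet l p)\<bar> \<le> \<bar>b m l\<bar>" using b[OF p, of m l] by linarith
      ultimately have "(\<bar>c m\<bar> * \<bar>d l\<bar>) * \<bar>g p (jet m p) (jet l p)\<bar> \<le> (a * a) * \<bar>b m l\<bar>"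
        by (rule mult_mono) simp_all
      then show "\<bar>c m * d l * g p (jet m p) (jet l p)\<bar> \<le> \<bar>b m l\<bar> * a\<^sup>2"
        by (simp add: abs_mult power2_eq_square mult_ac)
    qed
    finally show ?thesis by (simp add: sum_distrib_right)
  qed
  moreover have "(\<Sum>m\<in>UNIV. \<Sum>l\<in>UNIV. \<bar>b m l\<bar>) \<ge> 0" by (intro sum_nonneg) auto
  ultimately show ?thesis by blast
qed

lemma Hinv_bound:
  assumes K: "compact K" "K \<subseteq> N"
  obtains b where "\<And>p j k. p \<in> K \<Longrightarrow> \<bar>Hinv p $ j $ k\<bar> \<le> b j k"
proof -
  have "\<exists>b. \<forall>p\<in>K. \<bar>Hinv p $ j $ k\<bar> \<le> b" for j k
  proof -
    have "bounded ((\<lambda>p. Hinv p $ j $ k) ` K)"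
      by (intro compact_imp_bounded compact_continuous_image continuous_on_subset[OF Hinv_continuous K(2)] K)
    then show ?thesis unfolding bounded_iff by auto
  qed
  then show ?thesis using that by metis
qed

text \<open>Z and its coordinate covariant derivatives have coefficients bounded by a in the fields
  \<open>jet\<close>. The bounded matrix \<open>Hinv\<close> then turns bounds on inner products
  into bounds on the metric trace.\<close>

lemma gradient_bound:
  assumes K: "compact K" "K \<subseteq> N"
  shows "\<exists>B\<ge>0. \<forall>p\<in>K. \<forall>Z\<in>vfields A. \<forall>a. (\<forall>k. \<bar>Z p (xh k)\<bar> \<le> a) \<longrightarrow>
    (\<forall>j k. \<bar>dh j p (\<lambda>q. Z q (xh k))\<bar> \<le> a) \<longrightarrow>
    \<bar>g p (Z p) (Z p)\<bar> \<le> B * a\<^sup>2 \<and>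
    \<bar>metric_trace A g (\<lambda>X Y p. ip p (nabla X Z) (nabla Y Z)) p\<bar> \<le> B * a\<^sup>2"
proof -
  obtain J where J0: "J \<ge> 0" and J1: "\<forall>p\<in>K. \<forall>a c d. (\<forall>m. \<bar>c m\<bar> \<le> a) \<longrightarrow> (\<forall>m. \<bar>d m\<bar> \<le> a) \<longrightarrow>
      \<bar>g p (\<Sum>m\<in>UNIV. c m *\<^sub>R jet m p) (\<Sum>m\<in>UNIV. d m *\<^sub>R jet m p)\<bar> \<le> J * a\<^sup>2"
    using jet_bound[OF K(1)] by (elim exE conjE)
  note J = J0 J1[THEN bspec, THEN spec, THEN spec, THEN spec, THEN mp, THEN mp]
  obtain b where b: "\<And>p j k. p \<in> K \<Longrightarrow> \<bar>Hinv p $ j $ k\<bar> \<le> b j k"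
    by (rule Hinv_bound[OF K]) blast
  define H where "H = (\<Sum>j\<in>UNIV. \<Sum>k\<in>UNIV. \<bar>b j k\<bar>)"
  have H0: "H \<ge> 0" unfolding H_def by (intro sum_nonneg) auto
  have main: "\<bar>g p (Z p) (Z p)\<bar> \<le> J * a\<^sup>2 \<and>
      \<bar>metric_trace A g (\<lambda>X Y p. ip p (nabla X Z) (nabla Y Z)) p\<bar> \<le> H * J * a\<^sup>2"
    if p: "p \<in> K" and Z: "Z \<in> vfields A" and z: "\<And>k. \<bar>Z p (xh k)\<bar> \<le> a"
      and dz: "\<And>j k. \<bar>dh j p (\<lambda>q. Z q (xh k))\<bar> \<le> a" for p Z a
  proof
    have pN: "p \<in> N" using p K(2) by blast
    have a0: "a \<ge> 0" using order_trans[OF abs_ge_zero z] .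
    define c0 where "c0 = (\<lambda>(i::'n option, k). case i of None \<Rightarrow> Z p (xh k) | Some i \<Rightarrow> 0)"
    \<comment> \<open>By \<open>nabla_coords\<close> the covariant derivative in direction j
      involves the fields \<open>nabla (dh i) (dh k)\<close> for \<open>i = j\<close> only; the
      other slots are filled with zero.\<close>
    define c where "c j = (\<lambda>(i, k). case i of None \<Rightarrow> dh j p (\<lambda>q. Z q (xh k)) |
        Some i \<Rightarrow> if i = j then Z p (xh k) else 0)" for j
    have "Z p = (\<Sum>m\<in>UNIV. c0 m *\<^sub>R jet m p)"
      using tangent_expand[OF pN vf_T[OF Z]] by (simp add: sum_jet c0_def)
    moreover have "\<forall>m. \<bar>c0 m\<bar> \<le> a" using z a0 by (auto simp: c0_def split: option.split)
    ultimately show "\<bar>g p (Z p) (Z p)\<bar> \<le> J * a\<^sup>2" using J(2)[OF p, of c0 a c0] by simp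
    have n: "nabla (dh j) Z p = (\<Sum>m\<in>UNIV. c j m *\<^sub>R jet m p)" for j
    proof -
      have "(\<Sum>i\<in>UNIV. \<Sum>k\<in>UNIV. c j (Some i, k) *\<^sub>R nabla (dh i) (dh k) p) =
          (\<Sum>i\<in>UNIV. if i = j then \<Sum>k\<in>UNIV. Z p (xh k) *\<^sub>R nabla (dh j) (dh k) p else 0)"
        by (intro sum.cong refl) (auto simp: c_def)
      then show ?thesis
        by (simp add: nabla_coords[OF pN Z] sum_jet sum.distrib) (simp add: c_def)
    qed
    have ca: "\<forall>m. \<bar>c j m\<bar> \<le> a" for j using z dz a0 by (auto simp: c_def split: option.split)
    have ng: "\<bar>ip p (nabla (dh j) Z) (nabla (dh k) Z)\<bar> \<le> J * a\<^sup>2" for j k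
      unfolding ip_def n by (rule J(2)[OF p ca ca])
    have en: "endo (\<lambda>X. nabla X Z)" by (rule endoI) (simp_all add: Z nabla_add nabla_smul)
    have eq: "metric_trace A g (\<lambda>X Y p. ip p (nabla X Z) (nabla Y Z)) p =
        (\<Sum>j\<in>UNIV. \<Sum>k\<in>UNIV. Hinv p $ j $ k * ip p (nabla (dh j) Z) (nabla (dh k) Z))"
      by (subst metric_trace_coords[OF pN]) (simp_all add: endo_bitensorial[OF en en])
    have "\<bar>metric_trace A g (\<lambda>X Y p. ip p (nabla X Z) (nabla Y Z)) p\<bar> \<le>
        (\<Sum>j\<in>UNIV. \<Sum>k\<in>UNIV. \<bar>Hinv p $ j $ k * ip p (nabla (dh j) Z) (nabla (dh k) Z)\<bar>)"
      unfolding eq by (rule order_trans[OF sum_abs]) (intro sum_mono sum_abs)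
    also have "\<dots> \<le> (\<Sum>j\<in>UNIV. \<Sum>k\<in>UNIV. \<bar>b j k\<bar> * (J * a\<^sup>2))"
    proof (intro sum_mono)
      fix j k
      have "\<bar>Hinv p $ j $ k\<bar> \<le> \<bar>b j k\<bar>" using b[OF p, of j k] by linarith
      then show "\<bar>Hinv p $ j $ k * ip p (nabla (dh j) Z) (nabla (dh k) Z)\<bar> \<le> \<bar>b j k\<bar> * (J * a\<^sup>2)"
        unfolding abs_mult using ng by (intro mult_mono) auto
    qed
    also have "\<dots> = H * J * a\<^sup>2"
      by (simp add: H_def sum_distrib_right mult.assoc)
    finally show "\<bar>metric_trace A g (\<lambda>X Y p. ip p (nabla X Z) (nabla Y Z)) p\<bar> \<le> H * J * a\<^sup>2" .
  qed
  have le: "J * a\<^sup>2 \<le> (J + H * J) * a\<^sup>2" "H * J * a\<^sup>2 \<le> (J + H * J) * a\<^sup>2" for a :: real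
    using J(1) H0 by (simp_all add: algebra_simps)
  show ?thesis
  proof (intro exI[of _ "J + H * J"] conjI ballI allI impI)
    show "0 \<le> J + H * J" using J(1) H0 by simp
    fix p Z a assume as: "p \<in> K" "Z \<in> vfields A" "\<forall>k. \<bar>Z p (xh k)\<bar> \<le> a"
      "\<forall>j k. \<bar>dh j p (\<lambda>q. Z q (xh k))\<bar> \<le> a"
    note m = main[OF as(1,2), of a]
    show "\<bar>g p (Z p) (Z p)\<bar> \<le> (J + H * J) * a\<^sup>2"
      using m as(3,4) le(1)[of a] by (meson order_trans)
    show "\<bar>metric_trace A g (\<lambda>X Y p. ip p (nabla X Z) (nabla Y Z)) p\<bar> \<le> (J + H * J) * a\<^sup>2"
      using m as(3,4) le(2)[of a] by (meson order_trans)
  qed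
qed

text \<open>The components of W t and their partial derivatives in the chart are jointly smooth in
  time and position, so both are Lipschitz in time. The constant is a sum over all indices in order
  to dominate each of them.\<close>

lemma variation_component_bound:
  assumes var: "length_variation A g r D V e W" and K: "compact K" "K \<subseteq> N"
  shows "\<exists>B\<ge>0. \<forall>t. \<bar>t\<bar> \<le> e/2 \<longrightarrow> (\<forall>p\<in>K. \<forall>k. \<bar>(W t - V) p (xh k)\<bar> \<le> B * \<bar>t\<bar> \<and>
    (\<forall>j. \<bar>dh j p (\<lambda>q. (W t - V) q (xh k))\<bar> \<le> B * \<bar>t\<bar>))"
proof -
  have e: "e > 0" and W0: "W 0 = V" and Wv: "\<And>t. \<bar>t\<bar> < e \<Longrightarrow> W t \<in> vfields A"
    using length_variationD[OF var] by auto
  let ?I = "{-e<..<e}"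
  have oI: "open (?I \<times> x ` U)" by (intro open_Times cf) auto
  define u where "u k = (\<lambda>(t, y). W t (inv_x y) (xh k))" for k
  have us: "smooth_on (u k) (?I \<times> x ` U)" for k
    unfolding u_def by (rule length_variationD(5)[OF var xh_smooth chart])
  define w where "w k j z = frechet_derivative (u k) (at z) (0, axis j 1)" for k j z
  have ws: "smooth_on (w k j) (?I \<times> x ` U)" for k j
    unfolding w_def by (rule smooth_on_frechet_derivative[OF us])
  have xK: "compact (x ` K)" "x ` K \<subseteq> x ` U"
    using K NU by (auto intro!: compact_continuous_image continuous_on_subset[OF cf(4)])
  have "\<exists>B\<ge>0. \<forall>t. \<bar>t\<bar> \<le> e/2 \<longrightarrow> (\<forall>y\<in>x ` K. \<bar>u k (t, y) - u k (0, y)\<bar> \<le> B * \<bar>t\<bar>)" for k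
    by (rule smooth_on_lipschitz_time[OF us e xK])
  then obtain B1 where B1: "\<And>k. B1 k \<ge> 0"
    "\<And>k t y. \<bar>t\<bar> \<le> e/2 \<Longrightarrow> y \<in> x ` K \<Longrightarrow> \<bar>u k (t, y) - u k (0, y)\<bar> \<le> B1 k * \<bar>t\<bar>"
    by metis
  have "\<exists>B\<ge>0. \<forall>t. \<bar>t\<bar> \<le> e/2 \<longrightarrow> (\<forall>y\<in>x ` K. \<bar>w k j (t, y) - w k j (0, y)\<bar> \<le> B * \<bar>t\<bar>)" for k j
    by (rule smooth_on_lipschitz_time[OF ws e xK])
  then obtain B2 where B2: "\<And>k j. B2 k j \<ge> 0"
    "\<And>k j t y. \<bar>t\<bar> \<le> e/2 \<Longrightarrow> y \<in> x ` K \<Longrightarrow> \<bar>w k j (t, y) - w k j (0, y)\<bar> \<le> B2 k j * \<bar>t\<bar>"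
    by metis
  define B where "B = (\<Sum>k\<in>UNIV. B1 k) + (\<Sum>k\<in>UNIV. \<Sum>j\<in>UNIV. B2 k j)"
  have s0: "(\<Sum>k\<in>UNIV. B1 k) \<ge> 0" "(\<Sum>k\<in>UNIV. \<Sum>j\<in>UNIV. B2 k j) \<ge> 0"
    by (simp_all add: sum_nonneg B1(1) B2(1))
  have B1le: "B1 k \<le> B" for k
    using member_le_sum[of k UNIV B1] B1(1) s0 by (simp add: B_def)
  have B2le: "B2 k j \<le> B" for k j
    using member_le_sum[of j UNIV "B2 k"] member_le_sum[of k UNIV "\<lambda>k. \<Sum>j\<in>UNIV. B2 k j"] B2(1) s0
    by (simp add: B_def sum_nonneg)
  show ?thesis
  proof (intro exI[of _ B] conjI allI impI ballI)
    show "0 \<le> B" using s0 by (simp add: B_def)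
    fix t p k assume t: "\<bar>t\<bar> \<le> e/2" and p: "p \<in> K"
    then have pN: "p \<in> N" and pU: "p \<in> U" using K(2) NU by auto
    have te: "\<bar>t\<bar> < e" using t e by linarith
    have comp: "(W t - V) q (xh k) = u k (t, x q) - u k (0, x q)" if "q \<in> U" for q
      using that by (simp add: u_def W0 cf minus_apply)
    have "\<bar>u k (t, x p) - u k (0, x p)\<bar> \<le> B1 k * \<bar>t\<bar>" by (rule B1(2)[OF t]) (use p in simp)
    also have "\<dots> \<le> B * \<bar>t\<bar>" by (intro mult_right_mono B1le) simp
    finally show "\<bar>(W t - V) p (xh k)\<bar> \<le> B * \<bar>t\<bar>" by (subst comp[OF pU])
    fix j
    have xp: "x p \<in> x ` N" using pN by simp
    have Zv: "W t - V \<in> vfields A" using Wv[OF te] Wv[of 0] e W0 by (auto intro: vf_diff)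
    have slice: "((\<lambda>y. u k (s, y)) has_derivative (\<lambda>v. frechet_derivative (u k) (at (s, x p)) (0, v))) (at (x p))"
      if "\<bar>s\<bar> < e" for s
    proof -
      have "(u k has_derivative frechet_derivative (u k) (at (s, x p))) (at (s, x p))"
        by (rule smooth_on_has_derivative[OF us]) (use that pU in auto)
      moreover have "((\<lambda>y. (s, y)) has_derivative (\<lambda>v. (0, v))) (at (x p))"
        by (auto intro!: derivative_eq_intros)
      ultimately show ?thesis using has_derivative_compose by blast
    qed
    have "((\<lambda>y. u k (t, y) - u k (0, y)) has_derivative (\<lambda>v. frechet_derivative (u k) (at (t, x p)) (0, v) -
        frechet_derivative (u k) (at (0, x p)) (0, v))) (at (x p))"
      by (rule has_derivative_diff[OF slice[OF te] slice]) (use e in simp)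
    then have "((\<lambda>y. (W t - V) (inv_x y) (xh k)) has_derivative (\<lambda>v. frechet_derivative (u k) (at (t, x p)) (0, v) -
        frechet_derivative (u k) (at (0, x p)) (0, v))) (at (x p))"
      by (rule has_derivative_transform_within_open[OF _ cf(2)]) (use pU in \<open>auto simp: u_def W0\<close>)
    from fun_cong[OF frechet_derivative_at[OF this], of "axis j 1"]
    have "dh j p (\<lambda>q. (W t - V) q (xh k)) = w k j (t, x p) - w k j (0, x p)"
      using dh_frechet(2)[OF xp vfieldsD(2)[OF Zv xh_smooth], of k j] by (simp add: w_def cf(6)[OF pU])
    moreover have "\<bar>w k j (t, x p) - w k j (0, x p)\<bar> \<le> B2 k j * \<bar>t\<bar>" by (rule B2(2)[OF t]) (use p in simp)
    moreover have "B2 k j * \<bar>t\<bar> \<le> B * \<bar>t\<bar>" by (intro mult_right_mono B2le) simp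
    ultimately show "\<bar>dh j p (\<lambda>q. (W t - V) q (xh k))\<bar> \<le> B * \<bar>t\<bar>" by linarith
  qed
qed

end

section \<open>Expansion and criticality of the energy\<close>

locale kappa_mu_volume = kappa_mu_manifold A g nabla n \<phi> \<xi> \<eta> \<kappa> \<mu> + volume_manifold A g nabla vol
  for A :: "('a::{t2_space,second_countable_topology}, 'n::finite) chart set"
    and g nabla n \<phi> \<xi> \<eta> \<kappa> \<mu> vol
begin

text \<open>The factor in tr \<nabla>\<nabla>\<xi> = lam \<xi>; the rough Laplacian of \<xi> is then
  -lam \<xi>.\<close>

definition "lam p = metric_trace A g (\<lambda>X Y p. ip p (hess X Y) \<xi>) p"

lemma bitensorial_hess: "W \<in> vfields A \<Longrightarrow> bitensorial p (\<lambda>X Y. ip p (hess X Y) W)"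
  by (intro bitensorialI endo_tensorial' endo_hess)

lemma lam_continuous: "continuous_on UNIV lam"
proof -
  have eq: "lam = metric_trace A g (\<lambda>X Y p. ip p (hess X Y) \<xi>)" by (rule ext) (simp add: lam_def)
  show ?thesis
    unfolding eq
    by (intro metric_trace_continuous bitensorial_hess smooth_fun_continuous ip_smooth) simp_all
qed

lemma Tr_hess_lam:
  assumes [simp]: "Z \<in> vfields A"
  shows "Tr p (\<lambda>E. ip p (hess E E) Z) = ip p \<xi> Z * lam p"
proof -
  \<comment> \<open>Orthogonality to \<xi> is required at \<open>p\<close> alone, so the \<xi>
    component is subtracted with a constant coefficient.\<close>
  let ?Z = "Z - ip p \<xi> Z *\<^sub>R \<xi>"
  have "0 = Tr p (\<lambda>E. ip p (hess E E) ?Z)"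
    by (rule Tr_hess[symmetric]) (simp_all add: ip_\<xi>_\<xi>)
  also have "\<dots> = Tr p (\<lambda>E. ip p (hess E E) Z - ip p \<xi> Z * ip p (hess E E) \<xi>)"
    by (rule Tr_cong) simp
  finally show ?thesis by (simp add: Tr_simps lam_def metric_trace_Tr)
qed

text \<open>\<open>adj_tau Z\<close> is metrically dual to \<open>V \<mapsto> g(\<nabla>\<^sub>V \<xi>, Z)\<close>; its divergence is the integrand of the
  first variation up to the rough Laplacian.\<close>

definition "adj_tau Z = tau Z + 2 *\<^sub>R Phi Z"

lemma adj_tau_vf [simp]: "Z \<in> vfields A \<Longrightarrow> adj_tau Z \<in> vfields A"
  by (simp add: adj_tau_def)

lemma ip_adj_tau: "Z \<in> vfields A \<Longrightarrow> V \<in> vfields A \<Longrightarrow> ip p (adj_tau Z) V = ip p (tau V) Z"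
  using deta[of V Z p] by (simp add: adj_tau_def ip_sym[of "Phi Z"])

lemma divg_adj_tau:
  assumes [simp]: "Z \<in> vfields A"
  shows "divg (adj_tau Z) p = ip p \<xi> Z * lam p + Tr p (\<lambda>E. ip p (tau E) (nabla E Z))"
proof -
  have "divg (adj_tau Z) p = Tr p (\<lambda>E. ip p (nabla E (adj_tau Z)) E)"
    by (simp add: divg_def metric_trace_Tr ip_def)
  also have "\<dots> = Tr p (\<lambda>E. ip p (hess E E) Z + ip p (tau E) (nabla E Z))"
  proof (rule Tr_cong)
    fix E assume [simp]: "E \<in> vfields A"
    have "(\<lambda>q. ip q (adj_tau Z) E) = (\<lambda>q. ip q (tau E) Z)" by (simp add: ip_adj_tau)
    then have "E p (\<lambda>q. ip q (adj_tau Z) E) = E p (\<lambda>q. ip q (tau E) Z)" by (rule arg_cong)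
    moreover have "E p (\<lambda>q. ip q (adj_tau Z) E) = ip p (nabla E (adj_tau Z)) E + ip p (adj_tau Z) (nabla E E)"
      by (rule ip_deriv) simp_all
    moreover have "E p (\<lambda>q. ip q (tau E) Z) = ip p (nabla E (tau E)) Z + ip p (tau E) (nabla E Z)"
      by (rule ip_deriv) simp_all
    moreover have "ip p (adj_tau Z) (nabla E E) = ip p (tau (nabla E E)) Z"
      by (rule ip_adj_tau) simp_all
    ultimately have "ip p (nabla E (adj_tau Z)) E =
        (ip p (nabla E (tau E)) Z - ip p (tau (nabla E E)) Z) + ip p (tau E) (nabla E Z)"
      by linarith
    then show "ip p (nabla E (adj_tau Z)) E = ip p (hess E E) Z + ip p (tau E) (nabla E Z)"
      by (simp add: hess_def)
  qed
  finally show ?thesis by (simp add: Tr_simps Tr_hess_lam)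
qed

definition "edens V = metric_trace A g (sasaki_pullback g nabla V)"

lemma edens_Tr: "edens V p = Tr p (\<lambda>E. ip p E E + ip p (nabla E V) (nabla E V))"
  by (simp add: edens_def metric_trace_Tr sasaki_pullback_def ip_def)

lemma endo_nabla: "Z \<in> vfields A \<Longrightarrow> endo (\<lambda>X. nabla X Z)"
  by (rule endoI) (simp_all add: nabla_add nabla_smul)

lemma edens_continuous:
  assumes [simp]: "V \<in> vfields A"
  shows "continuous_on UNIV (edens V)"
  unfolding edens_def
proof (rule metric_trace_continuous)
  show "bitensorial q (\<lambda>X Y. sasaki_pullback g nabla V X Y q)" for q
  proof (rule bitensorialI)
    fix X assume [simp]: "X \<in> vfields A"
    show "tensorial q (\<lambda>Y. sasaki_pullback g nabla V X Y q)"
      "tensorial q (\<lambda>Y. sasaki_pullback g nabla V Y X q)"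
      unfolding sasaki_pullback_def ip_def[symmetric]
      by (rule tensorialI; simp add: nabla_add nabla_smul algebra_simps)+
  qed
  show "continuous_on UNIV (sasaki_pullback g nabla V X Y)" if "X \<in> vfields A" "Y \<in> vfields A" for X Y
    using that unfolding sasaki_pullback_def ip_def[symmetric]
    by (intro smooth_fun_continuous smooth_fun_add ip_smooth) simp_all
qed

text \<open>The part of the energy density that is quadratic in Z. Its first summand is -2 g(\<xi>,
  Z) lam, rewritten by the length constraint.\<close>

definition "rem Z p = lam p * ip p Z Z + metric_trace A g (\<lambda>X Y p. ip p (nabla X Z) (nabla Y Z)) p"

lemma rem_continuous: "Z \<in> vfields A \<Longrightarrow> continuous_on UNIV (rem Z)"
  unfolding rem_def[abs_def]
  by (intro continuous_on_add continuous_on_mult lam_continuous smooth_fun_continuous ip_smooth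
      metric_trace_continuous[where B = "\<lambda>X Y p. ip p (nabla X Z) (nabla Y Z)"]
      endo_bitensorial endo_nabla nabla_vf)

text \<open>The first-order term is a divergence, because \<open>\<xi> + Z\<close> having the length of \<open>\<xi>\<close> makes
  \<open>g(\<xi>, Z)\<close> quadratic in \<open>Z\<close>.\<close>

lemma edens_expand:
  assumes [simp]: "Z \<in> vfields A" and len: "ip p (\<xi> + Z) (\<xi> + Z) = 1"
  shows "edens (\<xi> + Z) p = edens \<xi> p + 2 * divg (adj_tau Z) p + rem Z p"
proof -
  have q: "2 * ip p \<xi> Z = - ip p Z Z"
    using len by (simp add: ip_\<xi>_\<xi> ip_sym[of Z \<xi>])
  have "edens (\<xi> + Z) p = Tr p (\<lambda>E. (ip p E E + ip p (nabla E \<xi>) (nabla E \<xi>)) +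
      (2 * ip p (tau E) (nabla E Z) + ip p (nabla E Z) (nabla E Z)))"
    unfolding edens_Tr
  proof (rule Tr_cong)
    fix E assume [simp]: "E \<in> vfields A"
    show "ip p E E + ip p (nabla E (\<xi> + Z)) (nabla E (\<xi> + Z)) =
      (ip p E E + ip p (nabla E \<xi>) (nabla E \<xi>)) +
      (2 * ip p (tau E) (nabla E Z) + ip p (nabla E Z) (nabla E Z))"
      by (simp add: nabla_add tau_def ip_sym[of "nabla E Z" "nabla E \<xi>"])
  qed
  also have "\<dots> = edens \<xi> p + (2 * Tr p (\<lambda>E. ip p (tau E) (nabla E Z)) + Tr p (\<lambda>E. ip p (nabla E Z) (nabla E Z)))"
    by (simp only: Tr_simps edens_Tr)
  also have "Tr p (\<lambda>E. ip p (tau E) (nabla E Z)) = divg (adj_tau Z) p - ip p \<xi> Z * lam p"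
    by (simp add: divg_adj_tau)
  also have "2 * (divg (adj_tau Z) p - ip p \<xi> Z * lam p) = 2 * divg (adj_tau Z) p + lam p * ip p Z Z"
  proof -
    have "2 * (divg (adj_tau Z) p - ip p \<xi> Z * lam p) = 2 * divg (adj_tau Z) p - (2 * ip p \<xi> Z) * lam p"
      by (simp add: algebra_simps)
    then show ?thesis unfolding q by (simp add: mult.commute)
  qed
  finally show ?thesis by (simp only: rem_def metric_trace_Tr add.assoc)
qed

lemma rem_zero:
  assumes Z: "Z \<in> vfields A" and M: "open M" "p \<in> M" "\<And>q. q \<in> M \<Longrightarrow> Z q = 0"
  shows "rem Z p = 0"
proof -
  have "nabla (fr p i) Z p = 0" for i
    using nabla_local[OF fr_vf Z vf_zero M(1,2), of p i] M(3)
    by (simp add: fun_zero_app nabla_zero fr_vf)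
  then show ?thesis
    using M by (simp add: rem_def metric_trace_fr ip_def g_zero ts_zero)
qed

text \<open>Components and first derivatives of W t - \<xi> are of order t, and \<open>rem\<close>
  is quadratic in them. With \<open>lam\<close> bounded on a compact set, this gives order t^2
  uniformly near \<open>p0\<close>.\<close>

lemma rem_bound_local:
  assumes var: "length_variation A g r D \<xi> e W"
  shows "\<exists>M C. open M \<and> p0 \<in> M \<and> C \<ge> 0 \<and>
    (\<forall>t. \<bar>t\<bar> \<le> e/2 \<longrightarrow> (\<forall>p\<in>M. \<bar>rem (W t - \<xi>) p\<bar> \<le> C * t\<^sup>2))"
proof -
  have e: "e > 0" and Wv: "\<And>t. \<bar>t\<bar> < e \<Longrightarrow> W t \<in> vfields A"
    using length_variationD[OF var] by auto
  obtain U x where c: "(U, x) \<in> A" "p0 \<in> U" by (rule chart_at)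
  obtain \<beta> N C where "volume_coords A g nabla vol U x \<beta> N C" and p0: "p0 \<in> N"
    by (rule volume_coords_at[OF c])
  then interpret volume_coords A g nabla vol U x \<beta> N C by simp
  obtain b M K where M: "smooth_fun A b" "open M" "p0 \<in> M" "M \<subseteq> K" "compact K" "K \<subseteq> U" "K \<subseteq> N"
    by (rule bump_at[OF c p0 N(1)]) blast
  obtain B1 where B10: "B1 \<ge> 0" and B11: "\<forall>p\<in>K. \<forall>Z\<in>vfields A. \<forall>a. (\<forall>k. \<bar>Z p (xh k)\<bar> \<le> a) \<longrightarrow>
    (\<forall>j k. \<bar>dh j p (\<lambda>q. Z q (xh k))\<bar> \<le> a) \<longrightarrow>
    \<bar>g p (Z p) (Z p)\<bar> \<le> B1 * a\<^sup>2 \<and>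
    \<bar>metric_trace A g (\<lambda>X Y p. ip p (nabla X Z) (nabla Y Z)) p\<bar> \<le> B1 * a\<^sup>2"
    using gradient_bound[OF M(5,7)] by (elim exE conjE)
  note B1 = B10 B11[THEN bspec, THEN bspec, THEN spec, THEN mp, THEN mp]
  obtain B2 where B20: "B2 \<ge> 0" and B21: "\<forall>t. \<bar>t\<bar> \<le> e/2 \<longrightarrow> (\<forall>p\<in>K. \<forall>k.
      \<bar>(W t - \<xi>) p (xh k)\<bar> \<le> B2 * \<bar>t\<bar> \<and> (\<forall>j. \<bar>dh j p (\<lambda>q. (W t - \<xi>) q (xh k))\<bar> \<le> B2 * \<bar>t\<bar>))"
    using variation_component_bound[OF var M(5,7)] by (elim exE conjE)
  note B2 = B20 conjunct1[OF B21[THEN spec, THEN mp, THEN bspec, THEN spec]]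
    spec[OF conjunct2[OF B21[THEN spec, THEN mp, THEN bspec, THEN spec]]]
  have "bounded (lam ` K)"
    by (intro compact_imp_bounded compact_continuous_image continuous_on_subset[OF lam_continuous] M(5)) simp
  then obtain L where L: "\<And>p. p \<in> K \<Longrightarrow> \<bar>lam p\<bar> \<le> L" unfolding bounded_iff by auto
  have "\<bar>rem (W t - \<xi>) p\<bar> \<le> ((\<bar>L\<bar> + 1) * B1 * B2\<^sup>2) * t\<^sup>2" if t: "\<bar>t\<bar> \<le> e/2" and p: "p \<in> M" for t p
  proof -
    have pK: "p \<in> K" using p M(4) by blast
    have "W t - \<xi> \<in> vfields A" using t e by (intro vf_diff Wv \<xi>_vf) linarith
    from B1(2)[OF pK this, of "B2 * \<bar>t\<bar>", OF allI[OF B2(2)[OF t pK]] allI[OF allI[OF B2(3)[OF t pK]]]]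
    have b: "\<bar>ip p (W t - \<xi>) (W t - \<xi>)\<bar> \<le> B1 * B2\<^sup>2 * t\<^sup>2"
      "\<bar>metric_trace A g (\<lambda>X Y p. ip p (nabla X (W t - \<xi>)) (nabla Y (W t - \<xi>))) p\<bar> \<le> B1 * B2\<^sup>2 * t\<^sup>2"
      by (simp_all add: ip_def power_mult_distrib mult.assoc)
    have "\<bar>lam p * ip p (W t - \<xi>) (W t - \<xi>)\<bar> \<le> \<bar>L\<bar> * (B1 * B2\<^sup>2 * t\<^sup>2)"
      unfolding abs_mult using L[OF pK] b(1) by (intro mult_mono) auto
    then have "\<bar>rem (W t - \<xi>) p\<bar> \<le> \<bar>L\<bar> * (B1 * B2\<^sup>2 * t\<^sup>2) + B1 * B2\<^sup>2 * t\<^sup>2"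
      unfolding rem_def using b(2) by linarith
    then show ?thesis by (simp add: algebra_simps)
  qed
  moreover have "(\<bar>L\<bar> + 1) * B1 * B2\<^sup>2 \<ge> 0" using B1(1) by simp
  ultimately show ?thesis using M(2,3) by blast
qed

lemma rem_bound:
  assumes var: "length_variation A g r D \<xi> e W" and K: "compact K"
  shows "\<exists>C\<ge>0. \<forall>t. \<bar>t\<bar> \<le> e/2 \<longrightarrow> (\<forall>p\<in>K. \<bar>rem (W t - \<xi>) p\<bar> \<le> C * t\<^sup>2)"
proof -
  obtain M C where M: "\<And>p. open (M p)" "\<And>p. p \<in> M p" "\<And>p. C p \<ge> (0::real)"
    "\<And>p0 t p. \<bar>t\<bar> \<le> e/2 \<Longrightarrow> p \<in> M p0 \<Longrightarrow> \<bar>rem (W t - \<xi>) p\<bar> \<le> C p0 * t\<^sup>2"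
    using rem_bound_local[OF var] by metis
  have "K \<subseteq> (\<Union>p\<in>K. M p)" using M(2) by blast
  then obtain I where I: "finite I" "K \<subseteq> (\<Union>p\<in>I. M p)"
    using compactE_image[OF K, of K M] M(1) by metis
  have "\<bar>rem (W t - \<xi>) p\<bar> \<le> (\<Sum>p\<in>I. C p) * t\<^sup>2" if t: "\<bar>t\<bar> \<le> e/2" and p: "p \<in> K" for t p
  proof -
    obtain p0 where p0: "p0 \<in> I" "p \<in> M p0" using p I(2) by blast
    have "\<bar>rem (W t - \<xi>) p\<bar> \<le> C p0 * t\<^sup>2" by (rule M(4)[OF t p0(2)])
    also have "\<dots> \<le> (\<Sum>p\<in>I. C p) * t\<^sup>2"
      using member_le_sum[OF p0(1), of C] M(3) I(1) by (intro mult_right_mono) auto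
    finally show ?thesis .
  qed
  moreover have "(\<Sum>p\<in>I. C p) \<ge> 0" using M(3) by (simp add: sum_nonneg)
  ultimately show ?thesis by blast
qed

lemma energy_critical:
  assumes D: "open D" "compact (closure D)" and var: "length_variation A g 1 D \<xi> e W"
  shows "((\<lambda>t. energy A g nabla vol D (W t)) has_real_derivative 0) (at 0)"
proof -
  have e: "e > 0" and W0: "W 0 = \<xi>" and Wv: "\<And>t. \<bar>t\<bar> < e \<Longrightarrow> W t \<in> vfields A"
    and len: "\<And>t p. \<bar>t\<bar> < e \<Longrightarrow> g p (W t p) (W t p) = 1"
    using length_variationD[OF var] by auto
  obtain K where K: "compact K" "K \<subseteq> D" "\<And>t p. \<bar>t\<bar> < e \<Longrightarrow> p \<notin> K \<Longrightarrow> W t p = \<xi> p"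
    using length_variationD(6)[OF var] by auto
  have Ko: "open (- K)" using compact_imp_closed[OF K(1)] by auto
  obtain C where C: "C \<ge> 0" "\<And>t p. \<bar>t\<bar> \<le> e/2 \<Longrightarrow> p \<in> K \<Longrightarrow> \<bar>rem (W t - \<xi>) p\<bar> \<le> C * t\<^sup>2"
    using rem_bound[OF var K(1)] by metis
  have Dm: "D \<in> sets vol" using D(1) by (simp add: sets_vol)
  have Dfin: "emeasure vol D < \<infinity>"
    using compact_finite[OF D(2)] emeasure_mono[OF closure_subset[of D], of vol]
    by (simp add: sets_vol)
  have "\<bar>energy A g nabla vol D (W t) - energy A g nabla vol D (W 0)\<bar> \<le> (1/2 * C * measure vol D) * t\<^sup>2"
    if t: "\<bar>t\<bar> < e/2" for t
  proof -
    have te: "\<bar>t\<bar> < e" and t': "\<bar>t\<bar> \<le> e/2" using t e by linarith+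
    define Z where "Z = W t - \<xi>"
    have Z[simp]: "Z \<in> vfields A" unfolding Z_def by (intro vf_diff Wv te \<xi>_vf)
    have WZ: "W t = \<xi> + Z" by (simp add: Z_def)
    have Z0: "Z q = 0" if "q \<notin> K" for q using K(3)[OF te that] by (simp add: Z_def minus_apply)
    \<comment> \<open>Through the duality \<open>ip_adj_tau\<close> the field depends on Z
      pointwise, so it inherits the compact support required by the divergence theorem.\<close>
    have supp: "adj_tau Z q = 0" if "q \<notin> K" for q
    proof (rule ip_nondeg[OF adj_tau_vf[OF Z]])
      fix V assume V: "V \<in> vfields A"
      then show "ip q (adj_tau Z) V = 0"
        using Z0[of q] that by (simp add: ip_adj_tau ip_def[of q _ Z] g_zero vf_T)
    qed
    have "divg (adj_tau Z) p = 0" if "p \<notin> K" for p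
      by (rule divg_zero_near[OF adj_tau_vf[OF Z] Ko]) (use that supp in auto)
    \<comment> \<open>The divergence is supported in \<open>K\<close>, hence inside
      \<open>D\<close>, so its integral over \<open>D\<close> is the integral over the whole
      manifold.\<close>
    then have div_D: "(\<lambda>p. indicator D p *\<^sub>R divg (adj_tau Z) p) = divg (adj_tau Z)"
      using K(2) by (intro ext) (metis indicator_simps(1) indicator_simps(2) scaleR_one scaleR_zero_left scaleR_zero_right subsetD)
    have dt: "integrable vol (divg (adj_tau Z))" "integral\<^sup>L vol (divg (adj_tau Z)) = 0"
      using divergence_theorem[OF adj_tau_vf[OF Z] K(1)] supp by blast+
    have int_div: "set_integrable vol D (divg (adj_tau Z))" "(LINT p:D|vol. divg (adj_tau Z) p) = 0"
      by (simp_all only: set_integrable_def set_lebesgue_integral_def div_D dt)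
    have int_rem: "set_integrable vol D (rem Z)"
      by (rule set_integrable_continuous[OF rem_continuous[OF Z] D])
    have int_\<xi>: "set_integrable vol D (edens \<xi>)"
      by (rule set_integrable_continuous[OF edens_continuous[OF \<xi>_vf] D])
    have "edens (W t) p = edens \<xi> p + 2 * divg (adj_tau Z) p + rem Z p" for p
      unfolding WZ by (rule edens_expand[OF Z]) (use len[OF te, of p] WZ in \<open>simp add: ip_def del: ip_simps\<close>)
    then have "(LINT p:D|vol. edens (W t) p) =
        (LINT p:D|vol. (edens \<xi> p + 2 * divg (adj_tau Z) p) + rem Z p)" by simp
    also have "\<dots> = (LINT p:D|vol. edens \<xi> p) + 2 * (LINT p:D|vol. divg (adj_tau Z) p) + (LINT p:D|vol. rem Z p)"
      using int_div(1) int_rem int_\<xi> by (simp add: set_integral_add)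
    finally have diff: "(LINT p:D|vol. edens (W t) p) - (LINT p:D|vol. edens (W 0) p) = (LINT p:D|vol. rem Z p)"
      by (simp add: int_div(2) W0)
    have rb: "\<bar>rem Z p\<bar> \<le> C * t\<^sup>2" for p
    proof (cases "p \<in> K")
      case True
      then show ?thesis using C(2)[OF t'] by (simp add: Z_def)
    next
      case False
      then have "rem Z p = 0" by (intro rem_zero[OF Z Ko]) (auto simp: Z0)
      then show ?thesis using C(1) by simp
    qed
    have "\<bar>LINT p:D|vol. rem Z p\<bar> \<le> (LINT p:D|vol. C * t\<^sup>2)"
    proof -
      have "\<bar>LINT p:D|vol. rem Z p\<bar> \<le> (LINT p|vol. \<bar>indicator D p *\<^sub>R rem Z p\<bar>)"
        unfolding set_lebesgue_integral_def by (rule integral_abs_bound)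
      also have "\<dots> \<le> (LINT p:D|vol. C * t\<^sup>2)"
        unfolding set_lebesgue_integral_def
      proof (rule integral_mono)
        show "integrable vol (\<lambda>p. \<bar>indicator D p *\<^sub>R rem Z p\<bar>)"
          using int_rem unfolding set_integrable_def by (rule integrable_abs)
        show "integrable vol (\<lambda>p. indicator D p *\<^sub>R (C * t\<^sup>2))"
          using Dm Dfin by (intro integrable_scaleR_left) (simp add: integrable_indicator_iff space_vol)
        fix p show "\<bar>indicator D p *\<^sub>R rem Z p\<bar> \<le> indicator D p *\<^sub>R (C * t\<^sup>2)"
          using rb[of p] by (cases "p \<in> D") auto
      qed
      finally show ?thesis .
    qed
    also have "\<dots> = measure vol D * (C * t\<^sup>2)"
      unfolding set_lebesgue_integral_def using Dm Dfin by (simp add: space_vol)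
    finally have "\<bar>LINT p:D|vol. rem Z p\<bar> \<le> measure vol D * (C * t\<^sup>2)" .
    moreover have en: "energy A g nabla vol D (W s) = 1/2 * (LINT p:D|vol. edens (W s) p)" for s
      by (simp add: energy_def edens_def)
    have "energy A g nabla vol D (W t) - energy A g nabla vol D (W 0) = 1/2 * (LINT p:D|vol. rem Z p)"
      unfolding en using diff by linarith
    then have "\<bar>energy A g nabla vol D (W t) - energy A g nabla vol D (W 0)\<bar> =
        1/2 * \<bar>LINT p:D|vol. rem Z p\<bar>"
      by linarith
    ultimately show ?thesis by (simp add: mult_ac)
  qed
  then show ?thesis
    by (rule has_real_derivative_0_of_quadratic[OF half_gt_zero[OF e]])
qed

theorem xi_harmonic: "harmonic_vector_field A g nabla vol \<xi>"
  unfolding harmonic_vector_field_def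
  using energy_critical ip_\<xi>_\<xi> by (intro conjI exI[of _ 1] \<xi>_vf) (auto simp: ip_def)

theorem xi_harmonic_map: "defines_harmonic_map A g nabla vol \<xi>"
proof -
  have "metric_trace A g (\<lambda>X Y. R (nabla X \<xi>) \<xi> Y) p = 0" for p
  proof (rule g_nondeg)
    let ?v = "metric_trace A g (\<lambda>X Y. R (nabla X \<xi>) \<xi> Y) p"
    have v: "?v = (\<Sum>i\<in>UNIV. \<epsilon> p i *\<^sub>R R (tau (fr p i)) \<xi> (fr p i) p)"
      by (simp add: metric_trace_fr tau_def)
    then show "?v \<in> T p" by (simp add: ts_sum ts_scale vf_T)
    fix w assume "w \<in> T p"
    then obtain Z where Z: "Z \<in> vfields A" "Z p = w" by (rule tangent_extend)
    have "g p ?v w = Tr p (\<lambda>E. ip p (R (tau E) \<xi> E) Z)"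
      using Z by (simp add: v g_sum g_scale vf_T ts_scale Tr_def ip_def flip: Z(2))
    then show "g p ?v w = 0" using Tr_curvature[OF Z(1)] by simp
  qed
  then show ?thesis
    unfolding defines_harmonic_map_def using xi_harmonic ip_\<xi>_\<xi> by (simp add: ip_def)
qed

end

theorem theorem4p3:
  fixes A :: "('a::{t2_space,second_countable_topology}, 'n::finite) chart set"
    and n :: nat
    and \<phi> :: "'a \<Rightarrow> 'a tvec \<Rightarrow> 'a tvec"
    and \<xi> :: "'a vfield"
    and \<eta> :: "'a \<Rightarrow> 'a tvec \<Rightarrow> real"
    and g :: "'a \<Rightarrow> 'a tvec \<Rightarrow> 'a tvec \<Rightarrow> real"
    and nabla :: "'a vfield \<Rightarrow> 'a vfield \<Rightarrow> 'a vfield"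
    and vol :: "'a measure"
    and \<kappa> \<mu> :: "'a \<Rightarrow> real"
  assumes "levi_civita A g nabla"
    and "volume_measure A g vol"
    and "kappa_mu_space A n \<phi> \<xi> \<eta> g nabla \<kappa> \<mu>"
  shows "H_paracontact A n \<phi> \<xi> \<eta> g nabla vol \<and>
    ((\<forall>p. \<kappa> p \<noteq> -1) \<longrightarrow> defines_harmonic_map A g nabla vol \<xi>)"
proof -
  have pmm: "paracontact_metric_manifold A n \<phi> \<xi> \<eta> g"
    using assms(3) by (simp add: kappa_mu_space_def)
  interpret kappa_mu_volume A g nabla n \<phi> \<xi> \<eta> \<kappa> \<mu> vol
    using assms pmm
    by unfold_locales (simp_all add: paracontact_metric_manifold_def)
  show ?thesis
    using pmm xi_harmonic xi_harmonic_map by (simp add: H_paracontact_def)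
qed

end
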